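(* Consider the sparse matrix polynomial optimization problem $$f_{\min}=\min_{x\in\mathbb{R}^n}\ f(x)=f_1(x_{\Delta_1})+\cdots+f_m(x_{\Delta_m})\quad\text{s.t.}\quad G_i(x_{\Delta_i})\succeq 0,\ i=1,\ldots,m.$$ Suppose $u$ is a minimizer of this problem and the first order optimality condition holds at $u$: there exist $\Lambda_i\in\mathcal{S}^{\ell_i}$, $i\in[m]$, such that $$\nabla f(u)=\sum_{i=1}^m\nabla G_i(u_{\Delta_i})^*[\Lambda_i],\qquad \Lambda_i\succeq0,\quad G_i(u_{\Delta_i})\succeq0,\quad \langle\Lambda_i,G_i(u_{\Delta_i})\rangle=0,\quad i\in[m].$$ Assume each $f_i$ is convex and each $G_i\in\mathcal{S}\mathbb{R}[x_{\Delta_i}]^{\ell_i\times\ell_i}$ is concave. Then: (i) There exist sparse polynomials $p_i\in\mathbb{R}[x_{\Delta_i}]$ such that $$p_1+\cdots+p_m+f_{\min}=0,\qquad f_i+p_i\ge0\ \text{on}\ K_{\Delta_i},\quad i=1,\ldots,m.$$ (ii) Suppose each $\mathrm{QM}_{\Delta_i}[G_i]$ is archimedean. Assume that for each $i$, the nondegeneracy condition for $G_i$ holds at $u_{\Delta_i}$, $\mathrm{rank}\,G_i(u_{\Delta_i})+\mathrm{rank}\,\Lambda_i=\ell_i$, and $$v^T\big(\nabla^2_{x_{\Delta_i}}\mathcal{L}_i(u)+H_i\big)v>0\qquad\forall\,0\ne v\in\mathcal{N}_i.$$ Then the sparse matrix Moment-SOS hierarchy is tight and $f-f_{\min}\in\mathrm{QM}[G]_{spa,2k}$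 for all $k$ big enough.
   Context: Let $[m]=\{1,\ldots,m\}$. $\Delta_1,\ldots,\Delta_m$ are subsets of $[n]$ with $\Delta_1\cup\cdots\cup\Delta_m=[n]$; $n_i=|\Delta_i|$. For $x\in\mathbb{R}^n$, $x_{\Delta_i}=(x_j)_{j\in\Delta_i}$. $\mathbb{R}[x_{\Delta_i}]$ is the ring of real polynomials in $x_{\Delta_i}$, with $\mathbb{R}[x_{\Delta_i}]_d$ the polynomials of degree at most $d$. $\mathcal{S}^\ell$ is the space of real symmetric $\ell\times\ell$ matrices with $\langle X,Y\rangle=\mathrm{trace}(XY)$, and $\mathcal{S}\mathbb{R}[x_{\Delta_i}]^{\ell\times\ell}$ the set of symmetric $\ell\times\ell$ matrices with entries in $\mathbb{R}[x_{\Delta_i}]$. $X\succeq0$ means positive semidefinite; $X\preceq Y$ means $Y-X\succeq0$. Each $f_i\in\mathbb{R}[x_{\Delta_i}]$ and $G_i\in\mathcal{S}\mathbb{R}[x_{\Delta_i}]^{\ell_i\times\ell_i}$; $\deg(G_i)$ is the maximum degree of its entries. $K_{\Delta_i}=\{x_{\Delta_i}\in\mathbb{R}^{n_i}:G_i(x_{\Delta_i})\succeq0\}$ and $K=\{x\in\mathbb{R}^n:G_i(x_{\Delta_i})\succeq0,\ i\in[m]\}$. A minimizer is a point $u\in K$ with $f(u)=f_{\min}$. Convexity: a symmetric matrix polynomial $P$ is convex (over the whole space) if $P(\lambda a+(1-\lambda)b)\preceq\lambda P(a)+(1-\lambda)P(b)$ for all $a,b$ and $0\le\lambda\le1$; $P$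 is concave if $-P$ is convex. Derivatives: for a symmetric matrix polynomial $G$, $\nabla G(x)[d]=\sum_j d_j\nabla_{x_j}G(x)$ with $\nabla_{x_j}G=\partial G/\partial x_j$, and the adjoint is $\nabla G(x)^*[X]=\big(\langle\nabla_{x_j}G(x),X\rangle\big)_j$. In the first order optimality condition, $\nabla G_i(u_{\Delta_i})^*[\Lambda_i]$ is viewed in $\mathbb{R}^n$, with $G_i$ regarded as a function of $x\in\mathbb{R}^n$ (zero entries for $j\notin\Delta_i$). Nondegeneracy condition for $G\in\mathcal{S}\mathbb{R}[x]^{\ell\times\ell}$ at $u$ with $G(u)\succeq0$: $\mathrm{Im}\,\nabla G(u)+T=\mathcal{S}^\ell$, where $\mathrm{Im}\,\nabla G(u)$ is the image of the linear map $\nabla G(u)$ and $T=\{X\in\mathcal{S}^\ell: v^TXv=0\ \forall v\in\ker G(u)\}$. For the given multipliers $\Lambda_i$: $\mathcal{L}_i(x)=f_i(x_{\Delta_i})-\langle\Lambda_i,G_i(x_{\Delta_i})\rangle$, and $\nabla^2_{x_{\Delta_i}}\mathcal{L}_i$ is its Hessian in $x_{\Delta_i}$. $H_i$ is the symmetric $n_i\times n_i$ matrix with entries, for $s,t\in\Delta_i$, $$(H_i)_{st}=2\big\langle\Lambda_i,\ \nabla_{x_s}G_i(u_{\Delta_i})\,G_i(u_{\Delta_i})^\dagger\,\nabla_{x_t}G_i(u_{\Delta_i})\big\rangle,$$ where $\dagger$ is the Moore–Penrose inverse and, for these (possibly non-symmetric) matrices, $\langle X,Y\rangle=\mathrm{trace}(XY)$.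 Further, $$\mathcal{N}_i=\Big\{v=(v_j)_{j\in\Delta_i}:\ \sum_{j\in\Delta_i}v_j\,E^T\nabla_{x_j}G_i(u_{\Delta_i})E=0\Big\},$$ where the columns of $E$ form a basis of $\ker G_i(u_{\Delta_i})$. Quadratic modules: $\Sigma[x_{\Delta_i}]$ is the set of sums of squares in $\mathbb{R}[x_{\Delta_i}]$, $\Sigma[x_{\Delta_i}]_{2k}=\Sigma[x_{\Delta_i}]\cap\mathbb{R}[x_{\Delta_i}]_{2k}$, $$\mathrm{QM}_{\Delta_i}[G_i]=\Sigma[x_{\Delta_i}]+\Big\{\sum_{j=1}^sP_j^TG_iP_j: s\in\mathbb{N},\ P_j\in\mathbb{R}[x_{\Delta_i}]^{\ell_i}\Big\},$$ $$\mathrm{QM}_{\Delta_i}[G_i]_{2k}=\Sigma[x_{\Delta_i}]_{2k}+\Big\{\sum_{j=1}^sP_j^TG_iP_j: s\in\mathbb{N},\ P_j\in\mathbb{R}[x_{\Delta_i}]^{\ell_i},\ 2\deg(P_j)+\deg(G_i)\le2k\Big\},$$ and $\mathrm{QM}[G]_{spa,2k}=\sum_{i=1}^m\mathrm{QM}_{\Delta_i}[G_i]_{2k}$. $\mathrm{QM}_{\Delta_i}[G_i]$ is archimedean if $R-\|x_{\Delta_i}\|^2\in\mathrm{QM}_{\Delta_i}[G_i]$ for some $R>0$. Sparse matrix Moment-SOS hierarchy: for integers $k\ge k_0:=\max_{i\in[m]}(\lceil\deg(f_i)/2\rceil,\lceil\deg(G_i)/2\rceil)$, let $f_k^{spa}=\sup\{\gamma:f-\gamma\in\mathrm{QM}[G]_{spa,2k}\}$,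 and let $f_k^{smo}$ be the optimal value of $$\min_{y\in\mathbb{R}^{\mathbb{U}_k}}\ \sum_{i=1}^m\langle f_i,y_{\Delta_i}\rangle\quad\text{s.t.}\quad L^{(k)}_{G_i}[y_{\Delta_i}]\succeq0,\ M^{(k)}_{\Delta_i}[y_{\Delta_i}]\succeq0\ (i\in[m]),\ y_0=1.$$ Here $\mathbb{N}^{\Delta_i}_d=\{\alpha\in\mathbb{N}^n:\alpha_j=0\ \forall j\notin\Delta_i,\ |\alpha|\le d\}$, $\mathbb{U}_k=\bigcup_i\mathbb{N}^{\Delta_i}_{2k}$, $y_{\Delta_i}=(y_\alpha)_{\alpha\in\mathbb{N}^{\Delta_i}_{2k}}$, $[x_{\Delta_i}]_d=(x^\alpha)_{\alpha\in\mathbb{N}_d^{\Delta_i}}$; $\mathscr{L}_{y_{\Delta_i}}$ is the linear functional on $\mathbb{R}[x_{\Delta_i}]_{2k}$ with $\mathscr{L}_{y_{\Delta_i}}(x^\alpha)=y_\alpha$ and $\langle p,y_{\Delta_i}\rangle=\mathscr{L}_{y_{\Delta_i}}(p)$; $M^{(k)}_{\Delta_i}[y_{\Delta_i}]=\mathscr{L}_{y_{\Delta_i}}([x_{\Delta_i}]_k[x_{\Delta_i}]_k^T)$ entrywise; $L^{(k)}_{G_i}[y_{\Delta_i}]$ is the $\ell_i\times\ell_i$ block matrix with $(a,b)$ block $\mathscr{L}_{y_{\Delta_i}}((G_i)_{ab}[x_{\Delta_i}]_{k'}[x_{\Delta_i}]_{k'}^T)$, $k'=\lfloor k-\deg(G_i)/2\rfloor$.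 The hierarchy is called tight if $f_k^{spa}=f_{\min}$ for some $k$ and $f_k^{smo}=f_{\min}$ for some $k$. *)

theory Defs
  imports
    "HOL-Analysis.Analysis"
    "HOL-Library.Poly_Mapping"
    "HOL-Library.Extended_Real"
    "Jordan_Normal_Form.Matrix_Kernel"
    "Jordan_Normal_Form.DL_Rank"
begin

text \<open>
  Conventions. The coordinates are indexed by a finite type \<open>'n\<close>, so the ambient space is
  \<open>real ^ 'n\<close>. For a set \<open>\<Delta>\<close> of coordinates, the space of vectors indexed by \<open>\<Delta>\<close> is represented
  by its zero-padded copy \<open>coord_space \<Delta>\<close> in \<open>real ^ 'n\<close>. Matrices whose size varies with the
  block index are those of \<open>Jordan_Normal_Form\<close>.
\<close>

no_notation Matrix.vec_index (infixl \<open>$\<close> 100)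
no_notation Matrix.scalar_prod (infix \<open>\<bullet>\<close> 70)

subsection \<open>Polynomials\<close>

text \<open>The polynomial \<open>p\<close> is the finite sum of the terms \<open>Poly_Mapping.lookup p \<alpha>\<close> times \<open>x\<^sup>\<alpha>\<close>.\<close>

type_synonym 'n mpoly = "('n \<Rightarrow>\<^sub>0 nat) \<Rightarrow>\<^sub>0 real"

definition pmonom :: "('n \<Rightarrow>\<^sub>0 nat) \<Rightarrow> 'n mpoly" where
  "pmonom \<alpha> = Poly_Mapping.single \<alpha> 1"

definition pconst :: "real \<Rightarrow> 'n mpoly" where
  "pconst c = Poly_Mapping.single 0 c"

definition pvar :: "'n \<Rightarrow> 'n mpoly" where
  "pvar j = pmonom (Poly_Mapping.single j 1)"

definition mdeg :: "('n::finite \<Rightarrow>\<^sub>0 nat) \<Rightarrow> nat" where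
  "mdeg \<alpha> = (\<Sum>j\<in>UNIV. Poly_Mapping.lookup \<alpha> j)"

text \<open>The zero polynomial gets degree 0.\<close>

definition tdeg :: "('n::finite) mpoly \<Rightarrow> nat" where
  "tdeg p = Max (insert 0 (mdeg ` Poly_Mapping.keys p))"

definition vec_tdeg :: "('n::finite) mpoly Matrix.vec \<Rightarrow> nat" where
  "vec_tdeg P = Max (insert 0 (tdeg ` set\<^sub>v P))"

definition mat_tdeg :: "('n::finite) mpoly mat \<Rightarrow> nat" where
  "mat_tdeg G = Max (insert 0 (tdeg ` elements_mat G))"

definition peval :: "('n::finite) mpoly \<Rightarrow> real ^ 'n \<Rightarrow> real" where
  "peval p x = (\<Sum>\<alpha>\<in>Poly_Mapping.keys p. Poly_Mapping.lookup p \<alpha> * (\<Prod>j\<in>UNIV. (x $ j) ^ Poly_Mapping.lookup \<alpha> j))"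

definition mat_peval :: "('n::finite) mpoly mat \<Rightarrow> real ^ 'n \<Rightarrow> real mat" where
  "mat_peval G x = map_mat (\<lambda>p. peval p x) G"

definition polys :: "'n set \<Rightarrow> 'n mpoly set" where
  "polys \<Delta> = {p. \<forall>\<alpha>\<in>Poly_Mapping.keys p. Poly_Mapping.keys \<alpha> \<subseteq> \<Delta>}"

definition polys_upto :: "('n::finite) set \<Rightarrow> nat \<Rightarrow> 'n mpoly set" where
  "polys_upto \<Delta> d = {p \<in> polys \<Delta>. tdeg p \<le> d}"

definition poly_vecs :: "'n set \<Rightarrow> nat \<Rightarrow> 'n mpoly Matrix.vec set" where
  "poly_vecs \<Delta> l = {P \<in> carrier_vec l. set\<^sub>v P \<subseteq> polys \<Delta>}"

definition sym_poly_mats :: "'n set \<Rightarrow> nat \<Rightarrow> 'n mpoly mat set" where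
  "sym_poly_mats \<Delta> l =
    {G \<in> carrier_mat l l. transpose_mat G = G \<and> elements_mat G \<subseteq> polys \<Delta>}"

definition coord_space :: "'n set \<Rightarrow> (real ^ 'n) set" where
  "coord_space \<Delta> = {x. \<forall>j. j \<notin> \<Delta> \<longrightarrow> x $ j = 0}"

definition coord_proj :: "'n set \<Rightarrow> real ^ 'n \<Rightarrow> real ^ 'n" where
  "coord_proj \<Delta> x = (\<chi> j. if j \<in> \<Delta> then x $ j else 0)"

subsection \<open>Real symmetric matrices\<close>

definition sym_mats :: "nat \<Rightarrow> real mat set" where
  "sym_mats l = {X \<in> carrier_mat l l. transpose_mat X = X}"

definition psd :: "real mat \<Rightarrow> bool" where
  "psd A \<longleftrightarrow> A \<in> sym_mats (dim_row A) \<and>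
    (\<forall>v \<in> carrier_vec (dim_row A). 0 \<le> scalar_prod v (A *\<^sub>v v))"

definition loewner_le :: "real mat \<Rightarrow> real mat \<Rightarrow> bool" where
  "loewner_le X Y \<longleftrightarrow> psd (Y - X)"

text \<open>Positive semidefiniteness of a matrix whose rows and columns are indexed by a finite set.\<close>

definition psd_on :: "'i set \<Rightarrow> ('i \<Rightarrow> 'i \<Rightarrow> real) \<Rightarrow> bool" where
  "psd_on I M \<longleftrightarrow> (\<forall>s\<in>I. \<forall>t\<in>I. M s t = M t s) \<and>
    (\<forall>v. 0 \<le> (\<Sum>s\<in>I. \<Sum>t\<in>I. v s * M s t * v t))"

text \<open>The pairing is \<open>trace (X * Y)\<close> also for non-symmetric arguments, without a transpose.\<close>

definition mat_trace :: "real mat \<Rightarrow> real" where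
  "mat_trace X = (\<Sum>a<dim_row X. X $$ (a, a))"

definition mat_inner :: "real mat \<Rightarrow> real mat \<Rightarrow> real" where
  "mat_inner X Y = mat_trace (X * Y)"

definition mat_rank :: "real mat \<Rightarrow> nat" where
  "mat_rank A = vec_space.rank (dim_row A) A"

definition is_moore_penrose :: "real mat \<Rightarrow> real mat \<Rightarrow> bool" where
  "is_moore_penrose A X \<longleftrightarrow> X \<in> carrier_mat (dim_col A) (dim_row A) \<and>
    A * X * A = A \<and> X * A * X = X \<and>
    transpose_mat (A * X) = A * X \<and> transpose_mat (X * A) = X * A"

definition moore_penrose :: "real mat \<Rightarrow> real mat" where
  "moore_penrose A = (THE X. is_moore_penrose A X)"

definition is_kernel_basis :: "real mat \<Rightarrow> real mat \<Rightarrow> bool" where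
  "is_kernel_basis A E \<longleftrightarrow> dim_row E = dim_col A \<and> distinct (cols E) \<and>
    kernel.basis (dim_col A) A (set (cols E))"

definition kernel_basis :: "real mat \<Rightarrow> real mat" where
  "kernel_basis A = (SOME E. is_kernel_basis A E)"

lemma is_kernel_basis_kernel_basis: "is_kernel_basis A (kernel_basis A)"
proof -
  have A: "A \<in> carrier_mat (dim_row A) (dim_col A)" by simp
  interpret kernel "dim_row A" "dim_col A" A by unfold_locales (rule A)
  obtain B where fin: "finite B" and B: "kernel.basis (dim_col A) A B"
    using kernel_basis_exists[OF A] by blast
  obtain bs where bs: "set bs = B" "distinct bs"
    using finite_distinct_list[OF fin] by blast
  have "B \<subseteq> mat_kernel A"
    using B unfolding Ker.basis_def by blast
  then have "set bs \<subseteq> carrier_vec (dim_col A)"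
    using bs(1) mat_kernel_carrier[OF A] by blast
  then have "cols (mat_of_cols (dim_col A) bs) = bs" by simp
  then have "is_kernel_basis A (mat_of_cols (dim_col A) bs)"
    unfolding is_kernel_basis_def using bs B by simp
  then show ?thesis unfolding kernel_basis_def by (rule someI)
qed

definition mat_convex_on :: "(real ^ 'n) set \<Rightarrow> (real ^ 'n \<Rightarrow> real mat) \<Rightarrow> bool" where
  "mat_convex_on S P \<longleftrightarrow> (\<forall>a\<in>S. \<forall>b\<in>S. \<forall>t. 0 \<le> t \<and> t \<le> 1 \<longrightarrow>
    loewner_le (P (t *\<^sub>R a + (1 - t) *\<^sub>R b)) (t \<cdot>\<^sub>m P a + (1 - t) \<cdot>\<^sub>m P b))"

definition mat_concave_on :: "(real ^ 'n) set \<Rightarrow> (real ^ 'n \<Rightarrow> real mat) \<Rightarrow> bool" where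
  "mat_concave_on S P \<longleftrightarrow> mat_convex_on S (\<lambda>x. - P x)"

subsection \<open>Derivatives\<close>

definition partial :: "'n \<Rightarrow> (real ^ 'n \<Rightarrow> real) \<Rightarrow> real ^ 'n \<Rightarrow> real" where
  "partial j F x = deriv (\<lambda>t. F (x + t *\<^sub>R axis j 1)) 0"

definition gradient :: "(real ^ 'n \<Rightarrow> real) \<Rightarrow> real ^ 'n \<Rightarrow> real ^ 'n" where
  "gradient F x = (\<chi> j. partial j F x)"

definition hessian :: "(real ^ 'n \<Rightarrow> real) \<Rightarrow> real ^ 'n \<Rightarrow> real ^ 'n ^ 'n" where
  "hessian F x = (\<chi> s t. partial s (partial t F) x)"

definition mat_partial :: "'n \<Rightarrow> ('n::finite) mpoly mat \<Rightarrow> real ^ 'n \<Rightarrow> real mat" where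
  "mat_partial j G x = map_mat (\<lambda>p. partial j (peval p) x) G"

definition nabla :: "('n::finite) set \<Rightarrow> 'n mpoly mat \<Rightarrow> real ^ 'n \<Rightarrow> real ^ 'n \<Rightarrow> real mat" where
  "nabla \<Delta> G x d = Matrix.mat (dim_row G) (dim_col G)
    (\<lambda>ab. \<Sum>j\<in>\<Delta>. d $ j * mat_partial j G x $$ ab)"

text \<open>The adjoint, as a vector of the whole space: if the entries of \<open>G\<close> lie in \<open>polys \<Delta>\<close>,
  the components outside \<open>\<Delta>\<close> vanish.\<close>

definition nabla_adj :: "('n::finite) mpoly mat \<Rightarrow> real ^ 'n \<Rightarrow> real mat \<Rightarrow> real ^ 'n" where
  "nabla_adj G x X = (\<chi> j. mat_inner (mat_partial j G x) X)"

subsection \<open>Optimality conditions\<close>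

definition block_feasible :: "('n::finite) set \<Rightarrow> 'n mpoly mat \<Rightarrow> (real ^ 'n) set" where
  "block_feasible \<Delta> G = {z \<in> coord_space \<Delta>. psd (mat_peval G z)}"

definition feasible ::
    "nat \<Rightarrow> (nat \<Rightarrow> ('n::finite) set) \<Rightarrow> (nat \<Rightarrow> 'n mpoly mat) \<Rightarrow> (real ^ 'n) set" where
  "feasible m \<Delta> G = {x. \<forall>i\<in>{1..m}. psd (mat_peval (G i) (coord_proj (\<Delta> i) x))}"

definition first_order_optimality ::
    "nat \<Rightarrow> (nat \<Rightarrow> ('n::finite) set) \<Rightarrow> (nat \<Rightarrow> 'n mpoly) \<Rightarrow> (nat \<Rightarrow> 'n mpoly mat) \<Rightarrow>
      real ^ 'n \<Rightarrow> (nat \<Rightarrow> real mat) \<Rightarrow> bool" where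
  "first_order_optimality m \<Delta> f G u \<Lambda> \<longleftrightarrow>
    gradient (peval (\<Sum>i=1..m. f i)) u = (\<Sum>i=1..m. nabla_adj (G i) (coord_proj (\<Delta> i) u) (\<Lambda> i)) \<and>
    (\<forall>i\<in>{1..m}. \<Lambda> i \<in> sym_mats (dim_row (G i)) \<and> psd (\<Lambda> i) \<and>
      psd (mat_peval (G i) (coord_proj (\<Delta> i) u)) \<and>
      mat_inner (\<Lambda> i) (mat_peval (G i) (coord_proj (\<Delta> i) u)) = 0)"

definition nondegenerate :: "('n::finite) set \<Rightarrow> 'n mpoly mat \<Rightarrow> real ^ 'n \<Rightarrow> bool" where
  "nondegenerate \<Delta> G u \<longleftrightarrow>
    (let T = {X \<in> sym_mats (dim_row G).
                \<forall>v \<in> mat_kernel (mat_peval G u). scalar_prod v (X *\<^sub>v v) = 0}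
     in {Y + X |Y X. Y \<in> nabla \<Delta> G u ` coord_space \<Delta> \<and> X \<in> T} = sym_mats (dim_row G))"

definition lagrangian ::
    "('n::finite) set \<Rightarrow> 'n mpoly \<Rightarrow> 'n mpoly mat \<Rightarrow> real mat \<Rightarrow> real ^ 'n \<Rightarrow> real" where
  "lagrangian \<Delta> f G \<Lambda> x = peval f (coord_proj \<Delta> x) - mat_inner \<Lambda> (mat_peval G (coord_proj \<Delta> x))"

text \<open>The matrices \<open>hessian\<close> and \<open>curvature\<close> are indexed by all coordinates; only their entries in
  \<open>\<Delta> \<times> \<Delta>\<close> are used below.\<close>

definition curvature ::
    "('n::finite) mpoly mat \<Rightarrow> real mat \<Rightarrow> real ^ 'n \<Rightarrow> real ^ 'n ^ 'n" where
  "curvature G \<Lambda> z = (\<chi> s t. 2 * mat_inner \<Lambda>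
    (mat_partial s G z * moore_penrose (mat_peval G z) * mat_partial t G z))"

text \<open>This set does not depend on the choice of the kernel basis: another basis replaces \<open>E\<close> by
  \<open>E * S\<close> with \<open>S\<close> invertible.\<close>

definition critical_space :: "('n::finite) set \<Rightarrow> 'n mpoly mat \<Rightarrow> real ^ 'n \<Rightarrow> (real ^ 'n) set" where
  "critical_space \<Delta> G z = (let E = kernel_basis (mat_peval G z) in
    {v \<in> coord_space \<Delta>.
      Matrix.mat (dim_col E) (dim_col E)
        (\<lambda>ab. \<Sum>j\<in>\<Delta>. v $ j * (transpose_mat E * mat_partial j G z * E) $$ ab)
      = 0\<^sub>m (dim_col E) (dim_col E)})"

definition second_order_sufficient ::
    "('n::finite) set \<Rightarrow> 'n mpoly \<Rightarrow> 'n mpoly mat \<Rightarrow> real mat \<Rightarrow> real ^ 'n \<Rightarrow> bool" where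
  "second_order_sufficient \<Delta> f G \<Lambda> u \<longleftrightarrow>
    (\<forall>v \<in> critical_space \<Delta> G (coord_proj \<Delta> u). v \<noteq> 0 \<longrightarrow>
      (\<Sum>s\<in>\<Delta>. \<Sum>t\<in>\<Delta>. v $ s *
        (hessian (lagrangian \<Delta> f G \<Lambda>) u + curvature G \<Lambda> (coord_proj \<Delta> u)) $ s $ t * v $ t) > 0)"

subsection \<open>Quadratic modules\<close>

definition sos :: "'n set \<Rightarrow> 'n mpoly set" where
  "sos \<Delta> = {\<Sum>j<s. (q j)\<^sup>2 |(s::nat) q. \<forall>j<s. q j \<in> polys \<Delta>}"

definition sos_upto :: "('n::finite) set \<Rightarrow> nat \<Rightarrow> 'n mpoly set" where
  "sos_upto \<Delta> d = sos \<Delta> \<inter> polys_upto \<Delta> d"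

definition qmodule :: "'n set \<Rightarrow> 'n mpoly mat \<Rightarrow> 'n mpoly set" where
  "qmodule \<Delta> G =
    {\<sigma> + (\<Sum>j<s. scalar_prod (P j) (G *\<^sub>v P j)) |\<sigma> (s::nat) P.
      \<sigma> \<in> sos \<Delta> \<and> (\<forall>j<s. P j \<in> poly_vecs \<Delta> (dim_row G))}"

text \<open>The argument \<open>d\<close> below is the full degree bound, i.e. \<open>2k\<close>.\<close>

definition qmodule_upto :: "('n::finite) set \<Rightarrow> 'n mpoly mat \<Rightarrow> nat \<Rightarrow> 'n mpoly set" where
  "qmodule_upto \<Delta> G d =
    {\<sigma> + (\<Sum>j<s. scalar_prod (P j) (G *\<^sub>v P j)) |\<sigma> (s::nat) P.
      \<sigma> \<in> sos_upto \<Delta> d \<and>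
      (\<forall>j<s. P j \<in> poly_vecs \<Delta> (dim_row G) \<and> 2 * vec_tdeg (P j) + mat_tdeg G \<le> d)}"

definition sparse_qmodule ::
    "nat \<Rightarrow> (nat \<Rightarrow> ('n::finite) set) \<Rightarrow> (nat \<Rightarrow> 'n mpoly mat) \<Rightarrow> nat \<Rightarrow> 'n mpoly set" where
  "sparse_qmodule m \<Delta> G d =
    {\<Sum>i=1..m. q i |q. \<forall>i\<in>{1..m}. q i \<in> qmodule_upto (\<Delta> i) (G i) d}"

definition archimedean_qmodule :: "'n set \<Rightarrow> 'n mpoly mat \<Rightarrow> bool" where
  "archimedean_qmodule \<Delta> G \<longleftrightarrow>
    (\<exists>R>0. pconst R - (\<Sum>j\<in>\<Delta>. (pvar j)\<^sup>2) \<in> qmodule \<Delta> G)"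

subsection \<open>The sparse matrix Moment-SOS hierarchy\<close>

definition min_order ::
    "nat \<Rightarrow> (nat \<Rightarrow> ('n::finite) mpoly) \<Rightarrow> (nat \<Rightarrow> 'n mpoly mat) \<Rightarrow> nat" where
  "min_order m f G =
    Max ((\<lambda>i. nat (max \<lceil>real (tdeg (f i)) / 2\<rceil> \<lceil>real (mat_tdeg (G i)) / 2\<rceil>)) ` {1..m})"

definition sos_value ::
    "nat \<Rightarrow> (nat \<Rightarrow> ('n::finite) set) \<Rightarrow> (nat \<Rightarrow> 'n mpoly) \<Rightarrow> (nat \<Rightarrow> 'n mpoly mat) \<Rightarrow> nat \<Rightarrow> ereal"
  where
  "sos_value m \<Delta> f G k =
    Sup (ereal ` {\<gamma>. (\<Sum>i=1..m. f i) - pconst \<gamma> \<in> sparse_qmodule m \<Delta> G (2 * k)})"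

definition expts :: "('n::finite) set \<Rightarrow> nat \<Rightarrow> ('n \<Rightarrow>\<^sub>0 nat) set" where
  "expts \<Delta> d = {\<alpha>. Poly_Mapping.keys \<alpha> \<subseteq> \<Delta> \<and> mdeg \<alpha> \<le> d}"

definition sparse_expts :: "nat \<Rightarrow> (nat \<Rightarrow> ('n::finite) set) \<Rightarrow> nat \<Rightarrow> ('n \<Rightarrow>\<^sub>0 nat) set" where
  "sparse_expts m \<Delta> k = (\<Union>i\<in>{1..m}. expts (\<Delta> i) (2 * k))"

definition riesz :: "(('n \<Rightarrow>\<^sub>0 nat) \<Rightarrow> real) \<Rightarrow> 'n mpoly \<Rightarrow> real" where
  "riesz y p = (\<Sum>\<alpha>\<in>Poly_Mapping.keys p. Poly_Mapping.lookup p \<alpha> * y \<alpha>)"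

definition moment_mat ::
    "(('n \<Rightarrow>\<^sub>0 nat) \<Rightarrow> real) \<Rightarrow> ('n \<Rightarrow>\<^sub>0 nat) \<Rightarrow> ('n \<Rightarrow>\<^sub>0 nat) \<Rightarrow> real" where
  "moment_mat y \<alpha> \<beta> = riesz y (pmonom \<alpha> * pmonom \<beta>)"

definition localizing_mat ::
    "'n mpoly mat \<Rightarrow> (('n \<Rightarrow>\<^sub>0 nat) \<Rightarrow> real) \<Rightarrow>
      nat \<times> ('n \<Rightarrow>\<^sub>0 nat) \<Rightarrow> nat \<times> ('n \<Rightarrow>\<^sub>0 nat) \<Rightarrow> real" where
  "localizing_mat G y = (\<lambda>(a, \<alpha>) (b, \<beta>). riesz y (G $$ (a, b) * (pmonom \<alpha> * pmonom \<beta>)))"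

definition localizing_order :: "('n::finite) mpoly mat \<Rightarrow> nat \<Rightarrow> nat" where
  "localizing_order G k = nat \<lfloor>real k - real (mat_tdeg G) / 2\<rfloor>"

definition sub_moments ::
    "('n::finite) set \<Rightarrow> nat \<Rightarrow> (('n \<Rightarrow>\<^sub>0 nat) \<Rightarrow> real) \<Rightarrow> (('n \<Rightarrow>\<^sub>0 nat) \<Rightarrow> real)" where
  "sub_moments \<Delta> k y = restrict y (expts \<Delta> (2 * k))"

definition moment_feasible ::
    "nat \<Rightarrow> (nat \<Rightarrow> ('n::finite) set) \<Rightarrow> (nat \<Rightarrow> 'n mpoly mat) \<Rightarrow> nat \<Rightarrow>
      (('n \<Rightarrow>\<^sub>0 nat) \<Rightarrow> real) set" where
  "moment_feasible m \<Delta> G k =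
    {y \<in> extensional (sparse_expts m \<Delta> k).
      (\<forall>i\<in>{1..m}.
        psd_on ({..<dim_row (G i)} \<times> expts (\<Delta> i) (localizing_order (G i) k))
          (localizing_mat (G i) (sub_moments (\<Delta> i) k y)) \<and>
        psd_on (expts (\<Delta> i) k) (moment_mat (sub_moments (\<Delta> i) k y))) \<and>
      y 0 = 1}"

definition moment_value ::
    "nat \<Rightarrow> (nat \<Rightarrow> ('n::finite) set) \<Rightarrow> (nat \<Rightarrow> 'n mpoly) \<Rightarrow> (nat \<Rightarrow> 'n mpoly mat) \<Rightarrow> nat \<Rightarrow> ereal"
  where
  "moment_value m \<Delta> f G k =
    Inf ((\<lambda>y. ereal (\<Sum>i=1..m. riesz (sub_moments (\<Delta> i) k y) (f i))) ` moment_feasible m \<Delta> G k)"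

definition hierarchy_tight ::
    "nat \<Rightarrow> (nat \<Rightarrow> ('n::finite) set) \<Rightarrow> (nat \<Rightarrow> 'n mpoly) \<Rightarrow> (nat \<Rightarrow> 'n mpoly mat) \<Rightarrow> real \<Rightarrow> bool"
  where
  "hierarchy_tight m \<Delta> f G fmin \<longleftrightarrow>
    (\<exists>k\<ge>min_order m f G. sos_value m \<Delta> f G k = ereal fmin) \<and>
    (\<exists>k\<ge>min_order m f G. moment_value m \<Delta> f G k = ereal fmin)"

end

theory Submission
  imports Defs
begin

text \<open>
  Both parts rest on one shifted polynomial per block. Let \<open>w\<close> be the projection of \<open>u\<close> to a
  block with objective \<open>f\<close>, constraint \<open>G\<close> and multiplier \<open>\<Lambda>\<close>. The Lagrangian
  \<open>f - \<langle>\<Lambda>, G\<rangle>\<close> is convex, since \<open>\<Lambda>\<close> is positive semidefinite and \<open>G\<close> is concave. Let \<open>F\<close>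
  be \<open>f\<close> minus the tangent of the Lagrangian at \<open>w\<close>. The first order condition makes these
  tangents add up to the constant \<open>fmin\<close>, so the sum of the \<open>F\<close> over the blocks is the objective
  minus \<open>fmin\<close>. Moreover \<open>F\<close> is the Lagrangian minus its tangent plus \<open>\<langle>\<Lambda>, G\<rangle>\<close>, and both terms
  are nonnegative on the feasible set of the block (\<open>shifted_objective_nonneg\<close>). This is the first
  part.

  For the second part it suffices that each \<open>F\<close> lies in the quadratic module of its block
  (\<open>shifted_objective_in_qmodule\<close>): the finitely many representations have bounded degree,
  evaluation at \<open>u\<close> bounds the sum of squares side from above, and the moments of the point mass
  at \<open>u\<close> are feasible on the other side (\<open>hierarchy_tight_if_certified\<close>).

  The difficulty is that \<open>F\<close> vanishes at \<open>w\<close>, where a Positivstellensatz for strictly positive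
  polynomials says nothing. The zero is removed by an explicit element of the module. Write
  \<open>\<Lambda> = (\<Sum>k. \<alpha>\<^sub>k \<alpha>\<^sub>k\<^sup>T)\<close>, let \<open>Q\<close> be the Moore-Penrose inverse of \<open>G(w)\<close> plus half of \<open>\<Lambda>\<close>, and
  put \<open>\<theta> = (\<Sum>k. P\<^sub>k\<^sup>T G P\<^sub>k)\<close> with \<open>P\<^sub>k(x) = \<alpha>\<^sub>k - Q \<nabla>G(w)[x - w] \<alpha>\<^sub>k\<close>. Then \<open>F - \<theta>\<close> vanishes
  to second order at \<open>w\<close>. With \<open>d\<^sub>k = \<nabla>G(w)[v] \<alpha>\<^sub>k\<close>, its second order part in direction \<open>v\<close> is
  half of the form of the second order condition (Hessian of the Lagrangian plus curvature matrix) at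
  \<open>v\<close>, plus \<open>\<Sum>k. d\<^sub>k\<^sup>T \<Lambda> d\<^sub>k\<close>. By convexity and semidefiniteness all of these terms are
  nonnegative. The last sum vanishes only if
  \<open>\<alpha>\<^sub>j\<^sup>T \<nabla>G(w)[v] \<alpha>\<^sub>k = 0\<close> for all \<open>j\<close>, \<open>k\<close>; as the \<open>\<alpha>\<^sub>k\<close> span the kernel of \<open>G(w)\<close> by strict
  complementarity, \<open>v\<close> is then a critical direction, and the second order condition applies. So the
  second order part of \<open>F - \<theta>\<close> is positive definite (\<open>R_pos\<close>).

  It remains to see that such an \<open>F\<close> belongs to an archimedean quadratic module whose nonnegativity
  set contains no other zero of \<open>F\<close> (\<open>nondegenerate_zero_in_module\<close>). Multiplying \<open>\<theta>\<close> by a high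
  even power of a polynomial that is 1 at \<open>w\<close> and smaller than 1 away from \<open>w\<close>, and adding to the
  second order part a large multiple of the matrix \<open>|y|\<^sup>2 I - y y\<^sup>T\<close> that annihilates
  \<open>y = x - w\<close>, one represents the remainder by \<open>y\<^sup>T M(x) y\<close> with \<open>M\<close> positive definite on the whole
  nonnegativity set. A matrix Positivstellensatz (\<open>archimedean_matrix_positivstellensatz\<close>) puts
  \<open>y\<^sup>T M(x) y\<close> into the module. Its proof subtracts a suitable element of the module so that \<open>M\<close>
  becomes positive definite on a box around the set. There the Bernstein coefficients of \<open>M\<close> of high
  degree are positive definite matrices, and the Bernstein polynomials lie in the preordering of a
  ball (\<open>box_matrix_positivstellensatz\<close>).
\<close>

section \<open>Polynomials as functions\<close>

definition monom_value :: "(('n::finite) \<Rightarrow>\<^sub>0 nat) \<Rightarrow> real ^ 'n \<Rightarrow> real" where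
  "monom_value \<alpha> x = (\<Prod>j\<in>UNIV. (x $ j) ^ Poly_Mapping.lookup \<alpha> j)"

lemma peval_superset:
  assumes "finite S" "Poly_Mapping.keys p \<subseteq> S"
  shows "peval p x = (\<Sum>\<alpha>\<in>S. Poly_Mapping.lookup p \<alpha> * monom_value \<alpha> x)"
  unfolding peval_def monom_value_def
  by (rule sum.mono_neutral_left) (use assms in \<open>auto simp: in_keys_iff\<close>)

lemma peval_0 [simp]: "peval 0 x = 0"
  by (simp add: peval_def)

lemma peval_single: "peval (Poly_Mapping.single \<alpha> c) x = c * monom_value \<alpha> x"
  by (subst peval_superset[of "{\<alpha>}"]) auto

lemma peval_add [simp]: "peval (p + q) x = peval p x + peval q x"
proof -
  let ?S = "Poly_Mapping.keys p \<union> Poly_Mapping.keys q"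
  have "Poly_Mapping.keys (p + q) \<subseteq> ?S" by (rule Poly_Mapping.keys_add)
  then show ?thesis
    by (subst (1 2 3) peval_superset[of ?S]) (auto simp: lookup_add algebra_simps sum.distrib)
qed

lemma peval_uminus [simp]: "peval (- p) x = - peval p x"
  using peval_add[of p "- p" x] by simp

lemma peval_diff [simp]: "peval (p - q) x = peval p x - peval q x"
  using peval_add[of p "- q" x] by simp

lemma peval_sum [simp]: "peval (sum f A) x = (\<Sum>a\<in>A. peval (f a) x)"
  by (induction A rule: infinite_finite_induct) auto

lemma peval_const [simp]: "peval (pconst c) x = c"
  by (simp add: pconst_def peval_single monom_value_def)

lemma peval_1 [simp]: "peval 1 x = 1"
  using peval_const[of 1 x] by (simp add: pconst_def)

lemma mpoly_sum_singles: "p = (\<Sum>\<alpha>\<in>Poly_Mapping.keys p. Poly_Mapping.single \<alpha> (Poly_Mapping.lookup p \<alpha>))"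
  by (rule poly_mapping_eqI)
     (simp add: lookup_sum lookup_single when_def in_keys_iff)

lemma monom_value_add: "monom_value (\<alpha> + \<beta>) x = monom_value \<alpha> x * monom_value \<beta> x"
  by (simp add: monom_value_def lookup_add power_add prod.distrib)

lemma peval_mult [simp]: "peval (p * q) x = peval p x * peval q x"
proof -
  have "p * q = (\<Sum>\<alpha>\<in>Poly_Mapping.keys p. \<Sum>\<beta>\<in>Poly_Mapping.keys q.
      Poly_Mapping.single (\<alpha> + \<beta>) (Poly_Mapping.lookup p \<alpha> * Poly_Mapping.lookup q \<beta>))"
    by (subst mpoly_sum_singles[of p], subst mpoly_sum_singles[of q])
       (simp add: sum_product mult_single)
  then have "peval (p * q) x = (\<Sum>\<alpha>\<in>Poly_Mapping.keys p. \<Sum>\<beta>\<in>Poly_Mapping.keys q.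
      (Poly_Mapping.lookup p \<alpha> * monom_value \<alpha> x) * (Poly_Mapping.lookup q \<beta> * monom_value \<beta> x))"
    by (simp add: peval_single monom_value_add mult_ac)
  also have "\<dots> = peval p x * peval q x"
    by (simp add: peval_def monom_value_def sum_product)
  finally show ?thesis .
qed

lemma peval_power [simp]: "peval (p ^ k) x = peval p x ^ k"
  by (induction k) auto

lemma peval_prod [simp]: "peval (prod f A) x = (\<Prod>a\<in>A. peval (f a) x)"
  by (induction A rule: infinite_finite_induct) auto

lemma peval_var [simp]: "peval (pvar j) x = x $ j"
proof -
  have "(\<Prod>i\<in>UNIV. (x $ i) ^ Poly_Mapping.lookup (Poly_Mapping.single j 1) i)
      = (\<Prod>i\<in>UNIV. if i = j then x $ j else 1)"
    by (rule prod.cong) (auto simp: lookup_single when_def)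
  then show ?thesis
    by (simp add: pvar_def pmonom_def peval_single monom_value_def)
qed

lemma pconst_0 [simp]: "pconst 0 = 0" by (simp add: pconst_def)
lemma pconst_1 [simp]: "pconst 1 = 1" by (simp add: pconst_def)
lemma pconst_add: "pconst (a + b) = pconst a + pconst b" by (simp add: pconst_def single_add)
lemma pconst_mult: "pconst (a * b) = pconst a * pconst b" by (simp add: pconst_def mult_single)
lemma pconst_uminus: "pconst (- a) = - pconst a" by (simp add: pconst_def single_uminus)
lemma pconst_diff: "pconst (a - b) = pconst a - pconst b" by (simp add: pconst_def single_diff)
lemma pconst_sum: "pconst (sum f A) = (\<Sum>a\<in>A. pconst (f a))"
  by (induction A rule: infinite_finite_induct) (auto simp: pconst_add)
lemma pconst_prod: "pconst (prod f A) = (\<Prod>a\<in>A. pconst (f a))"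
  by (induction A rule: infinite_finite_induct) (auto simp: pconst_mult)
lemma pconst_power: "pconst (a ^ k) = pconst a ^ k"
  by (induction k) (auto simp: pconst_mult)
lemma pconst_of_nat: "pconst (of_nat k) = of_nat k"
  by (induction k) (auto simp: pconst_add)

section \<open>Polynomials in a set of variables\<close>

lemma polys_const [simp, intro]: "pconst c \<in> polys \<Delta>"
  by (auto simp: polys_def pconst_def)

lemma polys_0 [simp]: "0 \<in> polys \<Delta>" by (simp add: polys_def)
lemma polys_1 [simp]: "1 \<in> polys \<Delta>" by (simp add: polys_def)

lemma polys_var: "j \<in> \<Delta> \<Longrightarrow> pvar j \<in> polys \<Delta>"
  by (simp add: polys_def pvar_def pmonom_def)

lemma polys_add [intro]: "p \<in> polys \<Delta> \<Longrightarrow> q \<in> polys \<Delta> \<Longrightarrow> p + q \<in> polys \<Delta>"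
  using Poly_Mapping.keys_add[of p q] by (auto simp: polys_def)

lemma polys_uminus [intro]: "p \<in> polys \<Delta> \<Longrightarrow> - p \<in> polys \<Delta>"
  by (simp add: polys_def in_keys_iff)

lemma polys_diff [intro]: "p \<in> polys \<Delta> \<Longrightarrow> q \<in> polys \<Delta> \<Longrightarrow> p - q \<in> polys \<Delta>"
  using polys_add[of p \<Delta> "- q"] polys_uminus[of q] by simp

lemma polys_mult [intro]:
  assumes "p \<in> polys \<Delta>" "q \<in> polys \<Delta>" shows "p * q \<in> polys \<Delta>"
proof -
  have "Poly_Mapping.keys \<gamma> \<subseteq> \<Delta>" if "\<gamma> \<in> Poly_Mapping.keys (p * q)" for \<gamma>
  proof -
    from subsetD[OF keys_mult that]
    obtain \<alpha> \<beta> where "\<gamma> = \<alpha> + \<beta>" "\<alpha> \<in> Poly_Mapping.keys p" "\<beta> \<in> Poly_Mapping.keys q"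
      by blast
    moreover have "Poly_Mapping.keys \<alpha> \<subseteq> \<Delta>" "Poly_Mapping.keys \<beta> \<subseteq> \<Delta>"
      using assms calculation by (auto simp: polys_def)
    ultimately show ?thesis using Poly_Mapping.keys_add[of \<alpha> \<beta>] by blast
  qed
  then show ?thesis by (simp add: polys_def)
qed

lemma polys_sum: "(\<And>a. a \<in> A \<Longrightarrow> f a \<in> polys \<Delta>) \<Longrightarrow> sum f A \<in> polys \<Delta>"
  by (induction A rule: infinite_finite_induct) auto

lemma polys_power [intro]: "p \<in> polys \<Delta> \<Longrightarrow> p ^ k \<in> polys \<Delta>"
  by (induction k) auto

lemma single_as_product:
  fixes \<alpha> :: "('n::finite) \<Rightarrow>\<^sub>0 nat"
  shows "Poly_Mapping.single \<alpha> c = pconst c * (\<Prod>j\<in>UNIV. pvar j ^ Poly_Mapping.lookup \<alpha> j)"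
proof -
  have pw: "pvar j ^ k = pmonom (Poly_Mapping.single j k)" for j :: 'n and k
    by (induction k) (auto simp: pvar_def pmonom_def mult_single single_add[symmetric])
  have pr: "(\<Prod>j\<in>A. pmonom (g j)) = pmonom (\<Sum>j\<in>A. g j)" if "finite A"
    for g :: "'n \<Rightarrow> ('n \<Rightarrow>\<^sub>0 nat)" and A
    using that by (induction A) (auto simp: pmonom_def mult_single)
  have sm: "(\<Sum>j\<in>UNIV. Poly_Mapping.single j (Poly_Mapping.lookup \<alpha> j)) = \<alpha>"
    by (rule poly_mapping_eqI) (simp add: lookup_sum lookup_single when_def)
  have "(\<Prod>j\<in>UNIV. pvar j ^ Poly_Mapping.lookup \<alpha> j) = pmonom \<alpha>"
    by (simp add: pw pr sm)
  then show ?thesis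
    by (simp add: pmonom_def pconst_def mult_single)
qed

lemma mpoly_expand:
  fixes p :: "('n::finite) mpoly"
  assumes "p \<in> polys \<Delta>"
  shows "p = (\<Sum>\<alpha>\<in>Poly_Mapping.keys p. pconst (Poly_Mapping.lookup p \<alpha>)
      * (\<Prod>j\<in>\<Delta>. pvar j ^ Poly_Mapping.lookup \<alpha> j))"
proof -
  have "Poly_Mapping.single \<alpha> (Poly_Mapping.lookup p \<alpha>) = pconst (Poly_Mapping.lookup p \<alpha>)
      * (\<Prod>j\<in>\<Delta>. pvar j ^ Poly_Mapping.lookup \<alpha> j)" if "\<alpha> \<in> Poly_Mapping.keys p" for \<alpha>
  proof -
    have "Poly_Mapping.keys \<alpha> \<subseteq> \<Delta>" using assms that by (auto simp: polys_def)
    then have not_in: "Poly_Mapping.lookup \<alpha> j = 0" if "j \<notin> \<Delta>" for j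
      using that by (auto simp: in_keys_iff)
    then have "(\<Prod>j\<in>UNIV. pvar j ^ Poly_Mapping.lookup \<alpha> j) = (\<Prod>j\<in>\<Delta>. pvar j ^ Poly_Mapping.lookup \<alpha> j)"
      using not_in by (intro prod.mono_neutral_right) auto
    then show ?thesis by (simp add: single_as_product)
  qed
  then show ?thesis
    by (subst mpoly_sum_singles[of p]) (rule sum.cong, auto)
qed

text \<open>Every statement about all polynomials that is stable under sums and products follows from
  constants and variables, without monomials or degrees.\<close>

lemma polys_induct [consumes 1, case_names const var add mult]:
  fixes p :: "('n::finite) mpoly"
  assumes p: "p \<in> polys \<Delta>"
    and const: "\<And>c. P (pconst c)"
    and var: "\<And>j. j \<in> \<Delta> \<Longrightarrow> P (pvar j)"
    and add: "\<And>p q. p \<in> polys \<Delta> \<Longrightarrow> q \<in> polys \<Delta> \<Longrightarrow> P p \<Longrightarrow> P q \<Longrightarrow> P (p + q)"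
    and mult: "\<And>p q. p \<in> polys \<Delta> \<Longrightarrow> q \<in> polys \<Delta> \<Longrightarrow> P p \<Longrightarrow> P q \<Longrightarrow> P (p * q)"
  shows "P p"
proof -
  let ?Q = "\<lambda>q. q \<in> polys \<Delta> \<and> P q"
  have c: "?Q (pconst c)" for c using const by auto
  have 0: "?Q 0" using c[of 0] by simp
  have 1: "?Q 1" using c[of 1] by simp
  have a: "?Q (a + b)" if "?Q a" "?Q b" for a b using that add by auto
  have m: "?Q (a * b)" if "?Q a" "?Q b" for a b using that mult by auto
  have sm: "?Q (sum g A)" if "\<And>a. a \<in> A \<Longrightarrow> ?Q (g a)" for g and A :: "('n \<Rightarrow>\<^sub>0 nat) set"
    using that by (induction A rule: infinite_finite_induct) (use 0 a in auto)
  have pr: "?Q (prod g A)" if "\<And>a. a \<in> A \<Longrightarrow> ?Q (g a)" for g and A :: "'n set"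
    using that by (induction A rule: infinite_finite_induct) (use 1 m in auto)
  have pw: "?Q (pvar j ^ k)" if "j \<in> \<Delta>" for j k
  proof (induction k)
    case 0 show ?case using 1 by simp
  next
    case (Suc k)
    have "?Q (pvar j)" by (intro conjI var polys_var that)
    from m[OF this Suc] show ?case by simp
  qed
  have "?Q (\<Sum>\<alpha>\<in>Poly_Mapping.keys p. pconst (Poly_Mapping.lookup p \<alpha>)
      * (\<Prod>j\<in>\<Delta>. pvar j ^ Poly_Mapping.lookup \<alpha> j))"
    by (intro sm m c pr pw)
  then show ?thesis
    unfolding mpoly_expand[OF p, symmetric] by (rule conjunct2)
qed

lemma coord_proj_in [simp]: "coord_proj \<Delta> x \<in> coord_space \<Delta>"
  by (simp add: coord_proj_def coord_space_def)

lemma peval_cong: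
  assumes "p \<in> polys \<Delta>" "\<And>j. j \<in> \<Delta> \<Longrightarrow> x $ j = y $ j"
  shows "peval p x = peval p y"
  using assms(1) by (induction rule: polys_induct) (use assms(2) in auto)

lemma peval_coord_proj: "p \<in> polys \<Delta> \<Longrightarrow> peval p (coord_proj \<Delta> x) = peval p x"
  by (rule peval_cong) (auto simp: coord_proj_def)

lemma continuous_on_peval [continuous_intros]:
  assumes "continuous_on S g" shows "continuous_on S (\<lambda>x. peval p (g x))"
proof -
  have "p \<in> polys UNIV" by (simp add: polys_def)
  then show ?thesis
    by (induction rule: polys_induct) (auto intro!: continuous_intros assms)
qed

lemma isCont_peval [continuous_intros]: "isCont g a \<Longrightarrow> isCont (\<lambda>x. peval p (g x)) a"
proof -
  assume "isCont g a"
  moreover have "isCont (peval p) (g a)"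
    using continuous_on_peval[of UNIV "\<lambda>x. x" p] by (simp add: continuous_on_eq_continuous_at)
  ultimately show ?thesis by (rule isCont_o2)
qed

section \<open>Taylor expansion with polynomial remainder\<close>

lemma coord_space_add [intro]: "x \<in> coord_space \<Delta> \<Longrightarrow> y \<in> coord_space \<Delta> \<Longrightarrow> x + y \<in> coord_space \<Delta>"
  and coord_space_diff [intro]: "x \<in> coord_space \<Delta> \<Longrightarrow> y \<in> coord_space \<Delta> \<Longrightarrow> x - y \<in> coord_space \<Delta>"
  and coord_space_scaleR [intro]: "x \<in> coord_space \<Delta> \<Longrightarrow> c *\<^sub>R x \<in> coord_space \<Delta>"
  and coord_space_0 [simp]: "0 \<in> coord_space \<Delta>"
  by (auto simp: coord_space_def)

text \<open>The polynomials \<open>x\<^sub>s - w\<^sub>s\<close> generate the ideal of the point \<open>w\<close>. For a product this is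
  \<open>p q - p(w) q(w) = (p - p(w)) q + p(w) (q - q(w))\<close>.\<close>

lemma hadamard1:
  fixes w :: "real ^ 'n::finite"
  assumes "p \<in> polys \<Delta>"
  shows "\<exists>a. (\<forall>s. a s \<in> polys \<Delta>) \<and>
    p - pconst (peval p w) = (\<Sum>s\<in>\<Delta>. (pvar s - pconst (w $ s)) * a s)"
  using assms
proof (induction rule: polys_induct)
  case (const c)
  show ?case by (rule exI[of _ "\<lambda>_. 0"]) simp
next
  case (var j)
  have "(\<Sum>s\<in>\<Delta>. (pvar s - pconst (w $ s)) * (if s = j then 1 else 0)) = pvar j - pconst (w $ j)"
    using var by (simp add: if_distrib cong: if_cong)
  then show ?case by (intro exI[of _ "\<lambda>s. if s = j then 1 else 0"]) auto
next
  case (add p q)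
  from \<open>\<exists>a. (\<forall>s. a s \<in> polys \<Delta>) \<and> p - pconst (peval p w) = _ a\<close>
    \<open>\<exists>a. (\<forall>s. a s \<in> polys \<Delta>) \<and> q - pconst (peval q w) = _ a\<close>
  obtain a b where ab: "\<forall>s. a s \<in> polys \<Delta>" "\<forall>s. b s \<in> polys \<Delta>"
    and p: "p - pconst (peval p w) = (\<Sum>s\<in>\<Delta>. (pvar s - pconst (w $ s)) * a s)"
    and q: "q - pconst (peval q w) = (\<Sum>s\<in>\<Delta>. (pvar s - pconst (w $ s)) * b s)" by blast
  have "p + q - pconst (peval (p + q) w) = (p - pconst (peval p w)) + (q - pconst (peval q w))"
    by (simp add: pconst_add)
  also have "\<dots> = (\<Sum>s\<in>\<Delta>. (pvar s - pconst (w $ s)) * (a s + b s))"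
    by (simp only: p q distrib_left sum.distrib)
  finally have e: "p + q - pconst (peval (p + q) w) = (\<Sum>s\<in>\<Delta>. (pvar s - pconst (w $ s)) * (a s + b s))" .
  have "\<forall>s. a s + b s \<in> polys \<Delta>" using ab by blast
  then show ?case using e by (intro exI[of _ "\<lambda>s. a s + b s"] conjI)
next
  case (mult p q)
  from \<open>\<exists>a. (\<forall>s. a s \<in> polys \<Delta>) \<and> p - pconst (peval p w) = _ a\<close>
    \<open>\<exists>a. (\<forall>s. a s \<in> polys \<Delta>) \<and> q - pconst (peval q w) = _ a\<close>
  obtain a b where ab: "\<forall>s. a s \<in> polys \<Delta>" "\<forall>s. b s \<in> polys \<Delta>"
    and p: "p - pconst (peval p w) = (\<Sum>s\<in>\<Delta>. (pvar s - pconst (w $ s)) * a s)"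
    and q: "q - pconst (peval q w) = (\<Sum>s\<in>\<Delta>. (pvar s - pconst (w $ s)) * b s)" by blast
  let ?y = "\<lambda>s. pvar s - pconst (w $ s)"
  have "p * q - pconst (peval (p * q) w)
      = (p - pconst (peval p w)) * q + pconst (peval p w) * (q - pconst (peval q w))"
    by (simp add: algebra_simps pconst_mult)
  also have "\<dots> = (\<Sum>s\<in>\<Delta>. ?y s * (a s * q + pconst (peval p w) * b s))"
    by (simp only: p q sum_distrib_left sum_distrib_right sum.distrib[symmetric])
       (simp only: distrib_left mult_ac)
  finally have e: "p * q - pconst (peval (p * q) w)
      = (\<Sum>s\<in>\<Delta>. ?y s * (a s * q + pconst (peval p w) * b s))" .
  have "\<forall>s. a s * q + pconst (peval p w) * b s \<in> polys \<Delta>"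
    using ab mult(1,2) by blast
  then show ?case using e by (intro exI[of _ "\<lambda>s. a s * q + pconst (peval p w) * b s"] conjI)
qed

text \<open>The previous lemma, applied to its own coefficients. Nothing is claimed about \<open>a\<close> and \<open>b\<close>
  beyond the identity; that they carry the derivatives at \<open>w\<close> is \<open>hadamard_rep_partial\<close> and
  \<open>hadamard_rep_hessian\<close>.\<close>

lemma hadamard2:
  fixes w :: "real ^ 'n::finite"
  assumes "p \<in> polys \<Delta>"
  obtains a b where "\<And>s t. b s t \<in> polys \<Delta>"
    "p = pconst (peval p w) + (\<Sum>s\<in>\<Delta>. pconst (a s) * (pvar s - pconst (w $ s)))
      + (\<Sum>s\<in>\<Delta>. \<Sum>t\<in>\<Delta>. (pvar s - pconst (w $ s)) * (pvar t - pconst (w $ t)) * b s t)"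
proof -
  let ?y = "\<lambda>s. pvar s - pconst (w $ s)"
  obtain a where a: "\<And>s. a s \<in> polys \<Delta>"
    and p: "p - pconst (peval p w) = (\<Sum>s\<in>\<Delta>. ?y s * a s)"
    using hadamard1[OF assms, of w] by blast
  have "\<forall>s. \<exists>b. (\<forall>t. b t \<in> polys \<Delta>) \<and> a s - pconst (peval (a s) w) = (\<Sum>t\<in>\<Delta>. ?y t * b t)"
    by (intro allI hadamard1 a)
  then obtain b where b: "\<And>s t. b s t \<in> polys \<Delta>"
    and as: "\<And>s. a s - pconst (peval (a s) w) = (\<Sum>t\<in>\<Delta>. ?y t * b s t)"
    unfolding choice_iff by blast
  have "?y s * a s = pconst (peval (a s) w) * ?y s + (\<Sum>t\<in>\<Delta>. ?y s * ?y t * b s t)" for s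
  proof -
    have "?y s * a s = pconst (peval (a s) w) * ?y s + ?y s * (a s - pconst (peval (a s) w))"
      by (simp add: algebra_simps)
    then show ?thesis by (simp only: as sum_distrib_left mult.assoc)
  qed
  then have e: "(\<Sum>s\<in>\<Delta>. ?y s * a s)
      = (\<Sum>s\<in>\<Delta>. pconst (peval (a s) w) * ?y s) + (\<Sum>s\<in>\<Delta>. \<Sum>t\<in>\<Delta>. ?y s * ?y t * b s t)"
    by (simp only: sum.distrib)
  have p': "p = pconst (peval p w) + (\<Sum>s\<in>\<Delta>. ?y s * a s)"
    unfolding p[symmetric] by simp
  have "p = pconst (peval p w) + (\<Sum>s\<in>\<Delta>. pconst (peval (a s) w) * ?y s)
      + (\<Sum>s\<in>\<Delta>. \<Sum>t\<in>\<Delta>. ?y s * ?y t * b s t)"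
    by (rule trans[OF p']) (simp only: e add.assoc)
  then show ?thesis by (rule that[OF b])
qed

section \<open>Gram decompositions\<close>

lemma psd_on_insertD:
  assumes "finite I" "x \<notin> I" "psd_on (insert x I) M"
  shows "0 \<le> c\<^sup>2 * M x x + 2 * c * (\<Sum>t\<in>I. M x t * v t) + (\<Sum>s\<in>I. \<Sum>t\<in>I. v s * M s t * v t)"
proof -
  let ?v = "v(x := c)"
  have sym: "M t x = M x t" if "t \<in> I" for t
    using assms(3) that unfolding psd_on_def by blast
  have e: "?v t = v t" if "t \<in> I" for t using that assms(2) by auto
  have "0 \<le> (\<Sum>s\<in>insert x I. \<Sum>t\<in>insert x I. ?v s * M s t * ?v t)"
    using assms(3) unfolding psd_on_def by blast
  also have "\<dots> = c * M x x * c + (\<Sum>t\<in>I. c * M x t * v t) + (\<Sum>s\<in>I. v s * M s x * c)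
      + (\<Sum>s\<in>I. \<Sum>t\<in>I. v s * M s t * v t)"
    using assms(1,2) by (simp add: e sum.distrib del: fun_upd_apply cong: sum.cong) (simp add: mult_ac)
  also have "(\<Sum>t\<in>I. c * M x t * v t) = c * (\<Sum>t\<in>I. M x t * v t)"
    by (simp add: sum_distrib_left mult_ac)
  also have "(\<Sum>s\<in>I. v s * M s x * c) = c * (\<Sum>t\<in>I. M x t * v t)"
    by (simp add: sum_distrib_left sym mult_ac cong: sum.cong)
  finally show ?thesis by (simp add: power2_eq_square algebra_simps)
qed

text \<open>Used to show that a positive semidefinite form vanishing on a vector vanishes against
  every vector.\<close>

lemma linear_nonneg_imp_zero:
  fixes a b :: real
  assumes "\<And>c. 0 \<le> 2 * c * a + b" shows "a = 0"
proof (rule ccontr)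
  assume "a \<noteq> 0"
  with assms[of "- (b + 1) / (2 * a)"] show False by (simp add: field_simps)
qed

text \<open>Elimination of one index at a time: the Schur complement of a diagonal entry is again positive
  semidefinite, and its Gram vectors, extended by zero, are completed by the scaled row of that
  entry. A vanishing diagonal entry forces its row to vanish, and division by zero then yields
  the zero vector, so that both cases share the same formulas.\<close>

lemma psd_on_gram:
  assumes "finite I" "psd_on I M"
  shows "\<exists>(r::nat) a. \<forall>s\<in>I. \<forall>t\<in>I. M s t = (\<Sum>k<r. a k s * a k t)"
  using assms
proof (induction I arbitrary: M rule: finite_induct)
  case empty
  then show ?case by auto
next
  case (insert x I)
  define d where "d = M x x"
  have sym: "M t x = M x t" if "t \<in> I" for t
    using insert.prems that unfolding psd_on_def by blast
  note ins = psd_on_insertD[OF insert.hyps(1,2) insert.prems]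
  have d0: "0 \<le> d" using ins[of 1 "\<lambda>_. 0"] by (simp add: d_def)
  have z: "M x t = 0" if "d = 0" "t \<in> I" for t
  proof (rule linear_nonneg_imp_zero[where b = "M t t"])
    fix c :: real
    have "(\<Sum>s\<in>I. \<Sum>r\<in>I. (if s = t then 1 else 0) * M s r * (if r = t then 1 else 0))
        = (\<Sum>s\<in>I. if s = t then M t t else 0)"
      using that insert.hyps(1) by (intro sum.cong) (auto simp: if_distrib cong: if_cong)
    then show "0 \<le> 2 * c * M x t + M t t"
      using ins[of c "\<lambda>s. if s = t then 1 else 0"] that insert.hyps(1)
      by (simp add: d_def if_distrib cong: if_cong)
  qed
  define N where "N s t = M s t - M x s * M x t / d" for s t
  have "psd_on I N"
    unfolding psd_on_def
  proof (intro conjI ballI allI)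
    fix s t assume "s \<in> I" "t \<in> I"
    then have "M s t = M t s" using insert.prems unfolding psd_on_def by blast
    then show "N s t = N t s" by (simp add: N_def)
  next
    fix v :: "'a \<Rightarrow> real"
    let ?m = "\<Sum>t\<in>I. M x t * v t"
    have "(\<Sum>s\<in>I. \<Sum>t\<in>I. v s * N s t * v t)
        = (\<Sum>s\<in>I. \<Sum>t\<in>I. v s * M s t * v t) - (\<Sum>s\<in>I. \<Sum>t\<in>I. (M x s * v s) * (M x t * v t) / d)"
      unfolding sum_subtractf[symmetric]
      by (intro sum.cong) (auto simp: N_def algebra_simps)
    also have "(\<Sum>s\<in>I. \<Sum>t\<in>I. (M x s * v s) * (M x t * v t) / d) = ?m\<^sup>2 / d"
      by (simp only: sum_divide_distrib[symmetric] sum_product power2_eq_square)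
    also have "0 \<le> (\<Sum>s\<in>I. \<Sum>t\<in>I. v s * M s t * v t) - ?m\<^sup>2 / d"
    proof (cases "d = 0")
      case True
      then show ?thesis using ins[of 0 v] by simp
    next
      case False
      then show ?thesis using ins[of "- ?m / d" v] by (simp add: d_def[symmetric] power2_eq_square field_simps)
    qed
    finally show "0 \<le> (\<Sum>s\<in>I. \<Sum>t\<in>I. v s * N s t * v t)" .
  qed
  from insert.IH[OF this] obtain r :: nat and a
    where a: "\<And>s t. s \<in> I \<Longrightarrow> t \<in> I \<Longrightarrow> N s t = (\<Sum>k<r. a k s * a k t)" by blast
  define b where "b k s = (if k = r then M x s / sqrt d else if s = x then 0 else a k s)" for k s
  have "M s t = (\<Sum>k<Suc r. b k s * b k t)" if "s \<in> insert x I" "t \<in> insert x I" for s t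
  proof -
    have eq: "(\<Sum>k<Suc r. b k s * b k t)
        = (\<Sum>k<r. if s = x \<or> t = x then 0 else a k s * a k t) + (M x s / sqrt d) * (M x t / sqrt d)"
      by (auto simp: b_def intro!: sum.cong)
    have sq: "(M x s / sqrt d) * (M x t / sqrt d) = M x s * M x t / d"
      using d0 by simp
    show ?thesis
    proof (cases "s = x \<or> t = x")
      case True
      have "M x s * M x t / d = M s t"
        using True that z sym insert.hyps(2) by (cases "d = 0") (auto simp: d_def)
      then show ?thesis using True unfolding eq sq by simp
    next
      case False
      then have st: "s \<in> I" "t \<in> I" using that by auto
      then show ?thesis using False unfolding eq sq by (simp add: a[symmetric] N_def)
    qed
  qed
  then show ?case by blast
qed

section \<open>Bernstein expansions\<close>

definition bern :: "nat \<Rightarrow> nat \<Rightarrow> 'a::comm_ring_1 \<Rightarrow> 'a" where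
  "bern d i z = of_nat (d choose i) * z ^ i * (1 - z) ^ (d - i)"

text \<open>Expand the factor \<open>(z + (1 - z))\<^bsup>d - r\<^esup> = 1\<close> in \<open>z\<^bsup>r\<^esup> (z + (1 - z))\<^bsup>d - r\<^esup>\<close>. Being an
  identity in every commutative ring, it applies to polynomials as well as to numbers.\<close>

lemma bern_moment:
  fixes z :: "'a::comm_ring_1"
  assumes "r \<le> d"
  shows "of_nat (d choose r) * z ^ r = (\<Sum>i\<le>d. of_nat (i choose r) * bern d i z)"
proof -
  have "z ^ r = z ^ r * (z + (1 - z)) ^ (d - r)" by simp
  also have "\<dots> = (\<Sum>k\<le>d - r. of_nat ((d - r) choose k) * z ^ (k + r) * (1 - z) ^ (d - r - k))"
    unfolding binomial_ring by (simp add: sum_distrib_left power_add mult_ac)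
  finally have "of_nat (d choose r) * z ^ r
      = (\<Sum>k\<le>d - r. of_nat (d choose r) * (of_nat ((d - r) choose k) * z ^ (k + r) * (1 - z) ^ (d - r - k)))"
    by (simp only: sum_distrib_left)
  also have "\<dots> = (\<Sum>k\<le>d - r. of_nat ((k + r) choose r) * bern d (k + r) z)"
  proof (rule sum.cong[OF refl])
    fix k assume "k \<in> {..d - r}"
    then have "(d choose (k + r)) * ((k + r) choose r) = (d choose r) * ((d - r) choose k)"
      using choose_mult[of r "k + r" d] assms by simp
    then have e: "(of_nat ((k + r) choose r) :: 'a) * of_nat (d choose (k + r))
        = of_nat (d choose r) * of_nat ((d - r) choose k)"
      by (metis of_nat_mult mult.commute)
    have "d - r - k = d - (k + r)" by simp
    then show "of_nat (d choose r) * (of_nat ((d - r) choose k) * z ^ (k + r) * (1 - z) ^ (d - r - k))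
        = of_nat ((k + r) choose r) * bern d (k + r) z"
      unfolding bern_def mult.assoc[symmetric] e by simp
  qed
  also have "\<dots> = (\<Sum>i\<in>{r..d}. of_nat (i choose r) * bern d i z)"
    by (rule sum.reindex_bij_witness[of _ "\<lambda>i. i - r" "\<lambda>k. k + r"]) (use assms in auto)
  also have "\<dots> = (\<Sum>i\<le>d. of_nat (i choose r) * bern d i z)"
    by (rule sum.mono_neutral_left) (auto simp: not_le binomial_eq_0)
  finally show ?thesis .
qed

text \<open>The index sets grow with \<open>d\<close>: below, \<open>a d i\<close> is the Bernstein coefficient of degree \<open>d\<close> at
  the index \<open>i\<close> and \<open>b d i\<close> the value at the corresponding grid point. Boundedness of \<open>b\<close> makes
  the relation stable under products.\<close>

definition uniformly_close :: "(nat \<Rightarrow> 'i set) \<Rightarrow> (nat \<Rightarrow> 'i \<Rightarrow> real) \<Rightarrow> (nat \<Rightarrow> 'i \<Rightarrow> real) \<Rightarrow> bool" where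
  "uniformly_close I a b \<longleftrightarrow> (\<exists>B. \<forall>d. \<forall>i\<in>I d. \<bar>b d i\<bar> \<le> B) \<and>
    (\<forall>\<epsilon>>0. \<forall>\<^sub>F d in sequentially. \<forall>i\<in>I d. \<bar>a d i - b d i\<bar> < \<epsilon>)"

lemma uniformly_close_const: "uniformly_close I (\<lambda>_ _. c) (\<lambda>_ _. c)"
  by (auto simp: uniformly_close_def)

lemma uniformly_close_add:
  assumes "uniformly_close I a b" "uniformly_close I a' b'"
  shows "uniformly_close I (\<lambda>d i. a d i + a' d i) (\<lambda>d i. b d i + b' d i)"
proof -
  obtain B B' where B: "\<And>d i. i \<in> I d \<Longrightarrow> \<bar>b d i\<bar> \<le> B" "\<And>d i. i \<in> I d \<Longrightarrow> \<bar>b' d i\<bar> \<le> B'"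
    using assms unfolding uniformly_close_def by blast
  have "\<bar>b d i + b' d i\<bar> \<le> B + B'" if "i \<in> I d" for d i
    using B[OF that] by linarith
  moreover have "\<forall>\<^sub>F d in sequentially. \<forall>i\<in>I d. \<bar>a d i + a' d i - (b d i + b' d i)\<bar> < \<epsilon>" if "\<epsilon> > 0" for \<epsilon>
  proof -
    have "\<epsilon> / 2 > 0" using that by simp
    then have "\<forall>\<^sub>F d in sequentially. \<forall>i\<in>I d. \<bar>a d i - b d i\<bar> < \<epsilon> / 2"
      "\<forall>\<^sub>F d in sequentially. \<forall>i\<in>I d. \<bar>a' d i - b' d i\<bar> < \<epsilon> / 2"
      using assms unfolding uniformly_close_def by blast+
    then show ?thesis
    proof eventually_elim
      case (elim d)
      show ?case
      proof
        fix i assume "i \<in> I d"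
        with elim have "\<bar>a d i - b d i\<bar> < \<epsilon> / 2" "\<bar>a' d i - b' d i\<bar> < \<epsilon> / 2" by auto
        then show "\<bar>a d i + a' d i - (b d i + b' d i)\<bar> < \<epsilon>" by linarith
      qed
    qed
  qed
  ultimately show ?thesis unfolding uniformly_close_def by blast
qed

lemma uniformly_close_mult:
  assumes "uniformly_close I a b" "uniformly_close I a' b'"
  shows "uniformly_close I (\<lambda>d i. a d i * a' d i) (\<lambda>d i. b d i * b' d i)"
proof -
  obtain B0 B0' where B0: "\<And>d i. i \<in> I d \<Longrightarrow> \<bar>b d i\<bar> \<le> B0" "\<And>d i. i \<in> I d \<Longrightarrow> \<bar>b' d i\<bar> \<le> B0'"
    using assms unfolding uniformly_close_def by blast
  define B where "B = max 1 (max B0 B0')"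
  have B: "\<And>d i. i \<in> I d \<Longrightarrow> \<bar>b d i\<bar> \<le> B" "\<And>d i. i \<in> I d \<Longrightarrow> \<bar>b' d i\<bar> \<le> B" "B \<ge> 1"
    using B0 by (auto simp: B_def le_max_iff_disj)
  have "\<bar>b d i * b' d i\<bar> \<le> B * B" if "i \<in> I d" for d i
    unfolding abs_mult using B(1,2)[OF that] B(3) by (intro mult_mono) auto
  moreover have "\<forall>\<^sub>F d in sequentially. \<forall>i\<in>I d. \<bar>a d i * a' d i - b d i * b' d i\<bar> < \<epsilon>" if "\<epsilon> > 0" for \<epsilon>
  proof -
    define e where "e = min 1 (\<epsilon> / (4 * B))"
    have e: "e > 0" "e \<le> 1" "e * (4 * B) \<le> \<epsilon>"
      using that B(3) by (auto simp: e_def min_def field_simps)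
    then have "\<forall>\<^sub>F d in sequentially. \<forall>i\<in>I d. \<bar>a d i - b d i\<bar> < e"
      "\<forall>\<^sub>F d in sequentially. \<forall>i\<in>I d. \<bar>a' d i - b' d i\<bar> < e"
      using assms unfolding uniformly_close_def by blast+
    then show ?thesis
    proof eventually_elim
      case (elim d)
      show ?case
      proof
        fix i assume i: "i \<in> I d"
        with elim have c: "\<bar>a d i - b d i\<bar> < e" "\<bar>a' d i - b' d i\<bar> < e" by auto
        have "\<bar>a' d i\<bar> \<le> 2 * B" using c(2) B(2)[OF i] B(3) e(2) by linarith
        then have "\<bar>a d i - b d i\<bar> * \<bar>a' d i\<bar> \<le> e * (2 * B)"
          using c(1) e(1) by (intro mult_mono) auto
        moreover have "\<bar>b d i\<bar> * \<bar>a' d i - b' d i\<bar> \<le> B * e"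
          using c(2) B(1)[OF i] B(3) by (intro mult_mono) auto
        moreover have "a d i * a' d i - b d i * b' d i = (a d i - b d i) * a' d i + b d i * (a' d i - b' d i)"
          by (simp add: algebra_simps)
        then have "\<bar>a d i * a' d i - b d i * b' d i\<bar> \<le> \<bar>a d i - b d i\<bar> * \<bar>a' d i\<bar> + \<bar>b d i\<bar> * \<bar>a' d i - b' d i\<bar>"
          by (metis abs_mult abs_triangle_ineq)
        ultimately have "\<bar>a d i * a' d i - b d i * b' d i\<bar> \<le> e * (2 * B) + B * e" by linarith
        also have "\<dots> = 3 * (e * B)" by simp
        also have "\<dots> < 4 * (e * B)" using e(1) B(3) by simp
        also have "\<dots> \<le> \<epsilon>" using e(3) by simp
        finally show "\<bar>a d i * a' d i - b d i * b' d i\<bar> < \<epsilon>" .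
      qed
    qed
  qed
  ultimately show ?thesis unfolding uniformly_close_def by blast
qed

lemma uniformly_close_sum:
  "(\<And>k. k \<in> A \<Longrightarrow> uniformly_close I (a k) (b k)) \<Longrightarrow>
    uniformly_close I (\<lambda>d i. \<Sum>k\<in>A. a k d i) (\<lambda>d i. \<Sum>k\<in>A. b k d i)"
  by (induction A rule: infinite_finite_induct)
     (auto intro: uniformly_close_const uniformly_close_add)

lemma uniformly_close_prod:
  "(\<And>k. k \<in> A \<Longrightarrow> uniformly_close I (a k) (b k)) \<Longrightarrow>
    uniformly_close I (\<lambda>d i. \<Prod>k\<in>A. a k d i) (\<lambda>d i. \<Prod>k\<in>A. b k d i)"
  by (induction A rule: infinite_finite_induct)
     (auto intro: uniformly_close_const uniformly_close_mult)

lemma uniformly_close_reindex: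
  assumes "uniformly_close I a b" "\<And>d i. i \<in> J d \<Longrightarrow> g i \<in> I d"
  shows "uniformly_close J (\<lambda>d i. a d (g i)) (\<lambda>d i. b d (g i))"
proof -
  have "\<forall>\<^sub>F d in sequentially. \<forall>i\<in>J d. \<bar>a d (g i) - b d (g i)\<bar> < \<epsilon>" if "\<epsilon> > 0" for \<epsilon>
  proof -
    have "\<forall>\<^sub>F d in sequentially. \<forall>i\<in>I d. \<bar>a d i - b d i\<bar> < \<epsilon>"
      using assms(1) that unfolding uniformly_close_def by blast
    then show ?thesis by eventually_elim (use assms(2) in blast)
  qed
  moreover have "\<exists>B. \<forall>d. \<forall>i\<in>J d. \<bar>b d (g i)\<bar> \<le> B"
    using assms unfolding uniformly_close_def by blast
  ultimately show ?thesis unfolding uniformly_close_def by blast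
qed

text \<open>Up to lower order terms both sides are products of the \<open>r\<close> factors \<open>(i - q) / (d - q)\<close> and
  \<open>i / d\<close>; one factor is compared at a time.\<close>

lemma binomial_ratio_close:
  "uniformly_close (\<lambda>d. {..d}) (\<lambda>d i. real (i choose r) / real (d choose r)) (\<lambda>d i. (real i / real d) ^ r)"
proof (induction r)
  case 0
  show ?case using uniformly_close_const[of _ 1] by simp
next
  case (Suc r)
  have bd: "\<bar>real i / real d\<bar> \<le> 1" if "i \<le> d" for i d
    using that by (cases "d = 0") auto
  have "uniformly_close (\<lambda>d. {..d}) (\<lambda>d i. (real i - real r) / (real d - real r)) (\<lambda>d i. real i / real d)"
    unfolding uniformly_close_def
  proof (intro conjI allI impI)
    show "\<exists>B. \<forall>d. \<forall>i\<in>{..d}. \<bar>real i / real d\<bar> \<le> B" using bd by auto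
  next
    fix \<epsilon> :: real assume "\<epsilon> > 0"
    have "\<forall>\<^sub>F d in sequentially. real d > real r + real r / \<epsilon>"
      using filterlim_real_sequentially unfolding filterlim_at_top_dense by blast
    then show "\<forall>\<^sub>F d in sequentially. \<forall>i\<in>{..d}. \<bar>(real i - real r) / (real d - real r) - real i / real d\<bar> < \<epsilon>"
    proof eventually_elim
      case (elim d)
      have "0 \<le> real r / \<epsilon>" using \<open>\<epsilon> > 0\<close> by simp
      then have d: "real d - real r > 0" using elim by linarith
      have small: "real r / (real d - real r) < \<epsilon>"
        using elim d \<open>\<epsilon> > 0\<close> by (simp add: field_simps)
      show ?case
      proof
        fix i assume "i \<in> {..d}"
        then have i: "real i \<le> real d" by simp
        have dp: "real d > 0" using d by simp
        have le: "\<bar>A * B\<bar> \<le> A" if "0 \<le> A" "0 \<le> B" "B \<le> 1" for A B :: real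
          using that by (simp add: abs_mult mult_left_le)
        have "real i / real d - (real i - real r) / (real d - real r)
            = (real r / (real d - real r)) * ((real d - real i) / real d)"
          using d dp by (simp add: divide_simps) (simp add: algebra_simps)
        moreover have "0 \<le> (real d - real i) / real d" "(real d - real i) / real d \<le> 1"
          using i dp by (auto simp: divide_le_eq_1)
        moreover have "0 \<le> real r / (real d - real r)" using d by simp
        ultimately have "\<bar>real i / real d - (real i - real r) / (real d - real r)\<bar> \<le> real r / (real d - real r)"
          using le by (simp only:)
        then show "\<bar>(real i - real r) / (real d - real r) - real i / real d\<bar> < \<epsilon>"
          using small by linarith
      qed
    qed
  qed
  from uniformly_close_mult[OF Suc this]
  have *: "uniformly_close (\<lambda>d. {..d})
      (\<lambda>d i. real (i choose r) / real (d choose r) * ((real i - real r) / (real d - real r)))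
      (\<lambda>d i. (real i / real d) ^ r * (real i / real d))" .
  \<comment> \<open>Also true for \<open>n < r\<close>, where both binomial coefficients vanish, so that no side condition on
    \<open>i\<close> remains.\<close>
  have rec: "real (n choose r) * (real n - real r) = real (n choose Suc r) * real (Suc r)" for n
  proof (cases "r \<le> n")
    case True
    have "(n choose r) * (n - r) = (n choose Suc r) * Suc r"
      using binomial_absorb_comp[of n r] binomial_absorption[of r n] by (simp add: mult_ac)
    then have "real (n choose r) * real (n - r) = real (n choose Suc r) * real (Suc r)"
      by (metis of_nat_mult)
    then show ?thesis using True by (simp add: of_nat_diff)
  next
    case False
    then show ?thesis by (simp add: binomial_eq_0)
  qed
  have "real (i choose r) / real (d choose r) * ((real i - real r) / (real d - real r))
      = real (i choose Suc r) / real (d choose Suc r)" for i d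
  proof -
    have "real (i choose r) / real (d choose r) * ((real i - real r) / (real d - real r))
      = (real (i choose Suc r) * real (Suc r)) / (real (d choose Suc r) * real (Suc r))"
      by (simp only: times_divide_times_eq rec)
    then show ?thesis by simp
  qed
  then show ?case using * by (simp only: power_Suc2)
qed

text \<open>The affine map \<open>z = (x + c) / (2 c)\<close> takes the interval from \<open>-c\<close> to \<open>c\<close> to the unit
  interval. Expand \<open>x\<^sup>k = (2 c z - c)\<^sup>k\<close> in powers of \<open>z\<close> and each power by \<open>bern_moment\<close>: the
  coefficient of the Bernstein polynomial with index \<open>i\<close> is the same expansion with \<open>z\<^sup>r\<close> replaced
  by \<open>(i choose r) / (d choose r)\<close>, which is close to \<open>(i / d)\<^sup>r\<close>.\<close>

lemma bernstein_var_power: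
  fixes c :: real
  assumes "c > 0"
  defines "z \<equiv> (\<lambda>j::'n::finite. pconst (1 / (2 * c)) * (pvar j + pconst c))"
  shows "\<exists>w. uniformly_close (\<lambda>d. {..d}) w (\<lambda>d i. (2 * c * (real i / real d) - c) ^ k) \<and>
    (\<forall>j. \<forall>d\<ge>k. pvar j ^ k = (\<Sum>i\<le>d. pconst (w d i) * bern d i (z j)))"
proof -
  define co where "co r = real (k choose r) * (2 * c) ^ r * (- c) ^ (k - r)" for r
  define w where "w d i = (\<Sum>r\<le>k. co r * (real (i choose r) / real (d choose r)))" for d i
  have "uniformly_close (\<lambda>d. {..d}) w (\<lambda>d i. \<Sum>r\<le>k. co r * (real i / real d) ^ r)"
    unfolding w_def by (intro uniformly_close_sum uniformly_close_mult uniformly_close_const binomial_ratio_close)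
  moreover have "(\<Sum>r\<le>k. co r * x ^ r) = (2 * c * x - c) ^ k" for x
    using binomial_ring[of "2 * c * x" "- c" k] by (simp add: co_def power_mult_distrib mult_ac)
  ultimately have 1: "uniformly_close (\<lambda>d. {..d}) w (\<lambda>d i. (2 * c * (real i / real d) - c) ^ k)" by simp
  have "pconst (2 * c) * z j = pconst (2 * c * (1 / (2 * c))) * (pvar j + pconst c)" for j
    unfolding z_def by (simp only: pconst_mult mult.assoc)
  then have v: "pvar j = pconst (2 * c) * z j + pconst (- c)" for j
    using assms(1) by (simp add: pconst_uminus)
  have "pvar j ^ k = (\<Sum>i\<le>d. pconst (w d i) * bern d i (z j))" if "k \<le> d" for d j
  proof -
    have zr: "(z j) ^ r = (\<Sum>i\<le>d. pconst (real (i choose r) / real (d choose r)) * bern d i (z j))" if "r \<le> k" for r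
    proof -
      have rd: "r \<le> d" using that \<open>k \<le> d\<close> by simp
      then have ne: "real (d choose r) \<noteq> 0" by simp
      have "(z j) ^ r = pconst (1 / real (d choose r)) * (of_nat (d choose r) * (z j) ^ r)"
        using ne by (simp add: pconst_of_nat[symmetric] mult.assoc[symmetric] pconst_mult[symmetric])
      also have "\<dots> = (\<Sum>i\<le>d. pconst (1 / real (d choose r)) * pconst (real (i choose r)) * bern d i (z j))"
        unfolding bern_moment[OF rd] by (simp only: sum_distrib_left pconst_of_nat mult.assoc)
      finally show ?thesis by (simp add: pconst_mult[symmetric])
    qed
    have "pvar j ^ k = (\<Sum>r\<le>k. of_nat (k choose r) * (pconst (2 * c) * z j) ^ r * pconst (- c) ^ (k - r))"
      by (subst v) (rule binomial_ring)
    also have "\<dots> = (\<Sum>r\<le>k. pconst (co r) * (z j) ^ r)"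
      by (simp add: co_def pconst_mult pconst_of_nat pconst_power power_mult_distrib mult_ac)
    also have "\<dots> = (\<Sum>r\<le>k. \<Sum>i\<le>d. pconst (co r * (real (i choose r) / real (d choose r))) * bern d i (z j))"
      by (intro sum.cong refl, subst zr) (simp_all only: sum_distrib_left pconst_mult mult.assoc atMost_iff)
    also have "\<dots> = (\<Sum>i\<le>d. \<Sum>r\<le>k. pconst (co r * (real (i choose r) / real (d choose r))) * bern d i (z j))"
      by (rule sum.swap)
    also have "\<dots> = (\<Sum>i\<le>d. pconst (w d i) * bern d i (z j))"
      by (simp add: w_def pconst_sum sum_distrib_right)
    finally show ?thesis .
  qed
  with 1 show ?thesis by blast
qed

text \<open>For a monomial the tensor coefficients are products of the coefficients of the powers of single
  variables, and uniform closeness is stable under finite products and sums.\<close>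

lemma bernstein_expansion:
  fixes p :: "('n::finite) mpoly"
  assumes p: "p \<in> polys \<Delta>" and c: "c > 0"
  defines "z \<equiv> (\<lambda>j. pconst (1 / (2 * c)) * (pvar j + pconst c))"
    and "node \<equiv> (\<lambda>d \<iota>. \<chi> j. if j \<in> \<Delta> then 2 * c * (real (\<iota> j) / real d) - c else 0)"
  shows "\<exists>C. uniformly_close (\<lambda>d. PiE \<Delta> (\<lambda>_. {..d})) C (\<lambda>d \<iota>. peval p (node d \<iota>)) \<and>
    (\<forall>\<^sub>F d in sequentially. p = (\<Sum>\<iota>\<in>PiE \<Delta> (\<lambda>_. {..d}). pconst (C d \<iota>) * (\<Prod>j\<in>\<Delta>. bern d (\<iota> j) (z j))))"
proof -
  define Q where "Q k w \<longleftrightarrow> uniformly_close (\<lambda>d. {..d}) w (\<lambda>d i. (2 * c * (real i / real d) - c) ^ k) \<and>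
      (\<forall>j. \<forall>d\<ge>k. pvar j ^ k = (\<Sum>i\<le>d. pconst (w d i) * bern d i (z j)))" for k w
  have "\<forall>k. \<exists>w. Q k w"
    unfolding Q_def z_def by (intro allI bernstein_var_power[OF c])
  then have "\<exists>w. \<forall>k. Q k (w k)" by (rule choice)
  then obtain w where w: "\<And>k. Q k (w k)" by blast
  have w1: "uniformly_close (\<lambda>d. {..d}) (w k) (\<lambda>d i. (2 * c * (real i / real d) - c) ^ k)" for k
    using w[of k] unfolding Q_def by (rule conjunct1)
  have w2: "pvar j ^ k = (\<Sum>i\<le>d. pconst (w k d i) * bern d i (z j))" if "k \<le> d" for k j d
    using w[of k] that unfolding Q_def by (elim conjE allE impE)
  define K where "K = Poly_Mapping.keys p"
  define e where "e \<alpha> j = Poly_Mapping.lookup \<alpha> j" for \<alpha> :: "'n \<Rightarrow>\<^sub>0 nat" and j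
  define pc where "pc = Poly_Mapping.lookup p"
  have fin: "finite K" by (simp add: K_def)
  define C where "C d \<iota> = (\<Sum>\<alpha>\<in>K. pc \<alpha> * (\<Prod>j\<in>\<Delta>. w (e \<alpha> j) d (\<iota> j)))" for d and \<iota> :: "'n \<Rightarrow> nat"
  have pe: "p = (\<Sum>\<alpha>\<in>K. pconst (pc \<alpha>) * (\<Prod>j\<in>\<Delta>. pvar j ^ e \<alpha> j))"
    using mpoly_expand[OF p] by (simp only: K_def e_def pc_def)
  have pv: "peval p (node d \<iota>) = (\<Sum>\<alpha>\<in>K. pc \<alpha> * (\<Prod>j\<in>\<Delta>. (2 * c * (real (\<iota> j) / real d) - c) ^ e \<alpha> j))" for d \<iota>
    by (subst pe) (simp add: node_def cong: prod.cong)
  have "uniformly_close (\<lambda>d. PiE \<Delta> (\<lambda>_. {..d})) C (\<lambda>d \<iota>. peval p (node d \<iota>))"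
    unfolding C_def pv
    by (intro uniformly_close_sum uniformly_close_mult uniformly_close_const uniformly_close_prod
        uniformly_close_reindex[OF w1]) (auto simp: PiE_def Pi_def)
  moreover have "\<forall>\<^sub>F d in sequentially. p = (\<Sum>\<iota>\<in>PiE \<Delta> (\<lambda>_. {..d}). pconst (C d \<iota>) * (\<Prod>j\<in>\<Delta>. bern d (\<iota> j) (z j)))"
    using eventually_ge_at_top[of "Max (insert 0 ((\<lambda>(\<alpha>, j). e \<alpha> j) ` (K \<times> UNIV)))"]
  proof eventually_elim
    case (elim d)
    have le: "e \<alpha> j \<le> d" if "\<alpha> \<in> K" for \<alpha> j
    proof -
      have in_set: "e \<alpha> j \<in> insert 0 ((\<lambda>(\<alpha>, j). e \<alpha> j) ` (K \<times> UNIV))" using that by force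
      then show ?thesis using fin by (intro order.trans[OF Max_ge[OF _ in_set] elim]) auto
    qed
    have "p = (\<Sum>\<alpha>\<in>K. pconst (pc \<alpha>) * (\<Prod>j\<in>\<Delta>. \<Sum>i\<le>d. pconst (w (e \<alpha> j) d i) * bern d i (z j)))"
      by (subst pe) (intro sum.cong refl arg_cong2[where f = "(*)"] prod.cong w2 le)
    also have "\<dots> = (\<Sum>\<alpha>\<in>K. pconst (pc \<alpha>) * (\<Sum>\<iota>\<in>PiE \<Delta> (\<lambda>_. {..d}). \<Prod>j\<in>\<Delta>. pconst (w (e \<alpha> j) d (\<iota> j)) * bern d (\<iota> j) (z j)))"
      by (subst prod_sum_PiE) auto
    also have "\<dots> = (\<Sum>\<alpha>\<in>K. \<Sum>\<iota>\<in>PiE \<Delta> (\<lambda>_. {..d}). pconst (pc \<alpha> * (\<Prod>j\<in>\<Delta>. w (e \<alpha> j) d (\<iota> j))) * (\<Prod>j\<in>\<Delta>. bern d (\<iota> j) (z j)))"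
      by (simp only: prod.distrib sum_distrib_left pconst_mult pconst_prod mult.assoc)
    also have "\<dots> = (\<Sum>\<iota>\<in>PiE \<Delta> (\<lambda>_. {..d}). \<Sum>\<alpha>\<in>K. pconst (pc \<alpha> * (\<Prod>j\<in>\<Delta>. w (e \<alpha> j) d (\<iota> j))) * (\<Prod>j\<in>\<Delta>. bern d (\<iota> j) (z j)))"
      by (rule sum.swap)
    also have "\<dots> = (\<Sum>\<iota>\<in>PiE \<Delta> (\<lambda>_. {..d}). pconst (C d \<iota>) * (\<Prod>j\<in>\<Delta>. bern d (\<iota> j) (z j)))"
      by (simp only: C_def pconst_sum sum_distrib_right)
    finally show ?case .
  qed
  ultimately show ?thesis by blast
qed

section \<open>Sums of squares\<close>

lemma sos_0 [simp]: "0 \<in> sos \<Delta>"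
  unfolding sos_def by (auto intro!: exI[of _ "0::nat"])

lemma sos_add_square:
  assumes "a \<in> sos \<Delta>" "q \<in> polys \<Delta>" shows "a + q\<^sup>2 \<in> sos \<Delta>"
proof -
  obtain s p where a: "a = (\<Sum>j<s. (p j)\<^sup>2)" "\<forall>j<(s::nat). p j \<in> polys \<Delta>"
    using assms(1) unfolding sos_def by blast
  have "a + q\<^sup>2 = (\<Sum>j<Suc s. ((p(s := q)) j)\<^sup>2)" by (simp add: a)
  moreover have "\<forall>j<Suc s. (p(s := q)) j \<in> polys \<Delta>" using a assms(2) by (auto simp: less_Suc_eq)
  ultimately show ?thesis unfolding sos_def by blast
qed

lemma sos_induct [consumes 1, case_names zero add_square]:
  assumes "a \<in> sos \<Delta>" "P 0"
    and step: "\<And>a q. a \<in> sos \<Delta> \<Longrightarrow> P a \<Longrightarrow> q \<in> polys \<Delta> \<Longrightarrow> P (a + q\<^sup>2)"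
  shows "P a"
proof -
  obtain s p where a: "a = (\<Sum>j<s. (p j)\<^sup>2)" "\<forall>j<(s::nat). p j \<in> polys \<Delta>"
    using assms(1) unfolding sos_def by blast
  have "(\<Sum>j<s. (p j)\<^sup>2) \<in> sos \<Delta> \<and> P (\<Sum>j<s. (p j)\<^sup>2)"
    using a(2)
  proof (induction s)
    case 0
    show ?case using assms(2) by simp
  next
    case (Suc s)
    then have "(\<Sum>j<s. (p j)\<^sup>2) \<in> sos \<Delta>" "P (\<Sum>j<s. (p j)\<^sup>2)" "p s \<in> polys \<Delta>" by auto
    then show ?case using step[of "\<Sum>j<s. (p j)\<^sup>2" "p s"] sos_add_square[of "\<Sum>j<s. (p j)\<^sup>2" \<Delta> "p s"]
      by (simp add: lessThan_Suc add.commute)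
  qed
  then show ?thesis using a(1) by simp
qed

lemma sos_square: "q \<in> polys \<Delta> \<Longrightarrow> q\<^sup>2 \<in> sos \<Delta>"
  using sos_add_square[of 0 \<Delta> q] by simp

lemma sos_add: "b \<in> sos \<Delta> \<Longrightarrow> a \<in> sos \<Delta> \<Longrightarrow> a + b \<in> sos \<Delta>"
  by (induction rule: sos_induct) (auto simp: add.assoc[symmetric] intro: sos_add_square)

lemma sos_mult_square:
  assumes "q \<in> polys \<Delta>" shows "a \<in> sos \<Delta> \<Longrightarrow> a * q\<^sup>2 \<in> sos \<Delta>"
proof (induction rule: sos_induct)
  case (add_square a p)
  have "(a + p\<^sup>2) * q\<^sup>2 = a * q\<^sup>2 + (p * q)\<^sup>2" by (simp add: algebra_simps power_mult_distrib)
  then show ?case using add_square assms by (simp only:) (blast intro: sos_add_square)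
qed simp

lemma sos_mult:
  assumes a: "a \<in> sos \<Delta>" shows "b \<in> sos \<Delta> \<Longrightarrow> a * b \<in> sos \<Delta>"
proof (induction rule: sos_induct)
  case (add_square b q)
  then show ?case using a unfolding distrib_left by (intro sos_add sos_mult_square)
qed simp

lemma sos_polys: "a \<in> sos \<Delta> \<Longrightarrow> a \<in> polys \<Delta>"
  by (induction rule: sos_induct) auto

lemma sos_const: "c \<ge> 0 \<Longrightarrow> pconst c \<in> sos \<Delta>"
  using sos_square[of "pconst (sqrt c)" \<Delta>] by (simp add: pconst_power[symmetric])

lemma sos_sum: "(\<And>a. a \<in> A \<Longrightarrow> f a \<in> sos \<Delta>) \<Longrightarrow> sum f A \<in> sos \<Delta>"
  by (induction A rule: infinite_finite_induct) (auto intro: sos_add)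

section \<open>The preordering of a ball\<close>

definition ball_poly :: "('n::finite) set \<Rightarrow> real \<Rightarrow> 'n mpoly" where
  "ball_poly \<Delta> R = pconst R - (\<Sum>j\<in>\<Delta>. (pvar j)\<^sup>2)"

text \<open>With a single generator the preordering coincides with the quadratic module. Hence it is
  contained in every quadratic module that contains \<open>ball_poly\<close>, and yet it is closed under
  products.\<close>

definition ball_preorder :: "('n::finite) set \<Rightarrow> real \<Rightarrow> 'n mpoly set" where
  "ball_preorder \<Delta> R = {\<sigma> + \<tau> * ball_poly \<Delta> R |\<sigma> \<tau>. \<sigma> \<in> sos \<Delta> \<and> \<tau> \<in> sos \<Delta>}"

lemma ball_poly_polys: "ball_poly \<Delta> R \<in> polys \<Delta>"
  unfolding ball_poly_def by (intro polys_diff polys_sum polys_power polys_var polys_const)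

lemma ball_preorder_sos: "a \<in> sos \<Delta> \<Longrightarrow> a \<in> ball_preorder \<Delta> R"
  unfolding ball_preorder_def by (rule CollectI, intro exI[of _ a] exI[of _ 0]) simp

lemma ball_preorder_ball: "ball_poly \<Delta> R \<in> ball_preorder \<Delta> R"
  unfolding ball_preorder_def using sos_const[of 1 \<Delta>]
  by (intro CollectI exI[of _ 0] exI[of _ 1]) simp

lemma ball_preorder_add:
  assumes "a \<in> ball_preorder \<Delta> R" "b \<in> ball_preorder \<Delta> R" shows "a + b \<in> ball_preorder \<Delta> R"
proof -
  obtain s t s' t' where "a = s + t * ball_poly \<Delta> R" "b = s' + t' * ball_poly \<Delta> R"
    "s \<in> sos \<Delta>" "t \<in> sos \<Delta>" "s' \<in> sos \<Delta>" "t' \<in> sos \<Delta>"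
    using assms unfolding ball_preorder_def by blast
  moreover from this have "a + b = (s + s') + (t + t') * ball_poly \<Delta> R" by (simp add: algebra_simps)
  ultimately show ?thesis unfolding ball_preorder_def using sos_add by blast
qed

lemma ball_preorder_mult:
  assumes "a \<in> ball_preorder \<Delta> R" "b \<in> ball_preorder \<Delta> R" shows "a * b \<in> ball_preorder \<Delta> R"
proof -
  obtain s t s' t' where e: "a = s + t * ball_poly \<Delta> R" "b = s' + t' * ball_poly \<Delta> R"
    and m: "s \<in> sos \<Delta>" "t \<in> sos \<Delta>" "s' \<in> sos \<Delta>" "t' \<in> sos \<Delta>"
    using assms unfolding ball_preorder_def by blast
  have "a * b = (s * s' + t * t' * (ball_poly \<Delta> R)\<^sup>2) + (s * t' + t * s') * ball_poly \<Delta> R"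
    unfolding e by (simp add: algebra_simps power2_eq_square)
  moreover have "s * s' + t * t' * (ball_poly \<Delta> R)\<^sup>2 \<in> sos \<Delta>" "s * t' + t * s' \<in> sos \<Delta>"
    by (intro sos_add sos_mult m sos_square ball_poly_polys)+
  ultimately show ?thesis unfolding ball_preorder_def by blast
qed

lemma ball_preorder_sum: "(\<And>a. a \<in> A \<Longrightarrow> f a \<in> ball_preorder \<Delta> R) \<Longrightarrow> sum f A \<in> ball_preorder \<Delta> R"
  by (induction A rule: infinite_finite_induct) (auto intro: ball_preorder_add ball_preorder_sos)

lemma ball_preorder_prod: "(\<And>a. a \<in> A \<Longrightarrow> f a \<in> ball_preorder \<Delta> R) \<Longrightarrow> prod f A \<in> ball_preorder \<Delta> R"
  using sos_const[of 1 \<Delta>]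
  by (induction A rule: infinite_finite_induct) (auto intro: ball_preorder_mult ball_preorder_sos)

lemma ball_preorder_power: "a \<in> ball_preorder \<Delta> R \<Longrightarrow> a ^ k \<in> ball_preorder \<Delta> R"
  using sos_const[of 1 \<Delta>]
  by (induction k) (auto intro: ball_preorder_mult ball_preorder_sos)

text \<open>The square \<open>c\<^sup>2 - x\<^sub>j\<^sup>2\<close> is \<open>(c\<^sup>2 - R) + (R - |x|\<^sup>2)\<close> plus the squares of the other variables,
  and \<open>2 c (c \<plusminus> x\<^sub>j) = (c \<plusminus> x\<^sub>j)\<^sup>2 + (c\<^sup>2 - x\<^sub>j\<^sup>2)\<close>. So the ball certifies the sides of a box around
  it.\<close>

lemma ball_preorder_facet:
  assumes "j \<in> \<Delta>" "c > 0" "R \<le> c\<^sup>2"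
  shows "pconst (1 / (2 * c)) * (pconst c + pvar j) \<in> ball_preorder \<Delta> R"
    and "pconst (1 / (2 * c)) * (pconst c - pvar j) \<in> ball_preorder \<Delta> R"
proof -
  have v: "pvar j \<in> polys \<Delta>" using assms(1) by (rule polys_var)
  have r: "pconst (c\<^sup>2) - (pvar j)\<^sup>2 = pconst (c\<^sup>2 - R) + ball_poly \<Delta> R + (\<Sum>i\<in>\<Delta> - {j}. (pvar i)\<^sup>2)"
    using assms(1) by (simp add: ball_poly_def sum.remove[of \<Delta> j] pconst_diff)
  have m: "pconst (c\<^sup>2) - (pvar j)\<^sup>2 \<in> ball_preorder \<Delta> R"
    unfolding r using assms(3)
    by (intro ball_preorder_add ball_preorder_ball ball_preorder_sos sos_const sos_sum sos_square polys_var) auto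
  have e: "pconst (1 / (2 * c)) * (pconst c + q) =
      pconst (1 / (2 * c) * (1 / (2 * c))) * ((pconst c + q)\<^sup>2 + (pconst (c\<^sup>2) - q\<^sup>2))" for q :: "'a mpoly"
  proof -
    have "(pconst c + q)\<^sup>2 + (pconst (c\<^sup>2) - q\<^sup>2) = pconst (2 * c) * (pconst c + q)"
    proof -
      have "pconst (c\<^sup>2) = pconst c * (pconst c :: 'a mpoly)" "pconst (2 * c) = pconst c + (pconst c :: 'a mpoly)"
        by (simp_all add: pconst_mult[symmetric] pconst_add[symmetric] power2_eq_square)
      then show ?thesis by (simp only: power2_eq_square) (simp add: algebra_simps)
    qed
    then show ?thesis using assms(2)
      by (simp add: mult.assoc[symmetric] pconst_mult[symmetric])
  qed
  show "pconst (1 / (2 * c)) * (pconst c + pvar j) \<in> ball_preorder \<Delta> R"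
    unfolding e using v assms(2)
    by (intro ball_preorder_mult ball_preorder_add m ball_preorder_sos sos_const sos_square polys_add) auto
  have m': "pconst (c\<^sup>2) - (- pvar j)\<^sup>2 \<in> ball_preorder \<Delta> R" using m by simp
  have "pconst (1 / (2 * c)) * (pconst c + - pvar j) \<in> ball_preorder \<Delta> R"
    unfolding e using v assms(2)
    by (intro ball_preorder_mult ball_preorder_add m' ball_preorder_sos sos_const sos_square polys_add) auto
  then show "pconst (1 / (2 * c)) * (pconst c - pvar j) \<in> ball_preorder \<Delta> R" by simp
qed

lemma bern_preorder:
  assumes "j \<in> \<Delta>" "c > 0" "R \<le> c\<^sup>2"
  shows "bern d i (pconst (1 / (2 * c)) * (pvar j + pconst c)) \<in> ball_preorder \<Delta> R"
proof -
  have "pconst (1 / (2 * c)) * (pconst c + pconst c) = (1 :: 'a mpoly)"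
    using assms(2) by (simp add: pconst_add[symmetric] pconst_mult[symmetric])
  then have "pconst (1 / (2 * c)) * (pconst c - pvar j) = 1 - pconst (1 / (2 * c)) * (pvar j + pconst c)"
    by (simp add: algebra_simps)
  then have 1: "1 - pconst (1 / (2 * c)) * (pvar j + pconst c) \<in> ball_preorder \<Delta> R"
    using ball_preorder_facet(2)[OF assms] by simp
  have 2: "pconst (1 / (2 * c)) * (pvar j + pconst c) \<in> ball_preorder \<Delta> R"
    using ball_preorder_facet(1)[OF assms] by (simp add: add.commute)
  have 3: "(of_nat (d choose i) :: 'a mpoly) \<in> ball_preorder \<Delta> R"
    using sos_const[of "real (d choose i)" \<Delta>] by (simp add: pconst_of_nat ball_preorder_sos)
  show ?thesis unfolding bern_def
    by (rule ball_preorder_mult[OF ball_preorder_mult[OF 3 ball_preorder_power[OF 2]] ball_preorder_power[OF 1]])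
qed

section \<open>Matrices that are positive definite on a box\<close>

definition quad_form :: "'n::finite set \<Rightarrow> ('n \<Rightarrow> 'n \<Rightarrow> 'n mpoly) \<Rightarrow> real ^ 'n \<Rightarrow> real ^ 'n \<Rightarrow> real" where
  "quad_form \<Delta> M x v = (\<Sum>s\<in>\<Delta>. \<Sum>t\<in>\<Delta>. v $ s * v $ t * peval (M s t) x)"

lemma quad_form_perturb:
  fixes v :: "real ^ 'n::finite"
  assumes "\<And>s t. s \<in> \<Delta> \<Longrightarrow> t \<in> \<Delta> \<Longrightarrow> \<bar>A s t - B s t\<bar> \<le> \<delta>"
  shows "(\<Sum>s\<in>\<Delta>. \<Sum>t\<in>\<Delta>. v $ s * v $ t * B s t)
    \<le> (\<Sum>s\<in>\<Delta>. \<Sum>t\<in>\<Delta>. v $ s * v $ t * A s t) + real (card \<Delta> * card \<Delta>) * \<delta> * (norm v)\<^sup>2"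
proof -
  have "(\<Sum>s\<in>\<Delta>. \<Sum>t\<in>\<Delta>. v $ s * v $ t * B s t) - (\<Sum>s\<in>\<Delta>. \<Sum>t\<in>\<Delta>. v $ s * v $ t * A s t)
      = (\<Sum>s\<in>\<Delta>. \<Sum>t\<in>\<Delta>. v $ s * v $ t * (B s t - A s t))"
    by (simp add: sum_subtractf right_diff_distrib)
  also have "\<dots> \<le> (\<Sum>s\<in>\<Delta>. \<Sum>t\<in>\<Delta>. \<delta> * (norm v)\<^sup>2)"
  proof (intro sum_mono)
    fix s t assume st: "s \<in> \<Delta>" "t \<in> \<Delta>"
    have "v $ s * v $ t * (B s t - A s t) \<le> \<bar>v $ s\<bar> * \<bar>v $ t\<bar> * \<bar>A s t - B s t\<bar>"
      by (metis abs_ge_self abs_minus_commute abs_mult)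
    also have "\<dots> \<le> (norm v * norm v) * \<delta>"
      using assms[OF st] component_le_norm_cart[of v s] component_le_norm_cart[of v t]
      by (intro mult_mono) auto
    finally show "v $ s * v $ t * (B s t - A s t) \<le> \<delta> * (norm v)\<^sup>2"
      by (simp add: power2_eq_square mult_ac)
  qed
  also have "\<dots> = real (card \<Delta> * card \<Delta>) * \<delta> * (norm v)\<^sup>2" by simp
  finally show ?thesis by simp
qed

text \<open>Expand all entries of \<open>M\<close> in tensor Bernstein polynomials of the same high degree. The matrix of
  coefficients at each index is close to the value of \<open>M\<close> at a grid point of the box, hence positive
  semidefinite, and its Gram decomposition turns \<open>\<Sum>s t. y\<^sub>s y\<^sub>t C\<^sub>s\<^sub>t\<close> into a sum of squares. The
  Bernstein polynomials themselves lie in the preordering by \<open>bern_preorder\<close>.\<close>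

lemma box_matrix_positivstellensatz_sym:
  fixes M :: "'n::finite \<Rightarrow> 'n \<Rightarrow> 'n mpoly"
  assumes Mp: "\<And>s t. M s t \<in> polys \<Delta>" and sym: "\<And>s t. M s t = M t s"
    and y: "\<And>s. s \<in> \<Delta> \<Longrightarrow> y s \<in> polys \<Delta>"
    and c: "c > 0" "R \<le> c\<^sup>2" and \<epsilon>: "\<epsilon> > 0"
    and pos: "\<And>x v. x \<in> coord_space \<Delta> \<Longrightarrow> (\<forall>j. \<bar>x $ j\<bar> \<le> c) \<Longrightarrow> v \<in> coord_space \<Delta> \<Longrightarrow>
        \<epsilon> * (norm v)\<^sup>2 \<le> quad_form \<Delta> M x v"
  shows "(\<Sum>s\<in>\<Delta>. \<Sum>t\<in>\<Delta>. y s * y t * M s t) \<in> ball_preorder \<Delta> R"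
proof -
  define z where "z j = pconst (1 / (2 * c)) * (pvar j + pconst c)" for j :: 'n
  define node where "node d \<iota> = (\<chi> j. if j \<in> \<Delta> then 2 * c * (real (\<iota> j) / real d) - c else 0)"
    for d :: nat and \<iota> :: "'n \<Rightarrow> nat"
  let ?I = "\<lambda>d::nat. PiE \<Delta> (\<lambda>_. {..d})"
  define Q where "Q p C \<longleftrightarrow> uniformly_close ?I C (\<lambda>d \<iota>. peval p (node d \<iota>)) \<and>
    (\<forall>\<^sub>F d in sequentially. p = (\<Sum>\<iota>\<in>?I d. pconst (C d \<iota>) * (\<Prod>j\<in>\<Delta>. bern d (\<iota> j) (z j))))" for p C
  have "\<exists>C. Q p C" if "p \<in> polys \<Delta>" for p
    using bernstein_expansion[OF that c(1)] unfolding Q_def node_def z_def .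
  then have "\<forall>p. \<exists>C. p \<in> polys \<Delta> \<longrightarrow> Q p C" by blast
  then have "\<exists>C. \<forall>p. p \<in> polys \<Delta> \<longrightarrow> Q p (C p)" by (rule choice)
  then obtain C where C: "\<And>p. p \<in> polys \<Delta> \<Longrightarrow> Q p (C p)" by blast
  \<comment> \<open>A perturbation of the entries by \<open>\<delta>\<close> must not exceed the margin \<open>\<epsilon>\<close>; the summand 1 covers
    empty \<open>\<Delta>\<close>.\<close>
  define \<delta> where "\<delta> = \<epsilon> / (real (card \<Delta> * card \<Delta>) + 1)"
  have \<delta>: "\<delta> > 0" "real (card \<Delta> * card \<Delta>) * \<delta> \<le> \<epsilon>"
    using \<epsilon> by (auto simp: \<delta>_def field_simps add_pos_nonneg)
  have "\<forall>\<^sub>F d in sequentially. \<forall>s\<in>UNIV. \<forall>t\<in>UNIV. (\<forall>\<iota>\<in>?I d. \<bar>C (M s t) d \<iota> - peval (M s t) (node d \<iota>)\<bar> < \<delta>) \<and>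
      M s t = (\<Sum>\<iota>\<in>?I d. pconst (C (M s t) d \<iota>) * (\<Prod>j\<in>\<Delta>. bern d (\<iota> j) (z j)))"
    using C[OF Mp] \<delta>(1) unfolding Q_def uniformly_close_def
    by (intro eventually_ball_finite ballI eventually_conj) auto
  then have "\<forall>\<^sub>F d in sequentially. d > 0 \<and> (\<forall>s\<in>UNIV. \<forall>t\<in>UNIV. (\<forall>\<iota>\<in>?I d. \<bar>C (M s t) d \<iota> - peval (M s t) (node d \<iota>)\<bar> < \<delta>) \<and>
      M s t = (\<Sum>\<iota>\<in>?I d. pconst (C (M s t) d \<iota>) * (\<Prod>j\<in>\<Delta>. bern d (\<iota> j) (z j))))"
    using eventually_gt_at_top by (rule eventually_conj[rotated])
  from eventually_happens'[OF sequentially_bot this]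
  obtain d :: nat where d: "d > 0" and all: "\<forall>s\<in>UNIV. \<forall>t\<in>UNIV. (\<forall>\<iota>\<in>?I d. \<bar>C (M s t) d \<iota> - peval (M s t) (node d \<iota>)\<bar> < \<delta>) \<and>
      M s t = (\<Sum>\<iota>\<in>?I d. pconst (C (M s t) d \<iota>) * (\<Prod>j\<in>\<Delta>. bern d (\<iota> j) (z j)))"
    by (elim exE conjE)
  have close: "\<bar>C (M s t) d \<iota> - peval (M s t) (node d \<iota>)\<bar> < \<delta>" if "\<iota> \<in> ?I d" for s t \<iota>
    using all that by (elim ballE[of _ _ s] ballE[of _ _ t] conjE) auto
  have exp: "M s t = (\<Sum>\<iota>\<in>?I d. pconst (C (M s t) d \<iota>) * (\<Prod>j\<in>\<Delta>. bern d (\<iota> j) (z j)))" for s t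
    using all by (elim ballE[of _ _ s] ballE[of _ _ t] conjE) auto
  have coeff: "(\<Sum>s\<in>\<Delta>. \<Sum>t\<in>\<Delta>. y s * y t * pconst (C (M s t) d \<iota>)) \<in> sos \<Delta>" if \<iota>: "\<iota> \<in> ?I d" for \<iota>
  proof -
    have "psd_on \<Delta> (\<lambda>s t. C (M s t) d \<iota>)"
      unfolding psd_on_def
    proof (intro conjI ballI allI)
      fix s t show "C (M s t) d \<iota> = C (M t s) d \<iota>" by (simp only: sym[of s t])
    next
      fix v :: "'n \<Rightarrow> real"
      define w where "w = (\<chi> j. if j \<in> \<Delta> then v j else 0)"
      have w: "w \<in> coord_space \<Delta>" by (simp add: w_def coord_space_def)
      have n: "node d \<iota> \<in> coord_space \<Delta>" by (simp add: node_def coord_space_def)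
      have "\<bar>node d \<iota> $ j\<bar> \<le> c" for j
      proof (cases "j \<in> \<Delta>")
        case True
        then have "\<iota> j \<le> d" using \<iota> by (auto simp: PiE_def Pi_def)
        then have "0 \<le> real (\<iota> j) / real d" "real (\<iota> j) / real d \<le> 1" using d by auto
        then have "0 \<le> 2 * c * (real (\<iota> j) / real d)" "2 * c * (real (\<iota> j) / real d) \<le> 2 * c * 1"
          using c(1) by (auto intro!: mult_left_mono simp del: times_divide_eq_right)
        then show ?thesis using True by (simp add: node_def abs_le_iff)
      qed (use c(1) in \<open>simp add: node_def\<close>)
      then have "\<epsilon> * (norm w)\<^sup>2 \<le> quad_form \<Delta> M (node d \<iota>) w" using pos n w by blast
      also have "\<dots> \<le> (\<Sum>s\<in>\<Delta>. \<Sum>t\<in>\<Delta>. w $ s * w $ t * C (M s t) d \<iota>) + real (card \<Delta> * card \<Delta>) * \<delta> * (norm w)\<^sup>2"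
        unfolding quad_form_def using close[OF \<iota>] by (intro quad_form_perturb less_imp_le)
      also have "real (card \<Delta> * card \<Delta>) * \<delta> * (norm w)\<^sup>2 \<le> \<epsilon> * (norm w)\<^sup>2"
        using \<delta>(2) by (intro mult_right_mono) auto
      finally have "0 \<le> (\<Sum>s\<in>\<Delta>. \<Sum>t\<in>\<Delta>. w $ s * w $ t * C (M s t) d \<iota>)" by simp
      also have "\<dots> = (\<Sum>s\<in>\<Delta>. \<Sum>t\<in>\<Delta>. v s * C (M s t) d \<iota> * v t)"
        by (intro sum.cong refl) (simp add: w_def)
      finally show "0 \<le> (\<Sum>s\<in>\<Delta>. \<Sum>t\<in>\<Delta>. v s * C (M s t) d \<iota> * v t)" .
    qed
    from psd_on_gram[OF _ this] obtain r :: nat and a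
      where a: "\<And>s t. s \<in> \<Delta> \<Longrightarrow> t \<in> \<Delta> \<Longrightarrow> C (M s t) d \<iota> = (\<Sum>k<r. a k s * a k t)" by auto
    have "(\<Sum>s\<in>\<Delta>. \<Sum>t\<in>\<Delta>. y s * y t * pconst (C (M s t) d \<iota>))
        = (\<Sum>s\<in>\<Delta>. \<Sum>t\<in>\<Delta>. \<Sum>k<r. (pconst (a k s) * y s) * (pconst (a k t) * y t))"
      by (intro sum.cong refl) (simp add: a pconst_sum pconst_mult sum_distrib_left mult_ac)
    also have "\<dots> = (\<Sum>s\<in>\<Delta>. \<Sum>k<r. \<Sum>t\<in>\<Delta>. (pconst (a k s) * y s) * (pconst (a k t) * y t))"
      by (intro sum.cong refl sum.swap)
    also have "\<dots> = (\<Sum>k<r. \<Sum>s\<in>\<Delta>. \<Sum>t\<in>\<Delta>. (pconst (a k s) * y s) * (pconst (a k t) * y t))"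
      by (rule sum.swap)
    also have "\<dots> = (\<Sum>k<r. (\<Sum>s\<in>\<Delta>. pconst (a k s) * y s)\<^sup>2)"
      by (simp only: power2_eq_square sum_product)
    also have "\<dots> \<in> sos \<Delta>"
      by (intro sos_sum sos_square polys_sum polys_mult polys_const y)
    finally show ?thesis .
  qed
  have "(\<Sum>s\<in>\<Delta>. \<Sum>t\<in>\<Delta>. y s * y t * M s t)
      = (\<Sum>s\<in>\<Delta>. \<Sum>t\<in>\<Delta>. \<Sum>\<iota>\<in>?I d. y s * y t * pconst (C (M s t) d \<iota>) * (\<Prod>j\<in>\<Delta>. bern d (\<iota> j) (z j)))"
    by (subst exp) (simp only: sum_distrib_left mult.assoc)
  also have "\<dots> = (\<Sum>s\<in>\<Delta>. \<Sum>\<iota>\<in>?I d. \<Sum>t\<in>\<Delta>. y s * y t * pconst (C (M s t) d \<iota>) * (\<Prod>j\<in>\<Delta>. bern d (\<iota> j) (z j)))"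
    by (intro sum.cong refl sum.swap)
  also have "\<dots> = (\<Sum>\<iota>\<in>?I d. \<Sum>s\<in>\<Delta>. \<Sum>t\<in>\<Delta>. y s * y t * pconst (C (M s t) d \<iota>) * (\<Prod>j\<in>\<Delta>. bern d (\<iota> j) (z j)))"
    by (rule sum.swap)
  also have "\<dots> = (\<Sum>\<iota>\<in>?I d. (\<Sum>s\<in>\<Delta>. \<Sum>t\<in>\<Delta>. y s * y t * pconst (C (M s t) d \<iota>)) * (\<Prod>j\<in>\<Delta>. bern d (\<iota> j) (z j)))"
    by (simp only: sum_distrib_right)
  also have "\<dots> \<in> ball_preorder \<Delta> R"
    by (rule ball_preorder_sum, rule ball_preorder_mult, rule ball_preorder_sos, erule coeff,
        rule ball_preorder_prod, unfold z_def, erule bern_preorder[OF _ c])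
  finally show ?thesis .
qed

lemma quad_form_symmetrize:
  "quad_form \<Delta> (\<lambda>s t. pconst (1/2) * (b s t + b t s)) x v = quad_form \<Delta> b x v"
proof -
  have "quad_form \<Delta> (\<lambda>s t. pconst (1/2) * (b s t + b t s)) x v
      = (quad_form \<Delta> b x v + (\<Sum>s\<in>\<Delta>. \<Sum>t\<in>\<Delta>. v $ t * v $ s * peval (b t s) x)) / 2"
    unfolding quad_form_def sum.distrib[symmetric] sum_divide_distrib
    by (intro sum.cong refl) (simp add: algebra_simps)
  also have "(\<Sum>s\<in>\<Delta>. \<Sum>t\<in>\<Delta>. v $ t * v $ s * peval (b t s) x) = quad_form \<Delta> b x v"
    unfolding quad_form_def by (rule sum.swap)
  finally show ?thesis by simp
qed

lemma poly_quad_symmetrize: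
  fixes y :: "'n::finite \<Rightarrow> 'n mpoly"
  shows "(\<Sum>s\<in>\<Delta>. \<Sum>t\<in>\<Delta>. y s * y t * (pconst (1/2) * (b s t + b t s))) = (\<Sum>s\<in>\<Delta>. \<Sum>t\<in>\<Delta>. y s * y t * b s t)"
proof -
  let ?h = "pconst (1/2) :: 'n mpoly"
  have "(\<Sum>s\<in>\<Delta>. \<Sum>t\<in>\<Delta>. y s * y t * (?h * (b s t + b t s)))
      = ?h * (\<Sum>s\<in>\<Delta>. \<Sum>t\<in>\<Delta>. y s * y t * b s t) + ?h * (\<Sum>s\<in>\<Delta>. \<Sum>t\<in>\<Delta>. y t * y s * b t s)"
    unfolding sum_distrib_left sum.distrib[symmetric] by (intro sum.cong refl) (simp add: algebra_simps)
  also have "(\<Sum>s\<in>\<Delta>. \<Sum>t\<in>\<Delta>. y t * y s * b t s) = (\<Sum>s\<in>\<Delta>. \<Sum>t\<in>\<Delta>. y s * y t * b s t)"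
    by (rule sum.swap)
  also have "?h * (\<Sum>s\<in>\<Delta>. \<Sum>t\<in>\<Delta>. y s * y t * b s t) + ?h * (\<Sum>s\<in>\<Delta>. \<Sum>t\<in>\<Delta>. y s * y t * b s t)
      = pconst (1/2 + 1/2) * (\<Sum>s\<in>\<Delta>. \<Sum>t\<in>\<Delta>. y s * y t * b s t)"
    unfolding pconst_add by (simp add: algebra_simps)
  finally show ?thesis by simp
qed

text \<open>Only the symmetric part of \<open>M\<close> enters the hypothesis and the conclusion.\<close>

lemma box_matrix_positivstellensatz:
  fixes M :: "'n::finite \<Rightarrow> 'n \<Rightarrow> 'n mpoly"
  assumes Mp: "\<And>s t. s \<in> \<Delta> \<Longrightarrow> t \<in> \<Delta> \<Longrightarrow> M s t \<in> polys \<Delta>"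
    and y: "\<And>s. s \<in> \<Delta> \<Longrightarrow> y s \<in> polys \<Delta>"
    and c: "c > 0" "R \<le> c\<^sup>2" "\<epsilon> > 0"
    and pos: "\<And>x v. x \<in> coord_space \<Delta> \<Longrightarrow> (\<forall>j. \<bar>x $ j\<bar> \<le> c) \<Longrightarrow> v \<in> coord_space \<Delta> \<Longrightarrow>
        \<epsilon> * (norm v)\<^sup>2 \<le> quad_form \<Delta> M x v"
  shows "(\<Sum>s\<in>\<Delta>. \<Sum>t\<in>\<Delta>. y s * y t * M s t) \<in> ball_preorder \<Delta> R"
proof -
  let ?M = "\<lambda>s t. pconst (1/2) * (M s t + M t s)"
  let ?M' = "\<lambda>s t. if s \<in> \<Delta> \<and> t \<in> \<Delta> then ?M s t else 0"
  have "(\<Sum>s\<in>\<Delta>. \<Sum>t\<in>\<Delta>. y s * y t * ?M' s t) \<in> ball_preorder \<Delta> R"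
  proof (rule box_matrix_positivstellensatz_sym[OF _ _ y c])
    show "?M' s t \<in> polys \<Delta>" for s t using Mp by (auto intro!: polys_mult polys_add polys_const)
    show "?M' s t = ?M' t s" for s t by (simp add: add.commute)
    have "quad_form \<Delta> ?M' x v = quad_form \<Delta> ?M x v" for x v
      unfolding quad_form_def by (intro sum.cong refl) simp
    then show "\<epsilon> * (norm v)\<^sup>2 \<le> quad_form \<Delta> ?M' x v"
      if "x \<in> coord_space \<Delta>" "\<forall>j. \<bar>x $ j\<bar> \<le> c" "v \<in> coord_space \<Delta>" for x v
      using pos[OF that] by (simp only: quad_form_symmetrize)
  qed
  also have "(\<Sum>s\<in>\<Delta>. \<Sum>t\<in>\<Delta>. y s * y t * ?M' s t) = (\<Sum>s\<in>\<Delta>. \<Sum>t\<in>\<Delta>. y s * y t * ?M s t)"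
    by (intro sum.cong refl) simp
  finally show ?thesis unfolding poly_quad_symmetrize .
qed

section \<open>Compactness\<close>

lemma compact_pos_lower_bound:
  fixes f :: "'a::topological_space \<Rightarrow> real"
  assumes "compact S" "continuous_on S f" "\<And>x. x \<in> S \<Longrightarrow> f x > 0"
  obtains e where "e > 0" "\<And>x. x \<in> S \<Longrightarrow> e \<le> f x"
proof (cases "S = {}")
  case True
  then show ?thesis using that[of 1] by auto
next
  case False
  then obtain x where "x \<in> S" "\<forall>y\<in>S. f x \<le> f y"
    using continuous_attains_inf[OF assms(1) _ assms(2)] by blast
  then show ?thesis using that[of "f x"] assms(3) by blast
qed

lemma compact_abs_bound:
  fixes f :: "'a::topological_space \<Rightarrow> real"
  assumes "compact S" "continuous_on S f"
  obtains B where "B > 0" "\<And>x. x \<in> S \<Longrightarrow> \<bar>f x\<bar> \<le> B"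
proof (cases "S = {}")
  case True
  then show ?thesis using that[of 1] by auto
next
  case False
  have "continuous_on S (\<lambda>x. \<bar>f x\<bar>)" using assms(2) by (intro continuous_intros)
  then obtain x where "x \<in> S" "\<forall>y\<in>S. \<bar>f y\<bar> \<le> \<bar>f x\<bar>"
    using continuous_attains_sup[OF assms(1) False] by blast
  then show ?thesis using that[of "\<bar>f x\<bar> + 1"] by force
qed

definition coord_box :: "('n::finite) set \<Rightarrow> real \<Rightarrow> (real ^ 'n) set" where
  "coord_box \<Delta> c = {x \<in> coord_space \<Delta>. \<forall>j. \<bar>x $ j\<bar> \<le> c}"

lemma closed_coord_space: "closed (coord_space \<Delta> :: (real ^ 'n::finite) set)"
proof -
  have "coord_space \<Delta> = (\<Inter>j\<in>- \<Delta>. {x :: real ^ 'n. x $ j = 0})"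
    by (auto simp: coord_space_def)
  then show ?thesis by (auto intro!: closed_INT closed_Collect_eq continuous_intros)
qed

lemma compact_coord_box: "compact (coord_box \<Delta> c)"
proof -
  have "coord_box \<Delta> c = coord_space \<Delta> \<inter> (\<Inter>j. {x. \<bar>x $ j\<bar> \<le> c})"
    by (auto simp: coord_box_def)
  then have "closed (coord_box \<Delta> c)"
    by (auto intro!: closed_Int closed_coord_space closed_INT closed_Collect_le continuous_intros)
  moreover have "norm x \<le> (\<Sum>j\<in>(UNIV::'a set). c)" if "x \<in> coord_box \<Delta> c" for x
  proof -
    have "norm x \<le> (\<Sum>j\<in>UNIV. \<bar>x $ j\<bar>)" by (rule norm_le_l1_cart)
    also have "\<dots> \<le> (\<Sum>j\<in>(UNIV::'a set). c)" using that by (intro sum_mono) (auto simp: coord_box_def)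
    finally show ?thesis .
  qed
  then have "bounded (coord_box \<Delta> c)" unfolding bounded_iff by blast
  ultimately show ?thesis by (simp add: compact_eq_bounded_closed)
qed

definition coord_sphere :: "('n::finite) set \<Rightarrow> (real ^ 'n) set" where
  "coord_sphere \<Delta> = coord_space \<Delta> \<inter> sphere 0 1"

lemma compact_coord_sphere: "compact (coord_sphere \<Delta>)"
  unfolding coord_sphere_def by (intro closed_Int_compact closed_coord_space compact_sphere)

lemma quad_form_scaleR: "quad_form \<Delta> M x (a *\<^sub>R v) = a\<^sup>2 * quad_form \<Delta> M x v"
  by (simp add: quad_form_def sum_distrib_left power2_eq_square mult_ac)

lemma quad_form_sphereI:
  assumes "\<And>v. v \<in> coord_sphere \<Delta> \<Longrightarrow> e \<le> quad_form \<Delta> M x v" "v \<in> coord_space \<Delta>"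
  shows "e * (norm v)\<^sup>2 \<le> quad_form \<Delta> M x v"
proof (cases "v = 0")
  case True
  then show ?thesis by (simp add: quad_form_def)
next
  case False
  then have "(1 / norm v) *\<^sub>R v \<in> coord_sphere \<Delta>"
    using assms(2) by (auto simp: coord_sphere_def)
  from assms(1)[OF this] have "e \<le> (1 / norm v)\<^sup>2 * quad_form \<Delta> M x v"
    by (simp only: quad_form_scaleR)
  then show ?thesis using False by (simp add: field_simps)
qed

lemma continuous_on_quad_form:
  "continuous_on S (\<lambda>z. quad_form \<Delta> M (fst z) (snd z))"
  unfolding quad_form_def by (intro continuous_intros)

section \<open>Quadratic modules and the archimedean Positivstellensatz\<close>

definition quadratic_module :: "('n::finite) set \<Rightarrow> 'n mpoly set \<Rightarrow> bool" where
  "quadratic_module \<Delta> T \<longleftrightarrow> sos \<Delta> \<subseteq> T \<and> T \<subseteq> polys \<Delta> \<and>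
    (\<forall>a\<in>T. \<forall>b\<in>T. a + b \<in> T) \<and> (\<forall>a\<in>T. \<forall>q\<in>polys \<Delta>. a * q\<^sup>2 \<in> T)"

lemma quadratic_module_sum:
  "quadratic_module \<Delta> T \<Longrightarrow> (\<And>a. a \<in> A \<Longrightarrow> f a \<in> T) \<Longrightarrow> sum f A \<in> T"
  by (induction A rule: infinite_finite_induct) (auto simp: quadratic_module_def intro: sos_0)

lemma quadratic_module_mult_sos:
  assumes "quadratic_module \<Delta> T" "a \<in> T"
  shows "b \<in> sos \<Delta> \<Longrightarrow> a * b \<in> T"
proof (induction rule: sos_induct)
  case zero
  show ?case using assms(1) sos_0 unfolding quadratic_module_def by auto
next
  case (add_square b q)
  then show ?case using assms unfolding quadratic_module_def distrib_left by blast
qed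

lemma quadratic_module_ball_preorder:
  assumes "quadratic_module \<Delta> T" "ball_poly \<Delta> R \<in> T" "a \<in> ball_preorder \<Delta> R" shows "a \<in> T"
proof -
  obtain s t where "a = s + ball_poly \<Delta> R * t" "s \<in> sos \<Delta>" "t \<in> sos \<Delta>"
    using assms(3) unfolding ball_preorder_def by (auto simp: mult.commute)
  then show ?thesis
    using assms(1) quadratic_module_mult_sos[OF assms(1,2)] unfolding quadratic_module_def by blast
qed

text \<open>The factor \<open>(1 - s)\<^bsup>2N\<^esup>\<close> damps \<open>s\<close> where it is positive and amplifies it where it is negative.
  For \<open>s \<ge> 0\<close>, Bernoulli's inequality gives \<open>(1 - s)\<^bsup>2N\<^esup> (1 + 2 N s) \<le> (1 - s\<^sup>2)\<^bsup>2N\<^esup> \<le> 1\<close>.\<close>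

lemma damped_le:
  fixes s :: real
  assumes "\<bar>s\<bar> \<le> 1" "N > 0"
  shows "s * (1 - s) ^ (2 * N) \<le> 1 / real N - max 0 (- s)"
proof (cases "s \<ge> 0")
  case True
  have s1: "s \<le> 1" using assms(1) by simp
  have "1 + real (2 * N) * s \<le> (1 + s) ^ (2 * N)"
    using Bernoulli_inequality[of s "2 * N"] True by simp
  then have "(1 - s) ^ (2 * N) * (1 + real (2 * N) * s) \<le> (1 - s) ^ (2 * N) * (1 + s) ^ (2 * N)"
    by (intro mult_left_mono) auto
  also have "\<dots> = (1 - s\<^sup>2) ^ (2 * N)"
    by (simp add: power_mult_distrib[symmetric] algebra_simps power2_eq_square)
  also have "\<dots> \<le> 1" using True s1 by (intro power_le_one) (auto simp: power_le_one)
  finally have 1: "(1 - s) ^ (2 * N) * (1 + real (2 * N) * s) \<le> 1" .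
  have "real N * (s * (1 - s) ^ (2 * N)) \<le> (1 - s) ^ (2 * N) * (1 + real (2 * N) * s)"
  proof -
    have "(1 - s) ^ (2 * N) * (real N * s) \<le> (1 - s) ^ (2 * N) * (1 + real (2 * N) * s)"
      using True by (intro mult_left_mono) (auto simp: mult_right_mono)
    then show ?thesis by (simp add: mult_ac)
  qed
  with 1 have "real N * (s * (1 - s) ^ (2 * N)) \<le> 1" by linarith
  then show ?thesis using True assms(2) by (simp add: field_simps)
next
  case False
  have "1 \<le> (1 - s) ^ (2 * N)" using False by (intro one_le_power) auto
  then have "s * (1 - s) ^ (2 * N) \<le> s * 1" using False by (intro mult_left_mono_neg) auto
  moreover have "0 \<le> 1 / real N" by simp
  ultimately show ?thesis using False by linarith
qed

lemma sum_coord_eq_inner: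
  assumes "v \<in> coord_space \<Delta>" shows "(\<Sum>s\<in>\<Delta>. y $ s * v $ s) = y \<bullet> (v :: real ^ 'n::finite)"
  unfolding inner_vec_def inner_real_def
  using assms by (intro sum.mono_neutral_left) (auto simp: coord_space_def)

lemma sum_coord_eq_norm:
  assumes "v \<in> coord_space \<Delta>" shows "(\<Sum>s\<in>\<Delta>. (v $ s)\<^sup>2) = (norm (v :: real ^ 'n::finite))\<^sup>2"
  using sum_coord_eq_inner[OF assms, of v] by (simp add: power2_eq_square power2_norm_eq_inner[unfolded power2_eq_square])

lemma module_set_compact:
  fixes T :: "('n::finite) mpoly set"
  assumes "ball_poly \<Delta> R \<in> T"
  defines "K \<equiv> {x \<in> coord_space \<Delta>. \<forall>g\<in>T. 0 \<le> peval g x}"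
  shows "compact K"
proof -
  have "K = coord_space \<Delta> \<inter> (\<Inter>g\<in>T. {x. 0 \<le> peval g x})" by (auto simp: K_def)
  then have cl: "closed K" by (auto intro!: closed_Int closed_coord_space closed_INT closed_Collect_le continuous_intros)
  have "norm x \<le> sqrt R" if "x \<in> K" for x
  proof -
    have "0 \<le> peval (ball_poly \<Delta> R) x" using that assms(1) by (simp add: K_def)
    then have "(\<Sum>j\<in>\<Delta>. (x $ j)\<^sup>2) \<le> R" by (simp add: ball_poly_def)
    then show ?thesis using that by (simp add: sum_coord_eq_norm K_def real_le_rsqrt)
  qed
  then have "bounded K" unfolding bounded_iff by blast
  then show ?thesis using cl by (simp add: compact_eq_bounded_closed)
qed

text \<open>Let \<open>K\<close> be the nonnegativity set of \<open>T\<close>. Outside \<open>K\<close> the matrix \<open>M\<close> may fail to be positive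
  definite, but there some \<open>g\<close> in \<open>T\<close> is negative. By compactness finitely many \<open>g\<close> suffice on a
  box around \<open>K\<close>, and by \<open>damped_le\<close> a combination \<open>\<tau>\<close> of \<open>g (1 - g)\<^bsup>2N\<^esup>\<close> in \<open>T\<close> is hardly positive
  on the box and bounded away from 0 on the negative side where \<open>M\<close> fails. Subtracting a large
  multiple of \<open>\<tau>\<close> from the diagonal makes \<open>M\<close> positive definite on the box, and
  \<open>box_matrix_positivstellensatz\<close> applies. The multiple of \<open>\<tau>\<close> returns as \<open>\<tau>\<close> times
  \<open>\<Sum>s. y\<^sub>s\<^sup>2\<close>, an element of \<open>T\<close>.\<close>

theorem archimedean_matrix_positivstellensatz:
  fixes M :: "'n::finite \<Rightarrow> 'n \<Rightarrow> 'n mpoly"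
  assumes T: "quadratic_module \<Delta> T" and ball: "ball_poly \<Delta> R \<in> T"
    and Mp: "\<And>s t. s \<in> \<Delta> \<Longrightarrow> t \<in> \<Delta> \<Longrightarrow> M s t \<in> polys \<Delta>"
    and y: "\<And>s. s \<in> \<Delta> \<Longrightarrow> y s \<in> polys \<Delta>"
    and pos: "\<And>x v. x \<in> coord_space \<Delta> \<Longrightarrow> \<forall>g\<in>T. peval g x \<ge> 0 \<Longrightarrow> v \<in> coord_space \<Delta> \<Longrightarrow> v \<noteq> 0 \<Longrightarrow>
        quad_form \<Delta> M x v > 0"
  shows "(\<Sum>s\<in>\<Delta>. \<Sum>t\<in>\<Delta>. y s * y t * M s t) \<in> T"
proof -
  define c where "c = \<bar>R\<bar> + 1"
  have c1: "c \<ge> 1" "R \<le> c" by (auto simp: c_def)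
  then have "c * 1 \<le> c * c" by (intro mult_left_mono) auto
  with c1 have c: "c > 0" "R \<le> c\<^sup>2" unfolding power2_eq_square by linarith+
  let ?D = "coord_box \<Delta> c" and ?S = "coord_sphere \<Delta>"
  let ?\<phi> = "\<lambda>z. quad_form \<Delta> M (fst z) (snd z)"
  define K where "K = {x \<in> coord_space \<Delta>. \<forall>g\<in>T. peval g x \<ge> 0}"
  have KD: "K \<subseteq> ?D"
  proof
    fix x assume x: "x \<in> K"
    then have "peval (ball_poly \<Delta> R) x \<ge> 0" using ball by (simp add: K_def)
    then have r: "(\<Sum>j\<in>\<Delta>. (x $ j)\<^sup>2) \<le> R" by (simp add: ball_poly_def)
    have "\<bar>x $ j\<bar> \<le> c" for j
    proof (cases "j \<in> \<Delta>")
      case True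
      then have "(x $ j)\<^sup>2 \<le> (\<Sum>j\<in>\<Delta>. (x $ j)\<^sup>2)" by (intro member_le_sum) auto
      then have "(x $ j)\<^sup>2 \<le> c\<^sup>2" using r c(2) by linarith
      then show ?thesis using c(1) by (simp add: abs_le_square_iff[symmetric])
    next
      case False
      then show ?thesis using x c(1) by (simp add: K_def coord_space_def)
    qed
    then show "x \<in> ?D" using x by (simp add: K_def coord_box_def)
  qed
  have "compact K" unfolding K_def by (rule module_set_compact[OF ball])
  then have KS: "compact (K \<times> ?S)" by (intro compact_Times compact_coord_sphere)
  have "?\<phi> z > 0" if "z \<in> K \<times> ?S" for z
  proof -
    have "snd z \<noteq> 0" using that by (auto simp: coord_sphere_def)
    then show ?thesis using that pos[of "fst z" "snd z"] by (auto simp: K_def coord_sphere_def)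
  qed
  from compact_pos_lower_bound[OF KS continuous_on_quad_form this]
  obtain \<epsilon> where \<epsilon>: "\<epsilon> > 0" "\<And>z. z \<in> K \<times> ?S \<Longrightarrow> \<epsilon> \<le> ?\<phi> z"
    by blast
  \<comment> \<open>The points of the box at which \<open>M\<close> is not positive definite with margin \<open>\<epsilon> / 2\<close>; none of them
    lies in \<open>K\<close>.\<close>
  define C where "C = fst ` {z \<in> ?D \<times> ?S. ?\<phi> z \<le> \<epsilon> / 2}"
  have "closed {z. ?\<phi> z \<le> \<epsilon> / 2}"
    by (intro closed_Collect_le continuous_on_quad_form continuous_intros)
  then have cc: "compact ((?D \<times> ?S) \<inter> {z. ?\<phi> z \<le> \<epsilon> / 2})"
    by (intro compact_Int_closed compact_Times compact_coord_box compact_coord_sphere)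
  have C_eq: "C = fst ` ((?D \<times> ?S) \<inter> {z. ?\<phi> z \<le> \<epsilon> / 2})" unfolding C_def by auto
  have "compact C"
    unfolding C_eq by (rule compact_continuous_image[OF continuous_on_fst[OF continuous_on_id] cc])
  have "\<exists>g\<in>T. peval g x < 0" if "x \<in> C" for x
  proof -
    obtain v where v: "x \<in> ?D" "v \<in> ?S" "?\<phi> (x, v) \<le> \<epsilon> / 2" using \<open>x \<in> C\<close> by (auto simp: C_def)
    then have "x \<notin> K" using \<epsilon>(2)[of "(x, v)"] \<epsilon>(1) by auto
    then show ?thesis using v(1) by (auto simp: K_def coord_box_def not_le)
  qed
  then have "C \<subseteq> (\<Union>g\<in>T. {x. peval g x < 0})" by blast
  moreover have "open {x :: real ^ 'n. peval g x < 0}" for g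
    by (intro open_Collect_less continuous_intros)
  ultimately obtain gs where gs: "gs \<subseteq> T" "finite gs" "C \<subseteq> (\<Union>g\<in>gs. {x. peval g x < 0})"
    using compactE_image[OF \<open>compact C\<close>, of T "\<lambda>g. {x. peval g x < 0}"] by metis
  let ?neg = "\<lambda>x. \<Sum>g\<in>gs. max 0 (- peval g x)"
  have "?neg x > 0" if x: "x \<in> C" for x
  proof -
    obtain g where "g \<in> gs" "peval g x < 0" using gs(3) x by blast
    then show ?thesis using gs(2) by (intro sum_pos2[of _ g]) auto
  qed
  moreover have "continuous_on C ?neg" by (intro continuous_intros)
  ultimately obtain \<delta> where \<delta>: "\<delta> > 0" "\<And>x. x \<in> C \<Longrightarrow> \<delta> \<le> ?neg x"
    using compact_pos_lower_bound[OF \<open>compact C\<close>, of ?neg] by metis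
  have "continuous_on ?D (\<lambda>x. \<Sum>g\<in>gs. \<bar>peval g x\<bar>)" by (intro continuous_intros)
  from compact_abs_bound[OF compact_coord_box this]
  obtain B where B: "B > 0" "\<And>x. x \<in> ?D \<Longrightarrow> \<bar>\<Sum>g\<in>gs. \<bar>peval g x\<bar>\<bar> \<le> B"
    by blast
  have gB: "\<bar>peval g x / B\<bar> \<le> 1" if "g \<in> gs" "x \<in> ?D" for g x
  proof -
    have "\<bar>peval g x\<bar> \<le> (\<Sum>g\<in>gs. \<bar>peval g x\<bar>)" using that(1) gs(2) by (intro member_le_sum) auto
    also have "\<dots> \<le> B" using B(2)[OF that(2)] by linarith
    finally show ?thesis using B(1) by simp
  qed
  from compact_abs_bound[OF compact_Times[OF compact_coord_box compact_coord_sphere] continuous_on_quad_form]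
  obtain b where b: "b > 0" "\<And>z. z \<in> ?D \<times> ?S \<Longrightarrow> \<bar>?\<phi> z\<bar> \<le> b"
    by blast
  \<comment> \<open>On the set just covered, \<open>-A \<tau>\<close> has to compensate a form as negative as \<open>-b\<close>; the choice
    makes \<open>A \<delta> / B\<close> equal to \<open>b + \<epsilon>\<close>. Elsewhere \<open>A \<tau>\<close> must use up at most \<open>\<epsilon> / 4\<close>, which
    fixes \<open>N\<close>.\<close>
  define A where "A = (b + \<epsilon>) * B / \<delta>"
  have A: "A > 0" "A * (\<delta> / B) = b + \<epsilon>" using b(1) \<epsilon>(1) B(1) \<delta>(1) by (auto simp: A_def)
  obtain N :: nat where N: "N > 0" "A * (real (card gs) / real N) \<le> \<epsilon> / 4"
  proof -
    obtain N :: nat where "A * real (card gs) / (\<epsilon> / 4) < real N" using reals_Archimedean2 by blast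
    then have "A * real (card gs) < real N * (\<epsilon> / 4)" using \<epsilon>(1) by (simp add: field_simps)
    moreover have "N > 0" using calculation A(1) by (cases "N = 0") (auto simp: mult_less_0_iff)
    ultimately show ?thesis using that[of N] by (simp add: field_simps)
  qed
  define \<tau> where "\<tau> = (\<Sum>g\<in>gs. g * pconst (1 / B) * ((1 - g * pconst (1 / B)) ^ N)\<^sup>2)"
  have gp: "g \<in> polys \<Delta>" if "g \<in> gs" for g
    using that gs(1) T unfolding quadratic_module_def by blast
  have \<tau>p: "\<tau> \<in> polys \<Delta>"
    unfolding \<tau>_def by (intro polys_sum polys_mult polys_power polys_diff polys_1 polys_const gp)
  have \<tau>T: "\<tau> * pconst A \<in> T"
  proof -
    have "(g * pconst (1 / B)) * ((1 - g * pconst (1 / B)) ^ N)\<^sup>2 \<in> T" if "g \<in> gs" for g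
    proof (rule quadratic_module_mult_sos[OF T])
      show "g * pconst (1 / B) \<in> T"
        using quadratic_module_mult_sos[OF T _ sos_const] that gs(1) B(1) by auto
      show "((1 - g * pconst (1 / B)) ^ N)\<^sup>2 \<in> sos \<Delta>"
        by (intro sos_square polys_mult polys_power polys_diff polys_1 polys_const gp that)
    qed
    then have "\<tau> \<in> T" unfolding \<tau>_def by (intro quadratic_module_sum[OF T])
    then show ?thesis using quadratic_module_mult_sos[OF T _ sos_const] A(1) by auto
  qed
  have \<tau>x: "peval \<tau> x \<le> real (card gs) / real N - ?neg x / B" if "x \<in> ?D" for x
  proof -
    have "peval \<tau> x = (\<Sum>g\<in>gs. peval g x / B * (1 - peval g x / B) ^ (2 * N))"
      by (simp add: \<tau>_def power_mult[symmetric] mult.commute)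
    also have "\<dots> \<le> (\<Sum>g\<in>gs. 1 / real N - max 0 (- peval g x) / B)"
    proof (rule sum_mono)
      fix g assume "g \<in> gs"
      have "max 0 (- (peval g x / B)) = max 0 (- peval g x) / B"
        using B(1) by (auto simp: max_def field_simps)
      then show "peval g x / B * (1 - peval g x / B) ^ (2 * N) \<le> 1 / real N - max 0 (- peval g x) / B"
        using damped_le[OF gB[OF \<open>g \<in> gs\<close> that] N(1)] by simp
    qed
    also have "\<dots> = real (card gs) / real N - ?neg x / B"
      by (simp add: sum_subtractf sum_divide_distrib)
    finally show ?thesis .
  qed
  define M' where "M' s t = M s t - (if s = t then \<tau> * pconst A else 0)" for s t
  have qM': "quad_form \<Delta> M' x v = quad_form \<Delta> M x v - peval \<tau> x * A * (\<Sum>s\<in>\<Delta>. (v $ s)\<^sup>2)" for x v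
  proof -
    have "quad_form \<Delta> M' x v = quad_form \<Delta> M x v
        - (\<Sum>s\<in>\<Delta>. \<Sum>t\<in>\<Delta>. v $ s * v $ t * peval (if s = t then \<tau> * pconst A else 0) x)"
      unfolding quad_form_def M'_def sum_subtractf[symmetric] by (simp add: right_diff_distrib)
    also have "(\<Sum>s\<in>\<Delta>. \<Sum>t\<in>\<Delta>. v $ s * v $ t * peval (if s = t then \<tau> * pconst A else 0) x)
        = (\<Sum>s\<in>\<Delta>. \<Sum>t\<in>\<Delta>. if s = t then v $ s * v $ s * (peval \<tau> x * A) else 0)"
      by (intro sum.cong refl) auto
    also have "\<dots> = peval \<tau> x * A * (\<Sum>s\<in>\<Delta>. (v $ s)\<^sup>2)"
      by (simp add: sum_distrib_left power2_eq_square mult_ac)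
    finally show ?thesis .
  qed
  have "\<epsilon> / 4 \<le> quad_form \<Delta> M' x v" if x: "x \<in> ?D" and v: "v \<in> ?S" for x v
  proof -
    have e: "quad_form \<Delta> M' x v = ?\<phi> (x, v) - A * peval \<tau> x"
      using v by (simp add: qM' coord_sphere_def sum_coord_eq_norm)
    have nn: "0 \<le> ?neg x" by (intro sum_nonneg) auto
    have up: "A * peval \<tau> x \<le> A * (real (card gs) / real N) - A * (?neg x / B)"
      using mult_left_mono[OF \<tau>x[OF x], of A] A(1) by (simp add: right_diff_distrib)
    show ?thesis
    proof (cases "x \<in> C")
      case True
      have "\<delta> / B \<le> ?neg x / B" using \<delta>(2)[OF True] B(1) by (simp add: divide_right_mono)
      then have "b + \<epsilon> \<le> A * (?neg x / B)" using A mult_left_mono[of "\<delta> / B" "?neg x / B" A] by simp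
      moreover have "- b \<le> ?\<phi> (x, v)" using b(2)[of "(x, v)"] x v by auto
      ultimately show ?thesis using e up N(2) \<epsilon>(1) by linarith
    next
      case False
      then have "\<epsilon> / 2 < ?\<phi> (x, v)" using x v by (force simp: C_def)
      moreover have "0 \<le> A * (?neg x / B)" using A(1) B(1) nn by simp
      ultimately show ?thesis using e up N(2) by linarith
    qed
  qed
  then have pos': "\<epsilon> / 4 * (norm v)\<^sup>2 \<le> quad_form \<Delta> M' x v"
    if "x \<in> coord_space \<Delta>" "\<forall>j. \<bar>x $ j\<bar> \<le> c" "v \<in> coord_space \<Delta>" for x v
    using that by (intro quad_form_sphereI) (auto simp: coord_box_def)
  have M'p: "M' s t \<in> polys \<Delta>" if "s \<in> \<Delta>" "t \<in> \<Delta>" for s t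
    unfolding M'_def using Mp that \<tau>p by auto
  have "(\<Sum>s\<in>\<Delta>. \<Sum>t\<in>\<Delta>. y s * y t * M' s t) \<in> ball_preorder \<Delta> R"
    by (rule box_matrix_positivstellensatz[OF M'p y c _ pos']) (use \<epsilon>(1) in auto)
  then have 1: "(\<Sum>s\<in>\<Delta>. \<Sum>t\<in>\<Delta>. y s * y t * M' s t) \<in> T"
    by (rule quadratic_module_ball_preorder[OF T ball])
  have 2: "\<tau> * pconst A * (\<Sum>s\<in>\<Delta>. (y s)\<^sup>2) \<in> T"
    by (intro quadratic_module_mult_sos[OF T \<tau>T] sos_sum sos_square y)
  have "(\<Sum>s\<in>\<Delta>. \<Sum>t\<in>\<Delta>. y s * y t * M s t)
      = (\<Sum>s\<in>\<Delta>. \<Sum>t\<in>\<Delta>. y s * y t * M' s t) + (\<Sum>s\<in>\<Delta>. \<Sum>t\<in>\<Delta>. if s = t then y s * y s * (\<tau> * pconst A) else 0)"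
    unfolding sum.distrib[symmetric] by (intro sum.cong refl) (auto simp: M'_def algebra_simps)
  also have "(\<Sum>s\<in>\<Delta>. \<Sum>t\<in>\<Delta>. if s = t then y s * y s * (\<tau> * pconst A) else 0) = \<tau> * pconst A * (\<Sum>s\<in>\<Delta>. (y s)\<^sup>2)"
    by (simp add: sum_distrib_left power2_eq_square mult_ac)
  finally show ?thesis using 1 2 T unfolding quadratic_module_def by auto
qed

section \<open>Quadratic forms of matrices\<close>

lemma scalar_prod_mult_mat_vec:
  assumes "A \<in> carrier_mat l l" "v \<in> carrier_vec l" "w \<in> carrier_vec l"
  shows "scalar_prod v (A *\<^sub>v w) = (\<Sum>a<l. \<Sum>b<l. vec_index v a * A $$ (a, b) * vec_index w b)"
  using assms
  by (auto simp: scalar_prod_def sum_distrib_left mult.assoc atLeast0LessThan intro!: sum.cong)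

lemma psd_iff_psd_on:
  assumes "A \<in> carrier_mat l l"
  shows "psd A \<longleftrightarrow> psd_on {..<l} (\<lambda>a b. A $$ (a, b))"
proof -
  have sy: "A \<in> sym_mats l \<longleftrightarrow> (\<forall>a\<in>{..<l}. \<forall>b\<in>{..<l}. A $$ (a, b) = A $$ (b, a))"
  proof
    assume "A \<in> sym_mats l"
    then have "transpose_mat A = A" by (simp add: sym_mats_def)
    then show "\<forall>a\<in>{..<l}. \<forall>b\<in>{..<l}. A $$ (a, b) = A $$ (b, a)"
      using assms by (metis carrier_matD index_transpose_mat(1) lessThan_iff)
  next
    assume "\<forall>a\<in>{..<l}. \<forall>b\<in>{..<l}. A $$ (a, b) = A $$ (b, a)"
    then have "transpose_mat A = A" using assms by (intro eq_matI) auto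
    then show "A \<in> sym_mats l" using assms by (simp add: sym_mats_def)
  qed
  have q: "(\<forall>v\<in>carrier_vec l. 0 \<le> scalar_prod v (A *\<^sub>v v)) \<longleftrightarrow>
      (\<forall>v. 0 \<le> (\<Sum>a<l. \<Sum>b<l. v a * A $$ (a, b) * v b))"
  proof (intro iffI allI ballI)
    fix v assume h: "\<forall>v\<in>carrier_vec l. 0 \<le> scalar_prod v (A *\<^sub>v v)"
    have "0 \<le> scalar_prod (Matrix.vec l v) (A *\<^sub>v Matrix.vec l v)" using h by simp
    also have "\<dots> = (\<Sum>a<l. \<Sum>b<l. v a * A $$ (a, b) * v b)"
      by (subst scalar_prod_mult_mat_vec[OF assms]) auto
    finally show "0 \<le> (\<Sum>a<l. \<Sum>b<l. v a * A $$ (a, b) * v b)" .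
  next
    fix v :: "real Matrix.vec" assume h: "\<forall>v. 0 \<le> (\<Sum>a<l. \<Sum>b<l. v a * A $$ (a, b) * v b)" and v: "v \<in> carrier_vec l"
    show "0 \<le> scalar_prod v (A *\<^sub>v v)"
      unfolding scalar_prod_mult_mat_vec[OF assms v v] using spec[OF h, of "vec_index v"] .
  qed
  show ?thesis unfolding psd_def psd_on_def using assms sy q by auto
qed

lemma sym_poly_matsD:
  assumes "G \<in> sym_poly_mats \<Delta> l"
  shows "G \<in> carrier_mat l l" "\<And>a b. a < l \<Longrightarrow> b < l \<Longrightarrow> G $$ (a, b) \<in> polys \<Delta>"
    "\<And>a b. a < l \<Longrightarrow> b < l \<Longrightarrow> G $$ (a, b) = G $$ (b, a)"
proof -
  show c: "G \<in> carrier_mat l l" using assms by (simp add: sym_poly_mats_def)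
  fix a b assume ab: "a < l" "b < l"
  show "G $$ (a, b) \<in> polys \<Delta>"
    using assms ab c elements_matI[of G l l a b "G $$ (a, b)"] by (auto simp: sym_poly_mats_def)
  have "transpose_mat G = G" using assms by (simp add: sym_poly_mats_def)
  then show "G $$ (a, b) = G $$ (b, a)" using c ab by (metis carrier_matD index_transpose_mat(1))
qed

lemma mat_peval_carrier [simp]: "mat_peval G x \<in> carrier_mat l l \<longleftrightarrow> G \<in> carrier_mat l l"
  by (auto simp: mat_peval_def)

lemma mat_peval_index: "G \<in> carrier_mat l l \<Longrightarrow> a < l \<Longrightarrow> b < l \<Longrightarrow> mat_peval G x $$ (a, b) = peval (G $$ (a, b)) x"
  by (auto simp: mat_peval_def)

lemma psd_mat_peval_iff:
  assumes "G \<in> sym_poly_mats \<Delta> l"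
  shows "psd (mat_peval G x) \<longleftrightarrow> (\<forall>v. 0 \<le> (\<Sum>a<l. \<Sum>b<l. v a * peval (G $$ (a, b)) x * v b))"
proof -
  note G = sym_poly_matsD[OF assms]
  have "psd (mat_peval G x) \<longleftrightarrow> psd_on {..<l} (\<lambda>a b. mat_peval G x $$ (a, b))"
    by (rule psd_iff_psd_on) (simp add: G)
  also have "\<dots> \<longleftrightarrow> (\<forall>v. 0 \<le> (\<Sum>a<l. \<Sum>b<l. v a * mat_peval G x $$ (a, b) * v b))"
    unfolding psd_on_def using G by (auto simp: mat_peval_index)
  also have "\<dots> \<longleftrightarrow> (\<forall>v. 0 \<le> (\<Sum>a<l. \<Sum>b<l. v a * peval (G $$ (a, b)) x * v b))"
  proof -
    have "(\<Sum>a<l. \<Sum>b<l. v a * mat_peval G x $$ (a, b) * v b)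
        = (\<Sum>a<l. \<Sum>b<l. v a * peval (G $$ (a, b)) x * v b)" for v :: "nat \<Rightarrow> real"
      by (intro sum.cong refl) (simp add: mat_peval_index[OF G(1)])
    then show ?thesis by simp
  qed
  finally show ?thesis .
qed

section \<open>The quadratic module of a matrix\<close>

definition poly_form :: "('n::finite) mpoly mat \<Rightarrow> 'n mpoly Matrix.vec \<Rightarrow> 'n mpoly" where
  "poly_form G P = scalar_prod P (G *\<^sub>v P)"

lemma poly_vecsD:
  assumes "P \<in> poly_vecs \<Delta> l"
  shows "P \<in> carrier_vec l" "a < l \<Longrightarrow> vec_index P a \<in> polys \<Delta>"
  using assms vec_setI[of P a "vec_index P a"] by (auto simp: poly_vecs_def)

lemma poly_vecsI: "(\<And>a. a < l \<Longrightarrow> g a \<in> polys \<Delta>) \<Longrightarrow> Matrix.vec l g \<in> poly_vecs \<Delta> l"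
  by (auto simp: poly_vecs_def vec_set_def)

lemma poly_form_expand:
  assumes "G \<in> sym_poly_mats \<Delta> l" "P \<in> carrier_vec l"
  shows "poly_form G P = (\<Sum>a<l. \<Sum>b<l. vec_index P a * G $$ (a, b) * vec_index P b)"
  unfolding poly_form_def by (rule scalar_prod_mult_mat_vec[OF sym_poly_matsD(1)[OF assms(1)] assms(2,2)])

lemma sum_lessThan_add:
  fixes f :: "nat \<Rightarrow> 'a::comm_monoid_add"
  shows "(\<Sum>j<s + s'. f j) = (\<Sum>j<s. f j) + (\<Sum>j<s'. f (s + j))"
  by (induction s') (simp_all add: add.assoc)

lemma qmoduleI:
  assumes "G \<in> sym_poly_mats \<Delta> l" "\<sigma> \<in> sos \<Delta>" "\<And>j. j < (s::nat) \<Longrightarrow> P j \<in> poly_vecs \<Delta> l"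
  shows "\<sigma> + (\<Sum>j<s. poly_form G (P j)) \<in> qmodule \<Delta> G"
  using assms sym_poly_matsD(1)[OF assms(1)] unfolding qmodule_def poly_form_def by auto

lemma qmoduleE:
  assumes "p \<in> qmodule \<Delta> G" "G \<in> sym_poly_mats \<Delta> l"
  obtains \<sigma> s P where "p = \<sigma> + (\<Sum>j<(s::nat). poly_form G (P j))" "\<sigma> \<in> sos \<Delta>"
    "\<And>j. j < s \<Longrightarrow> P j \<in> poly_vecs \<Delta> l"
  using assms sym_poly_matsD(1)[OF assms(2)] unfolding qmodule_def poly_form_def by auto

lemma poly_form_polys:
  assumes "G \<in> sym_poly_mats \<Delta> l" "P \<in> poly_vecs \<Delta> l" shows "poly_form G P \<in> polys \<Delta>"
  unfolding poly_form_expand[OF assms(1) poly_vecsD(1)[OF assms(2)]]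
  by (intro polys_sum polys_mult poly_vecsD(2)[OF assms(2)] sym_poly_matsD(2)[OF assms(1)]) auto

lemma poly_form_scale:
  assumes "G \<in> sym_poly_mats \<Delta> l" "P \<in> poly_vecs \<Delta> l" "q \<in> polys \<Delta>"
  shows "Matrix.vec l (\<lambda>a. vec_index P a * q) \<in> poly_vecs \<Delta> l"
    "poly_form G (Matrix.vec l (\<lambda>a. vec_index P a * q)) = poly_form G P * q\<^sup>2"
proof -
  show "Matrix.vec l (\<lambda>a. vec_index P a * q) \<in> poly_vecs \<Delta> l"
    by (intro poly_vecsI polys_mult poly_vecsD(2)[OF assms(2)] assms(3))
  have "poly_form G (Matrix.vec l (\<lambda>a. vec_index P a * q))
      = (\<Sum>a<l. \<Sum>b<l. vec_index P a * q * G $$ (a, b) * (vec_index P b * q))"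
    by (subst poly_form_expand[OF assms(1)]) auto
  also have "\<dots> = poly_form G P * q\<^sup>2"
    unfolding poly_form_expand[OF assms(1) poly_vecsD(1)[OF assms(2)]] sum_distrib_right
    by (intro sum.cong refl) (simp add: power2_eq_square mult_ac)
  finally show "poly_form G (Matrix.vec l (\<lambda>a. vec_index P a * q)) = poly_form G P * q\<^sup>2" .
qed

lemma quadratic_module_qmodule:
  assumes G: "G \<in> sym_poly_mats \<Delta> l" shows "quadratic_module \<Delta> (qmodule \<Delta> G)"
  unfolding quadratic_module_def
proof (intro conjI subsetI ballI)
  fix a assume "a \<in> sos \<Delta>"
  then show "a \<in> qmodule \<Delta> G" using qmoduleI[OF G, of a 0] by simp
next
  fix a assume "a \<in> qmodule \<Delta> G"
  then show "a \<in> polys \<Delta>"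
    by (elim qmoduleE[OF _ G]) (auto intro: sos_polys intro!: polys_add[OF sos_polys] polys_sum poly_form_polys[OF G])
next
  fix a b assume a: "a \<in> qmodule \<Delta> G" and b: "b \<in> qmodule \<Delta> G"
  obtain \<sigma> s P where 1: "a = \<sigma> + (\<Sum>j<(s::nat). poly_form G (P j))" "\<sigma> \<in> sos \<Delta>"
    "\<And>j. j < s \<Longrightarrow> P j \<in> poly_vecs \<Delta> l" by (rule qmoduleE[OF a G]) (rule that)
  obtain \<sigma>' s' P' where 2: "b = \<sigma>' + (\<Sum>j<(s'::nat). poly_form G (P' j))" "\<sigma>' \<in> sos \<Delta>"
    "\<And>j. j < s' \<Longrightarrow> P' j \<in> poly_vecs \<Delta> l" by (rule qmoduleE[OF b G]) (rule that)
  define Q where "Q j = (if j < s then P j else P' (j - s))" for j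
  have "a + b = (\<sigma> + \<sigma>') + (\<Sum>j<s + s'. poly_form G (Q j))"
    unfolding sum_lessThan_add 1(1) 2(1) by (simp add: Q_def algebra_simps)
  moreover have "\<And>j. j < s + s' \<Longrightarrow> Q j \<in> poly_vecs \<Delta> l" using 1(3) 2(3) by (simp add: Q_def)
  ultimately show "a + b \<in> qmodule \<Delta> G" using qmoduleI[OF G sos_add[OF 2(2) 1(2)]] by simp
next
  fix a q assume a: "a \<in> qmodule \<Delta> G" and q: "q \<in> polys \<Delta>"
  obtain \<sigma> s P where 1: "a = \<sigma> + (\<Sum>j<(s::nat). poly_form G (P j))" "\<sigma> \<in> sos \<Delta>"
    "\<And>j. j < s \<Longrightarrow> P j \<in> poly_vecs \<Delta> l" by (rule qmoduleE[OF a G]) (rule that)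
  define Q where "Q j = Matrix.vec l (\<lambda>a. vec_index (P j) a * q)" for j
  have Q: "Q j \<in> poly_vecs \<Delta> l" "poly_form G (Q j) = poly_form G (P j) * q\<^sup>2" if "j < s" for j
    unfolding Q_def using poly_form_scale[OF G 1(3)[OF that] q] by auto
  have "a * q\<^sup>2 = \<sigma> * q\<^sup>2 + (\<Sum>j<s. poly_form G (Q j))"
    unfolding 1(1) by (simp add: distrib_right sum_distrib_right Q(2))
  also have "\<dots> \<in> qmodule \<Delta> G" by (intro qmoduleI[OF G] sos_mult_square q 1(2) Q(1))
  finally show "a * q\<^sup>2 \<in> qmodule \<Delta> G" .
qed

lemma poly_form_in_qmodule:
  assumes "G \<in> sym_poly_mats \<Delta> l" "P \<in> poly_vecs \<Delta> l" shows "poly_form G P \<in> qmodule \<Delta> G"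
  using qmoduleI[OF assms(1) sos_0, of 1 "\<lambda>_. P"] assms(2) by simp

lemma peval_poly_form:
  assumes "G \<in> sym_poly_mats \<Delta> l" "P \<in> carrier_vec l"
  shows "peval (poly_form G P) x
    = (\<Sum>a<l. \<Sum>b<l. peval (vec_index P a) x * peval (G $$ (a, b)) x * peval (vec_index P b) x)"
  unfolding poly_form_expand[OF assms] by simp

lemma sos_nonneg: "a \<in> sos \<Delta> \<Longrightarrow> 0 \<le> peval a x"
  by (induction rule: sos_induct) auto

lemma qmodule_nonneg:
  assumes G: "G \<in> sym_poly_mats \<Delta> l" and "p \<in> qmodule \<Delta> G" "psd (mat_peval G x)"
  shows "0 \<le> peval p x"
proof -
  obtain \<sigma> s P where 1: "p = \<sigma> + (\<Sum>j<(s::nat). poly_form G (P j))" "\<sigma> \<in> sos \<Delta>"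
    "\<And>j. j < s \<Longrightarrow> P j \<in> poly_vecs \<Delta> l" by (rule qmoduleE[OF assms(2) G]) (rule that)
  have "0 \<le> peval (poly_form G (P j)) x" if "j < s" for j
    unfolding peval_poly_form[OF G poly_vecsD(1)[OF 1(3)[OF that]]]
    using assms(3) unfolding psd_mat_peval_iff[OF G] by (rule spec)
  then show ?thesis unfolding 1(1) using sos_nonneg[OF 1(2)]
    by (simp only: peval_add peval_sum) (intro add_nonneg_nonneg sum_nonneg, auto)
qed

text \<open>Constant vectors already suffice: the polynomial \<open>v\<^sup>T G v\<close> lies in the module for each real \<open>v\<close>.
  So the nonnegativity set of the module is exactly the feasible set of \<open>G\<close>.\<close>

lemma psd_if_qmodule_nonneg:
  assumes G: "G \<in> sym_poly_mats \<Delta> l" and "\<forall>g\<in>qmodule \<Delta> G. 0 \<le> peval g x"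
  shows "psd (mat_peval G x)"
  unfolding psd_mat_peval_iff[OF G]
proof
  fix v :: "nat \<Rightarrow> real"
  let ?P = "Matrix.vec l (\<lambda>a. pconst (v a))"
  have "0 \<le> peval (poly_form G ?P) x"
    using assms(2) poly_form_in_qmodule[OF G poly_vecsI[of l "\<lambda>a. pconst (v a)"]] by auto
  also have "\<dots> = (\<Sum>a<l. \<Sum>b<l. v a * peval (G $$ (a, b)) x * v b)"
    by (subst peval_poly_form[OF G]) auto
  finally show "0 \<le> (\<Sum>a<l. \<Sum>b<l. v a * peval (G $$ (a, b)) x * v b)" .
qed

section \<open>Degrees\<close>

lemma polys_upto_iff: "p \<in> polys_upto \<Delta> d \<longleftrightarrow> Poly_Mapping.keys p \<subseteq> expts \<Delta> d"
proof -
  have "tdeg p \<le> d \<longleftrightarrow> (\<forall>\<alpha>\<in>Poly_Mapping.keys p. mdeg \<alpha> \<le> d)"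
    unfolding tdeg_def by (subst Max_le_iff) auto
  then show ?thesis by (auto simp: polys_upto_def polys_def expts_def)
qed

lemma mdeg_add: "mdeg (\<alpha> + \<beta>) = mdeg \<alpha> + mdeg \<beta>"
  by (simp add: mdeg_def lookup_add sum.distrib)

lemma expts_add:
  assumes "\<alpha> \<in> expts \<Delta> d" "\<beta> \<in> expts \<Delta> e" "d + e \<le> c" shows "\<alpha> + \<beta> \<in> expts \<Delta> c"
  using assms Poly_Mapping.keys_add[of \<alpha> \<beta>] by (auto simp: expts_def mdeg_add)

lemma polys_upto_mult:
  assumes "p \<in> polys_upto \<Delta> d" "q \<in> polys_upto \<Delta> e" "d + e \<le> c" shows "p * q \<in> polys_upto \<Delta> c"
  unfolding polys_upto_iff
proof
  fix \<gamma> assume "\<gamma> \<in> Poly_Mapping.keys (p * q)"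
  from subsetD[OF keys_mult this]
  obtain \<alpha> \<beta> where "\<gamma> = \<alpha> + \<beta>" "\<alpha> \<in> Poly_Mapping.keys p" "\<beta> \<in> Poly_Mapping.keys q" by blast
  then show "\<gamma> \<in> expts \<Delta> c" using assms unfolding polys_upto_iff by (auto intro: expts_add)
qed

lemma polys_upto_add: "p \<in> polys_upto \<Delta> d \<Longrightarrow> q \<in> polys_upto \<Delta> d \<Longrightarrow> p + q \<in> polys_upto \<Delta> d"
  unfolding polys_upto_iff using Poly_Mapping.keys_add[of p q] by blast

lemma polys_upto_0 [simp]: "0 \<in> polys_upto \<Delta> d"
  by (simp add: polys_upto_iff)

lemma polys_upto_sum: "(\<And>a. a \<in> A \<Longrightarrow> f a \<in> polys_upto \<Delta> d) \<Longrightarrow> sum f A \<in> polys_upto \<Delta> d"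
  by (induction A rule: infinite_finite_induct) (auto intro: polys_upto_add)

lemma pmonom_upto: "\<alpha> \<in> expts \<Delta> d \<Longrightarrow> pmonom \<alpha> \<in> polys_upto \<Delta> d"
  by (simp add: polys_upto_iff pmonom_def)

lemma tdeg_le_vec_tdeg: "P \<in> carrier_vec l \<Longrightarrow> a < l \<Longrightarrow> tdeg (vec_index P a) \<le> vec_tdeg P"
  unfolding vec_tdeg_def by (intro Max_ge) (auto simp: vec_set_def)

lemma tdeg_le_mat_tdeg: "G \<in> carrier_mat l l \<Longrightarrow> a < l \<Longrightarrow> b < l \<Longrightarrow> tdeg (G $$ (a, b)) \<le> mat_tdeg G"
  unfolding mat_tdeg_def by (intro Max_ge insertI2 imageI elements_matI) (auto simp: elements_mat_def)

lemma finite_expts: "finite (expts \<Delta> d)"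
proof (rule finite_imageD)
  have "Poly_Mapping.lookup \<alpha> j \<le> d" if "\<alpha> \<in> expts \<Delta> d" for \<alpha> j
  proof -
    have "Poly_Mapping.lookup \<alpha> j \<le> mdeg \<alpha>" unfolding mdeg_def by (intro member_le_sum) auto
    then show ?thesis using that by (simp add: expts_def)
  qed
  then have "Poly_Mapping.lookup ` expts \<Delta> d \<subseteq> PiE UNIV (\<lambda>_. {..d})" by auto
  then show "finite (Poly_Mapping.lookup ` expts \<Delta> d)"
    by (rule finite_subset) (auto intro: finite_PiE)
  show "inj_on Poly_Mapping.lookup (expts \<Delta> d)" by (auto intro: inj_onI poly_mapping_eqI)
qed

section \<open>The Riesz functional\<close>

lemma riesz_superset:
  assumes "finite S" "Poly_Mapping.keys p \<subseteq> S"
  shows "riesz y p = (\<Sum>\<alpha>\<in>S. Poly_Mapping.lookup p \<alpha> * y \<alpha>)"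
  unfolding riesz_def by (rule sum.mono_neutral_left) (use assms in \<open>auto simp: in_keys_iff\<close>)

lemma riesz_0 [simp]: "riesz y 0 = 0"
  by (simp add: riesz_def)

lemma riesz_add: "riesz y (p + q) = riesz y p + riesz y q"
proof -
  let ?S = "Poly_Mapping.keys p \<union> Poly_Mapping.keys q"
  have "Poly_Mapping.keys (p + q) \<subseteq> ?S" by (rule Poly_Mapping.keys_add)
  then show ?thesis
    by (subst (1 2 3) riesz_superset[of ?S]) (auto simp: lookup_add algebra_simps sum.distrib)
qed

lemma riesz_sum: "riesz y (sum f A) = (\<Sum>a\<in>A. riesz y (f a))"
  by (induction A rule: infinite_finite_induct) (auto simp: riesz_add)

lemma riesz_single: "riesz y (Poly_Mapping.single \<alpha> c) = c * y \<alpha>"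
  by (subst riesz_superset[of "{\<alpha>}"]) auto

lemma riesz_const_mult: "riesz y (pconst c * p) = c * riesz y p"
proof -
  have "pconst c * p = (\<Sum>\<alpha>\<in>Poly_Mapping.keys p. Poly_Mapping.single \<alpha> (c * Poly_Mapping.lookup p \<alpha>))"
    by (subst mpoly_sum_singles[of p]) (simp add: pconst_def mult_single sum_distrib_left)
  then have "riesz y (pconst c * p) = (\<Sum>\<alpha>\<in>Poly_Mapping.keys p. c * (Poly_Mapping.lookup p \<alpha> * y \<alpha>))"
    by (simp add: riesz_sum riesz_single mult_ac)
  then show ?thesis by (simp add: riesz_def sum_distrib_left)
qed

lemma mpoly_sum_monoms:
  assumes "finite E" "Poly_Mapping.keys q \<subseteq> E"
  shows "q = (\<Sum>\<alpha>\<in>E. pconst (Poly_Mapping.lookup q \<alpha>) * pmonom \<alpha>)"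
proof -
  have "(\<Sum>\<alpha>\<in>E. pconst (Poly_Mapping.lookup q \<alpha>) * pmonom \<alpha>)
      = (\<Sum>\<alpha>\<in>E. Poly_Mapping.single \<alpha> (Poly_Mapping.lookup q \<alpha>))"
    by (simp add: pconst_def pmonom_def mult_single)
  also have "\<dots> = (\<Sum>\<alpha>\<in>Poly_Mapping.keys q. Poly_Mapping.single \<alpha> (Poly_Mapping.lookup q \<alpha>))"
    using assms by (intro sum.mono_neutral_right) (auto simp: in_keys_iff)
  finally show ?thesis using mpoly_sum_singles[of q] by simp
qed

text \<open>With \<open>g = 1\<close> this is the form of the moment matrix, with \<open>g\<close> an entry of \<open>G\<close> that of a block of
  the localizing matrix, at the coefficient vectors of \<open>p\<close> and \<open>q\<close>.\<close>

lemma riesz_product: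
  assumes "finite E" "Poly_Mapping.keys p \<subseteq> E" "Poly_Mapping.keys q \<subseteq> E"
  shows "riesz y (p * g * q) = (\<Sum>\<alpha>\<in>E. \<Sum>\<beta>\<in>E.
    Poly_Mapping.lookup p \<alpha> * riesz y (g * (pmonom \<alpha> * pmonom \<beta>)) * Poly_Mapping.lookup q \<beta>)"
proof -
  let ?p = "\<lambda>\<alpha>. pconst (Poly_Mapping.lookup p \<alpha>) * pmonom \<alpha>" and ?q = "\<lambda>\<alpha>. pconst (Poly_Mapping.lookup q \<alpha>) * pmonom \<alpha>"
  have "p * g * q = (\<Sum>\<alpha>\<in>E. ?p \<alpha>) * g * (\<Sum>\<beta>\<in>E. ?q \<beta>)"
    using mpoly_sum_monoms[OF assms(1,2)] mpoly_sum_monoms[OF assms(1,3)] by argo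
  also have "\<dots> = (\<Sum>\<alpha>\<in>E. \<Sum>\<beta>\<in>E. ?p \<alpha> * g * ?q \<beta>)"
    by (simp only: sum_distrib_right) (simp only: sum_distrib_left)
  also have "\<dots> = (\<Sum>\<alpha>\<in>E. \<Sum>\<beta>\<in>E. pconst (Poly_Mapping.lookup p \<alpha> * Poly_Mapping.lookup q \<beta>) * (g * (pmonom \<alpha> * pmonom \<beta>)))"
    by (intro sum.cong refl) (simp add: pconst_mult mult_ac)
  finally show ?thesis by (simp only: riesz_sum riesz_const_mult) (simp add: mult_ac)
qed

lemma riesz_sub_moments:
  "p \<in> polys_upto \<Delta> (2 * k) \<Longrightarrow> riesz (sub_moments \<Delta> k y) p = riesz y p"
  unfolding polys_upto_iff riesz_def sub_moments_def by (intro sum.cong refl) auto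

section \<open>Truncated certificates\<close>

text \<open>The squares are bounded one by one, which is what pairing with a moment matrix of order \<open>k\<close>
  needs; the truncated quadratic module bounds only the degree of their sum.\<close>

definition certificate :: "('n::finite) set \<Rightarrow> nat \<Rightarrow> 'n mpoly mat \<Rightarrow> nat \<Rightarrow> 'n mpoly \<Rightarrow> bool" where
  "certificate \<Delta> l G k p \<longleftrightarrow> (\<exists>(s::nat) q (s'::nat) P. p = (\<Sum>j<s. (q j)\<^sup>2) + (\<Sum>j<s'. poly_form G (P j)) \<and>
    (\<forall>j<s. q j \<in> polys_upto \<Delta> k) \<and> (\<forall>j<s'. P j \<in> poly_vecs \<Delta> l \<and> 2 * vec_tdeg (P j) + mat_tdeg G \<le> 2 * k))"

lemma qmodule_certificate:
  assumes G: "G \<in> sym_poly_mats \<Delta> l" and "p \<in> qmodule \<Delta> G"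
  shows "\<exists>K. \<forall>k\<ge>K. certificate \<Delta> l G k p"
proof -
  obtain \<sigma> s' P where 1: "p = \<sigma> + (\<Sum>j<(s'::nat). poly_form G (P j))" "\<sigma> \<in> sos \<Delta>"
    "\<And>j. j < s' \<Longrightarrow> P j \<in> poly_vecs \<Delta> l" by (rule qmoduleE[OF assms(2) G]) (rule that)
  obtain s q where 2: "\<sigma> = (\<Sum>j<s. (q j)\<^sup>2)" "\<forall>j<(s::nat). q j \<in> polys \<Delta>"
    using 1(2) unfolding sos_def by blast
  let ?K = "(\<Sum>j<s. tdeg (q j)) + (\<Sum>j<s'. vec_tdeg (P j)) + mat_tdeg G"
  have "certificate \<Delta> l G k p" if k: "?K \<le> k" for k
  proof -
    have "tdeg (q j) \<le> k" if "j < s" for j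
    proof -
      have "tdeg (q j) \<le> (\<Sum>j<s. tdeg (q j))" using that by (intro member_le_sum) auto
      then show ?thesis using k by linarith
    qed
    moreover have "2 * vec_tdeg (P j) + mat_tdeg G \<le> 2 * k" if "j < s'" for j
    proof -
      have "vec_tdeg (P j) \<le> (\<Sum>j<s'. vec_tdeg (P j))" using that by (intro member_le_sum) auto
      then show ?thesis using k by linarith
    qed
    ultimately show ?thesis unfolding certificate_def using 1 2
      by (intro exI[of _ s] exI[of _ q] exI[of _ s'] exI[of _ P]) (auto simp: polys_upto_def)
  qed
  then show ?thesis by blast
qed

lemma poly_form_upto:
  assumes G: "G \<in> sym_poly_mats \<Delta> l" and P: "P \<in> poly_vecs \<Delta> l" "2 * vec_tdeg P + mat_tdeg G \<le> d"
  shows "poly_form G P \<in> polys_upto \<Delta> d"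
  unfolding poly_form_expand[OF G poly_vecsD(1)[OF P(1)]]
proof (intro polys_upto_sum)
  fix a b assume "a \<in> {..<l}" "b \<in> {..<l}"
  then have ab: "a < l" "b < l" by auto
  have v: "vec_index P c \<in> polys_upto \<Delta> (vec_tdeg P)" if "c < l" for c
    using poly_vecsD[OF P(1)] tdeg_le_vec_tdeg that by (auto simp: polys_upto_def)
  have g: "G $$ (a, b) \<in> polys_upto \<Delta> (mat_tdeg G)"
    using sym_poly_matsD[OF G] tdeg_le_mat_tdeg ab by (auto simp: polys_upto_def)
  have "vec_index P a * G $$ (a, b) \<in> polys_upto \<Delta> (vec_tdeg P + mat_tdeg G)"
    by (rule polys_upto_mult[OF v[OF ab(1)] g]) simp
  then show "vec_index P a * G $$ (a, b) * vec_index P b \<in> polys_upto \<Delta> d"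
    by (rule polys_upto_mult[OF _ v[OF ab(2)]]) (use P(2) in simp)
qed

lemma square_upto: "q \<in> polys_upto \<Delta> k \<Longrightarrow> q\<^sup>2 \<in> polys_upto \<Delta> (2 * k)"
  unfolding power2_eq_square by (rule polys_upto_mult) auto

lemma certificate_upto:
  assumes "G \<in> sym_poly_mats \<Delta> l" "certificate \<Delta> l G k p"
  shows "p \<in> polys_upto \<Delta> (2 * k)"
  using assms(2) unfolding certificate_def
  by (elim exE conjE) (auto intro!: polys_upto_add polys_upto_sum square_upto poly_form_upto[OF assms(1)])

lemma certificate_qmodule_upto:
  assumes G: "G \<in> sym_poly_mats \<Delta> l" and "certificate \<Delta> l G k p"
  shows "p \<in> qmodule_upto \<Delta> G (2 * k)"
proof -
  obtain s q s' P where p: "p = (\<Sum>j<(s::nat). (q j)\<^sup>2) + (\<Sum>j<(s'::nat). poly_form G (P j))"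
    and q: "\<forall>j<s. q j \<in> polys_upto \<Delta> k"
    and P: "\<forall>j<s'. P j \<in> poly_vecs \<Delta> l \<and> 2 * vec_tdeg (P j) + mat_tdeg G \<le> 2 * k"
    using assms(2) unfolding certificate_def by (elim exE conjE) (rule that)
  have "(\<Sum>j<s. (q j)\<^sup>2) \<in> sos \<Delta>"
    using q by (intro sos_sum sos_square) (auto simp: polys_upto_def)
  moreover have "(\<Sum>j<s. (q j)\<^sup>2) \<in> polys_upto \<Delta> (2 * k)"
    using q by (intro polys_upto_sum square_upto) auto
  ultimately have "(\<Sum>j<s. (q j)\<^sup>2) \<in> sos_upto \<Delta> (2 * k)" by (simp add: sos_upto_def)
  moreover have "dim_row G = l" using sym_poly_matsD(1)[OF G] by simp
  ultimately show ?thesis unfolding qmodule_upto_def p poly_form_def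
    using P by (intro CollectI exI[of _ "\<Sum>j<s. (q j)\<^sup>2"] exI[of _ s'] exI[of _ P]) auto
qed

lemma le_localizing_order:
  assumes "2 * d + mat_tdeg G \<le> 2 * k" shows "d \<le> localizing_order G k"
  unfolding localizing_order_def by (rule le_nat_floor) (use assms in linarith)

lemma localizing_order_le:
  assumes "mat_tdeg G \<le> 2 * k" shows "2 * localizing_order G k + mat_tdeg G \<le> 2 * k"
proof -
  have "real (localizing_order G k) \<le> real k - real (mat_tdeg G) / 2"
    unfolding localizing_order_def using assms by (intro of_nat_floor) linarith
  then show ?thesis by linarith
qed

lemma psd_on_nonneg: "psd_on I M \<Longrightarrow> 0 \<le> (\<Sum>s\<in>I. \<Sum>t\<in>I. v s * M s t * v t)"
  unfolding psd_on_def by blast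

text \<open>Weak duality: each square is a value of the form of the moment matrix, and each \<open>P\<^sup>T G P\<close> a value
  of the form of the localizing matrix.\<close>

lemma certificate_riesz_nonneg:
  assumes G: "G \<in> sym_poly_mats \<Delta> l" and cert: "certificate \<Delta> l G k p"
    and loc: "psd_on ({..<l} \<times> expts \<Delta> (localizing_order G k)) (localizing_mat G y)"
    and mom: "psd_on (expts \<Delta> k) (moment_mat y)"
  shows "0 \<le> riesz y p"
proof -
  obtain s q s' P where p: "p = (\<Sum>j<(s::nat). (q j)\<^sup>2) + (\<Sum>j<(s'::nat). poly_form G (P j))"
    and q: "\<forall>j<s. q j \<in> polys_upto \<Delta> k"
    and P: "\<forall>j<s'. P j \<in> poly_vecs \<Delta> l \<and> 2 * vec_tdeg (P j) + mat_tdeg G \<le> 2 * k"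
    using cert unfolding certificate_def by (elim exE conjE) (rule that)
  have 1: "0 \<le> riesz y ((q j)\<^sup>2)" if "j < s" for j
  proof -
    have k: "Poly_Mapping.keys (q j) \<subseteq> expts \<Delta> k" using q that unfolding polys_upto_iff by blast
    have "(q j)\<^sup>2 = q j * 1 * q j" by (simp add: power2_eq_square)
    then have "riesz y ((q j)\<^sup>2) = (\<Sum>\<alpha>\<in>expts \<Delta> k. \<Sum>\<beta>\<in>expts \<Delta> k.
        Poly_Mapping.lookup (q j) \<alpha> * moment_mat y \<alpha> \<beta> * Poly_Mapping.lookup (q j) \<beta>)"
      by (simp only: riesz_product[OF finite_expts k k] moment_mat_def mult_1)
    then show ?thesis using psd_on_nonneg[OF mom] by simp
  qed
  have 2: "0 \<le> riesz y (poly_form G (P j))" if j: "j < s'" for j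
  proof -
    let ?E = "expts \<Delta> (localizing_order G k)"
    define c where "c = (\<lambda>(a, \<alpha>). Poly_Mapping.lookup (vec_index (P j) a) \<alpha>)"
    have Pj: "P j \<in> poly_vecs \<Delta> l" "2 * vec_tdeg (P j) + mat_tdeg G \<le> 2 * k" using P j by auto
    have k: "Poly_Mapping.keys (vec_index (P j) a) \<subseteq> ?E" if "a < l" for a
      unfolding polys_upto_iff[symmetric]
      using poly_vecsD[OF Pj(1)] tdeg_le_vec_tdeg[OF poly_vecsD(1)[OF Pj(1)] that] le_localizing_order[OF Pj(2)] that
      by (auto simp: polys_upto_def)
    have "riesz y (poly_form G (P j)) = (\<Sum>a<l. \<Sum>b<l. riesz y (vec_index (P j) a * G $$ (a, b) * vec_index (P j) b))"
      unfolding poly_form_expand[OF G poly_vecsD(1)[OF Pj(1)]] by (simp only: riesz_sum)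
    also have "\<dots> = (\<Sum>a<l. \<Sum>b<l. \<Sum>\<alpha>\<in>?E. \<Sum>\<beta>\<in>?E. c (a, \<alpha>) * localizing_mat G y (a, \<alpha>) (b, \<beta>) * c (b, \<beta>))"
      by (intro sum.cong refl) (simp add: riesz_product[OF finite_expts k k] c_def localizing_mat_def)
    also have "\<dots> = (\<Sum>a<l. \<Sum>\<alpha>\<in>?E. \<Sum>b<l. \<Sum>\<beta>\<in>?E. c (a, \<alpha>) * localizing_mat G y (a, \<alpha>) (b, \<beta>) * c (b, \<beta>))"
      by (intro sum.cong refl sum.swap)
    also have "\<dots> = (\<Sum>x\<in>{..<l} \<times> ?E. \<Sum>z\<in>{..<l} \<times> ?E. c x * localizing_mat G y x z * c z)"
      by (simp only: sum.cartesian_product')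
    finally show ?thesis using psd_on_nonneg[OF loc] by simp
  qed
  show ?thesis unfolding p riesz_add riesz_sum
    by (intro add_nonneg_nonneg sum_nonneg) (auto intro: 1 2)
qed

section \<open>Moments of a point mass\<close>

lemma riesz_monom_value:
  "(\<And>\<alpha>. \<alpha> \<in> Poly_Mapping.keys p \<Longrightarrow> y \<alpha> = monom_value \<alpha> x) \<Longrightarrow> riesz y p = peval p x"
  unfolding riesz_def peval_def monom_value_def by (intro sum.cong refl) simp

lemma peval_pmonom: "peval (pmonom \<alpha>) x = monom_value \<alpha> x"
  by (simp add: pmonom_def peval_single)

lemma min_order_le:
  assumes "min_order m f G \<le> k" "i \<in> {1..m}"
  shows "tdeg (f i) \<le> 2 * k" "mat_tdeg (G i) \<le> 2 * k"
proof -
  have "nat (max \<lceil>real (tdeg (f i)) / 2\<rceil> \<lceil>real (mat_tdeg (G i)) / 2\<rceil>) \<le> min_order m f G"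
    unfolding min_order_def using assms(2) by (intro Max_ge) auto
  then have "\<lceil>real (tdeg (f i)) / 2\<rceil> \<le> int k" "\<lceil>real (mat_tdeg (G i)) / 2\<rceil> \<le> int k"
    using assms(1) by linarith+
  then show "tdeg (f i) \<le> 2 * k" "mat_tdeg (G i) \<le> 2 * k"
    by (simp_all add: ceiling_le_iff)
qed

text \<open>The moment matrix of a point mass is the rank one matrix of monomial values, and its localizing
  matrix at the coefficients \<open>v\<close> is the value of the form of \<open>G(u)\<close> at the vector of polynomial
  values.\<close>

lemma dirac_moment_feasible:
  assumes G: "\<forall>i\<in>{1..m}. G i \<in> sym_poly_mats (\<Delta> i) (l i)"
    and u: "u \<in> feasible m \<Delta> G" and k: "min_order m f G \<le> k" and m: "1 \<le> m"
  defines "y \<equiv> restrict (\<lambda>\<alpha>. monom_value \<alpha> u) (sparse_expts m \<Delta> k)"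
  shows "y \<in> moment_feasible m \<Delta> G k"
    and "\<And>i p. i \<in> {1..m} \<Longrightarrow> p \<in> polys_upto (\<Delta> i) (2 * k) \<Longrightarrow> riesz (sub_moments (\<Delta> i) k y) p = peval p u"
proof -
  show r: "riesz (sub_moments (\<Delta> i) k y) p = peval p u"
    if "i \<in> {1..m}" "p \<in> polys_upto (\<Delta> i) (2 * k)" for i p
    using that unfolding polys_upto_iff
    by (intro riesz_monom_value) (auto simp: sub_moments_def y_def sparse_expts_def)
  have mom: "psd_on (expts (\<Delta> i) k) (moment_mat (sub_moments (\<Delta> i) k y))" if i: "i \<in> {1..m}" for i
  proof -
    have e: "moment_mat (sub_moments (\<Delta> i) k y) \<alpha> \<beta> = monom_value \<alpha> u * monom_value \<beta> u"
      if "\<alpha> \<in> expts (\<Delta> i) k" "\<beta> \<in> expts (\<Delta> i) k" for \<alpha> \<beta>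
      unfolding moment_mat_def
      by (subst r[OF i polys_upto_mult[OF pmonom_upto[OF that(1)] pmonom_upto[OF that(2)]]])
         (simp_all add: peval_pmonom)
    show ?thesis unfolding psd_on_def
    proof (intro conjI ballI allI)
      fix v :: "('a \<Rightarrow>\<^sub>0 nat) \<Rightarrow> real"
      have "(\<Sum>s\<in>expts (\<Delta> i) k. \<Sum>t\<in>expts (\<Delta> i) k. v s * moment_mat (sub_moments (\<Delta> i) k y) s t * v t)
          = (\<Sum>s\<in>expts (\<Delta> i) k. v s * monom_value s u)\<^sup>2"
        unfolding power2_eq_square sum_product by (intro sum.cong refl) (simp add: e mult_ac)
      then show "0 \<le> (\<Sum>s\<in>expts (\<Delta> i) k. \<Sum>t\<in>expts (\<Delta> i) k. v s * moment_mat (sub_moments (\<Delta> i) k y) s t * v t)"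
        by simp
    qed (simp add: e)
  qed
  have loc: "psd_on ({..<dim_row (G i)} \<times> expts (\<Delta> i) (localizing_order (G i) k)) (localizing_mat (G i) (sub_moments (\<Delta> i) k y))"
    if i: "i \<in> {1..m}" for i
  proof -
    have Gi: "G i \<in> sym_poly_mats (\<Delta> i) (l i)" using G i by blast
    note Gd = sym_poly_matsD[OF Gi]
    have dim: "dim_row (G i) = l i" using Gd(1) by simp
    let ?E = "expts (\<Delta> i) (localizing_order (G i) k)" and ?L = "localizing_mat (G i) (sub_moments (\<Delta> i) k y)"
    have e: "?L (a, \<alpha>) (b, \<beta>) = monom_value \<alpha> u * peval (G i $$ (a, b)) u * monom_value \<beta> u"
      if "a < l i" "b < l i" "\<alpha> \<in> ?E" "\<beta> \<in> ?E" for a b \<alpha> \<beta>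
    proof -
      let ?o = "localizing_order (G i) k"
      have "G i $$ (a, b) \<in> polys_upto (\<Delta> i) (mat_tdeg (G i))"
        using Gd(2) tdeg_le_mat_tdeg[OF Gd(1)] that by (auto simp: polys_upto_def)
      moreover have "pmonom \<alpha> * pmonom \<beta> \<in> polys_upto (\<Delta> i) (2 * ?o)"
        by (rule polys_upto_mult[OF pmonom_upto[OF that(3)] pmonom_upto[OF that(4)]]) simp
      ultimately have "G i $$ (a, b) * (pmonom \<alpha> * pmonom \<beta>) \<in> polys_upto (\<Delta> i) (2 * k)"
        by (rule polys_upto_mult) (use localizing_order_le[OF min_order_le(2)[OF k i]] in simp)
      then show ?thesis unfolding localizing_mat_def by (simp add: r[OF i] peval_pmonom)
    qed
    have psd: "psd (mat_peval (G i) (coord_proj (\<Delta> i) u))" using u i by (simp add: feasible_def)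
    show ?thesis unfolding psd_on_def dim
    proof (intro conjI ballI allI)
      fix s t assume "s \<in> {..<l i} \<times> ?E" "t \<in> {..<l i} \<times> ?E"
      then show "?L s t = ?L t s" using Gd(3) by (auto simp: e)
    next
      fix v :: "nat \<times> ('a \<Rightarrow>\<^sub>0 nat) \<Rightarrow> real"
      define w where "w a = (\<Sum>\<alpha>\<in>?E. v (a, \<alpha>) * monom_value \<alpha> u)" for a
      have "(\<Sum>s\<in>{..<l i} \<times> ?E. \<Sum>t\<in>{..<l i} \<times> ?E. v s * ?L s t * v t)
          = (\<Sum>a<l i. \<Sum>\<alpha>\<in>?E. \<Sum>b<l i. \<Sum>\<beta>\<in>?E. v (a, \<alpha>) * ?L (a, \<alpha>) (b, \<beta>) * v (b, \<beta>))"
        by (simp only: sum.cartesian_product')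
      also have "\<dots> = (\<Sum>a<l i. \<Sum>b<l i. \<Sum>\<alpha>\<in>?E. \<Sum>\<beta>\<in>?E. v (a, \<alpha>) * ?L (a, \<alpha>) (b, \<beta>) * v (b, \<beta>))"
        by (intro sum.cong refl sum.swap)
      also have "\<dots> = (\<Sum>a<l i. \<Sum>b<l i. w a * peval (G i $$ (a, b)) u * w b)"
      proof (intro sum.cong refl)
        fix a b assume "a \<in> {..<l i}" "b \<in> {..<l i}"
        then have "(\<Sum>\<alpha>\<in>?E. \<Sum>\<beta>\<in>?E. v (a, \<alpha>) * ?L (a, \<alpha>) (b, \<beta>) * v (b, \<beta>))
            = (\<Sum>\<alpha>\<in>?E. \<Sum>\<beta>\<in>?E. peval (G i $$ (a, b)) u * ((v (a, \<alpha>) * monom_value \<alpha> u) * (v (b, \<beta>) * monom_value \<beta> u)))"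
          by (intro sum.cong refl) (simp add: e mult_ac)
        also have "\<dots> = peval (G i $$ (a, b)) u * (w a * w b)"
          unfolding w_def sum_product by (simp only: sum_distrib_left)
        finally show "(\<Sum>\<alpha>\<in>?E. \<Sum>\<beta>\<in>?E. v (a, \<alpha>) * ?L (a, \<alpha>) (b, \<beta>) * v (b, \<beta>)) = w a * peval (G i $$ (a, b)) u * w b"
          by (simp add: mult_ac)
      qed
      also have "\<dots> = (\<Sum>a<l i. \<Sum>b<l i. w a * peval (G i $$ (a, b)) (coord_proj (\<Delta> i) u) * w b)"
        using Gd(2) by (intro sum.cong refl) (simp add: peval_coord_proj)
      also have "0 \<le> \<dots>" using psd unfolding psd_mat_peval_iff[OF Gi] by (rule spec)
      finally show "0 \<le> (\<Sum>s\<in>{..<l i} \<times> ?E. \<Sum>t\<in>{..<l i} \<times> ?E. v s * ?L s t * v t)" .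
    qed
  qed
  have "0 \<in> sparse_expts m \<Delta> k" using m by (auto simp: sparse_expts_def expts_def mdeg_def)
  then have "y 0 = 1" by (simp add: y_def monom_value_def)
  then show "y \<in> moment_feasible m \<Delta> G k"
    unfolding moment_feasible_def using mom loc by (auto simp: y_def)
qed

section \<open>Tightness of the hierarchy\<close>

lemma qmodule_upto_subset: "qmodule_upto \<Delta> G d \<subseteq> qmodule \<Delta> G"
  unfolding qmodule_upto_def qmodule_def sos_upto_def by blast

text \<open>From some order on all the \<open>f\<^sub>i + p\<^sub>i\<close> have truncated certificates, and they sum to the
  objective minus \<open>fmin\<close>. No larger bound is certified, since elements of the modules are
  nonnegative at the feasible point \<open>u\<close>. On the moment side a certificate bounds every feasible value
  from below by \<open>fmin\<close>, and the point mass at \<open>u\<close> attains this bound.\<close>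

theorem hierarchy_tight_if_certified:
  assumes m: "1 \<le> m" and f: "\<forall>i\<in>{1..m}. f i \<in> polys (\<Delta> i)"
    and G: "\<forall>i\<in>{1..m}. G i \<in> sym_poly_mats (\<Delta> i) (l i)"
    and u: "u \<in> feasible m \<Delta> G" and fmin: "fmin = peval (\<Sum>i=1..m. f i) u"
    and p: "(\<Sum>i=1..m. p i) + pconst fmin = 0"
    and cert: "\<forall>i\<in>{1..m}. f i + p i \<in> qmodule (\<Delta> i) (G i)"
  shows "hierarchy_tight m \<Delta> f G fmin \<and>
      (\<exists>K. \<forall>k\<ge>K. (\<Sum>i=1..m. f i) - pconst fmin \<in> sparse_qmodule m \<Delta> G (2 * k))"
proof -
  have "\<forall>i\<in>{1..m}. \<exists>K. \<forall>k\<ge>K. certificate (\<Delta> i) (l i) (G i) k (f i + p i)"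
    using qmodule_certificate G cert by blast
  then obtain K0 where K0: "\<And>i k. i \<in> {1..m} \<Longrightarrow> k \<ge> K0 i \<Longrightarrow> certificate (\<Delta> i) (l i) (G i) k (f i + p i)"
    by metis
  define K where "K = (\<Sum>i=1..m. K0 i) + min_order m f G"
  have cK: "certificate (\<Delta> i) (l i) (G i) k (f i + p i)" if "i \<in> {1..m}" "k \<ge> K" for i k
  proof (rule K0[OF that(1)])
    have "K0 i \<le> (\<Sum>i=1..m. K0 i)" using that(1) by (intro member_le_sum) auto
    then show "K0 i \<le> k" using that(2) by (simp add: K_def)
  qed
  have sum_fp: "(\<Sum>i=1..m. f i) - pconst fmin = (\<Sum>i=1..m. f i + p i)"
    using p by (simp add: sum.distrib) (metis add.commute add_diff_cancel_left' add_eq_0_iff diff_0 group_cancel.sub1 uminus_add_conv_diff)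
  have mem: "(\<Sum>i=1..m. f i) - pconst fmin \<in> sparse_qmodule m \<Delta> G (2 * k)" if "k \<ge> K" for k
    unfolding sum_fp sparse_qmodule_def
    using certificate_qmodule_upto cK[OF _ that] G by blast
  have "sos_value m \<Delta> f G K = ereal fmin"
    unfolding sos_value_def
  proof (rule antisym)
    show "ereal fmin \<le> Sup (ereal ` {\<gamma>. (\<Sum>i=1..m. f i) - pconst \<gamma> \<in> sparse_qmodule m \<Delta> G (2 * K)})"
      using mem[of K] by (intro Sup_upper imageI) simp
    show "Sup (ereal ` {\<gamma>. (\<Sum>i=1..m. f i) - pconst \<gamma> \<in> sparse_qmodule m \<Delta> G (2 * K)}) \<le> ereal fmin"
    proof (rule Sup_least, elim imageE CollectE)
      fix x \<gamma> assume x: "x = ereal \<gamma>" and "(\<Sum>i=1..m. f i) - pconst \<gamma> \<in> sparse_qmodule m \<Delta> G (2 * K)"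
      then obtain q where q: "(\<Sum>i=1..m. f i) - pconst \<gamma> = (\<Sum>i=1..m. q i)"
        "\<forall>i\<in>{1..m}. q i \<in> qmodule_upto (\<Delta> i) (G i) (2 * K)"
        unfolding sparse_qmodule_def by blast
      have "0 \<le> peval (q i) u" if i: "i \<in> {1..m}" for i
      proof -
        have Gi: "G i \<in> sym_poly_mats (\<Delta> i) (l i)" using G i by blast
        have qi: "q i \<in> qmodule (\<Delta> i) (G i)" using q(2) i qmodule_upto_subset by blast
        then have "q i \<in> polys (\<Delta> i)" using quadratic_module_qmodule[OF Gi] unfolding quadratic_module_def by blast
        moreover have "0 \<le> peval (q i) (coord_proj (\<Delta> i) u)"
          using u i by (intro qmodule_nonneg[OF Gi qi]) (simp add: feasible_def)
        ultimately show ?thesis by (simp add: peval_coord_proj)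
      qed
      then have "0 \<le> peval (\<Sum>i=1..m. q i) u" unfolding peval_sum by (rule sum_nonneg)
      then show "x \<le> ereal fmin" unfolding q(1)[symmetric] x fmin by simp
    qed
  qed
  moreover have "moment_value m \<Delta> f G K = ereal fmin"
    unfolding moment_value_def
  proof (rule antisym)
    have mo: "min_order m f G \<le> K" by (simp add: K_def)
    have fu: "f i \<in> polys_upto (\<Delta> i) (2 * K)" if "i \<in> {1..m}" for i
      using f that min_order_le(1)[OF mo that] by (simp add: polys_upto_def)
    let ?y = "restrict (\<lambda>\<alpha>. monom_value \<alpha> u) (sparse_expts m \<Delta> K)"
    note dirac = dirac_moment_feasible[OF G u mo m]
    have "(\<Sum>i=1..m. riesz (sub_moments (\<Delta> i) K ?y) (f i)) = fmin"
      using dirac(2) fu by (simp add: fmin)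
    then show "Inf ((\<lambda>y. ereal (\<Sum>i=1..m. riesz (sub_moments (\<Delta> i) K y) (f i))) ` moment_feasible m \<Delta> G K) \<le> ereal fmin"
      using dirac(1) by (intro Inf_lower image_eqI[of _ _ ?y]) auto
    show "ereal fmin \<le> Inf ((\<lambda>y. ereal (\<Sum>i=1..m. riesz (sub_moments (\<Delta> i) K y) (f i))) ` moment_feasible m \<Delta> G K)"
    proof (rule Inf_greatest, elim imageE)
      fix x y assume x: "x = ereal (\<Sum>i=1..m. riesz (sub_moments (\<Delta> i) K y) (f i))" and y: "y \<in> moment_feasible m \<Delta> G K"
      have nn: "0 \<le> riesz y (f i + p i)" if i: "i \<in> {1..m}" for i
      proof -
        have Gi: "G i \<in> sym_poly_mats (\<Delta> i) (l i)" using G i by blast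
        have dim: "dim_row (G i) = l i" using sym_poly_matsD(1)[OF Gi] by simp
        note c = cK[OF i order.refl]
        have psd: "psd_on ({..<dim_row (G i)} \<times> expts (\<Delta> i) (localizing_order (G i) K))
            (localizing_mat (G i) (sub_moments (\<Delta> i) K y)) \<and>
          psd_on (expts (\<Delta> i) K) (moment_mat (sub_moments (\<Delta> i) K y))"
          using y i unfolding moment_feasible_def by blast
        have "0 \<le> riesz (sub_moments (\<Delta> i) K y) (f i + p i)"
          using psd unfolding dim by (intro certificate_riesz_nonneg[OF Gi c]) blast+
        then show ?thesis using riesz_sub_moments[OF certificate_upto[OF Gi c]] by simp
      qed
      have y0: "y 0 = 1" using y by (simp add: moment_feasible_def)
      have "0 \<le> (\<Sum>i=1..m. riesz y (f i + p i))" using nn by (intro sum_nonneg) auto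
      also have "\<dots> = riesz y ((\<Sum>i=1..m. f i) - pconst fmin)" unfolding sum_fp riesz_sum ..
      also have "\<dots> = (\<Sum>i=1..m. riesz y (f i)) + riesz y (pconst (- fmin))"
        by (simp only: diff_conv_add_uminus riesz_add riesz_sum pconst_uminus)
      also have "riesz y (pconst (- fmin)) = - fmin" by (simp only: pconst_def riesz_single y0)
      finally have "fmin \<le> (\<Sum>i=1..m. riesz y (f i))" by simp
      also have "\<dots> = (\<Sum>i=1..m. riesz (sub_moments (\<Delta> i) K y) (f i))"
        by (intro sum.cong refl) (simp add: riesz_sub_moments[OF fu])
      finally show "ereal fmin \<le> x" unfolding x by simp
    qed
  qed
  moreover have "min_order m f G \<le> K" by (simp add: K_def)
  ultimately show ?thesis unfolding hierarchy_tight_def using mem by blast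
qed

section \<open>Bilinear forms and least squares\<close>

text \<open>Forms and matrix-vector products on functions of an index, of which only the values below \<open>l\<close>
  matter. In this form the entries may depend on a point or a parameter without reference to
  carriers.\<close>

definition bil :: "nat \<Rightarrow> (nat \<Rightarrow> nat \<Rightarrow> real) \<Rightarrow> (nat \<Rightarrow> real) \<Rightarrow> (nat \<Rightarrow> real) \<Rightarrow> real" where
  "bil l A v w = (\<Sum>a<l. \<Sum>b<l. v a * A a b * w b)"

definition app :: "nat \<Rightarrow> (nat \<Rightarrow> nat \<Rightarrow> real) \<Rightarrow> (nat \<Rightarrow> real) \<Rightarrow> nat \<Rightarrow> real" where
  "app l A v a = (\<Sum>b<l. A a b * v b)"

lemma bil_add_left: "bil l A (\<lambda>a. v a + v' a) w = bil l A v w + bil l A v' w"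
  and bil_add_right: "bil l A w (\<lambda>a. v a + v' a) = bil l A w v + bil l A w v'"
  and bil_scale_left: "bil l A (\<lambda>a. c * v a) w = c * bil l A v w"
  and bil_scale_right: "bil l A w (\<lambda>a. c * v a) = c * bil l A w v"
  by (simp_all add: bil_def algebra_simps sum.distrib sum_distrib_left)

lemma bil_app: "bil l A v w = (\<Sum>a<l. v a * app l A w a)"
  by (simp add: bil_def app_def sum_distrib_left mult_ac)

lemma bil_sym:
  assumes "\<And>a b. a < l \<Longrightarrow> b < l \<Longrightarrow> A a b = A b a"
  shows "bil l A v w = bil l A w v"
  unfolding bil_def
  by (subst sum.swap) (auto intro!: sum.cong simp: assms mult_ac)

text \<open>The form at \<open>w + c v\<close> is affine in \<open>c\<close> when it vanishes at \<open>v\<close>, and an affine function that is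
  nonnegative everywhere is constant.\<close>

lemma psd_kernel:
  assumes psd: "\<And>v. 0 \<le> bil l A v v" and sym: "\<And>a b. a < l \<Longrightarrow> b < l \<Longrightarrow> A a b = A b a"
    and z: "bil l A v v = 0" and a: "a < l"
  shows "app l A v a = 0"
proof -
  define w where "w b = (if b = a then 1 else 0 :: real)" for b
  have "bil l A w v = (\<Sum>b<l. if b = a then app l A v a else 0)"
    unfolding bil_app by (intro sum.cong) (auto simp: w_def)
  also have "\<dots> = app l A v a" using a by simp
  finally have wv: "bil l A w v = app l A v a" .
  show ?thesis
  proof (rule linear_nonneg_imp_zero[where b = "bil l A w w"])
    fix c :: real
    have "0 \<le> bil l A (\<lambda>b. w b + c * v b) (\<lambda>b. w b + c * v b)" by (rule psd)
    then show "0 \<le> 2 * c * app l A v a + bil l A w w"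
      by (simp add: bil_add_left bil_add_right bil_scale_left bil_scale_right z wv
          bil_sym[where l = l and A = A and v = v and w = w, OF sym])
  qed
qed

text \<open>The normal equations are solvable, by Gram-Schmidt: the last vector is orthogonalized against the
  others, and the residual is corrected along the result. If that result is the zero vector, the
  coefficient of the correction is irrelevant.\<close>

lemma least_squares:
  fixes c :: "nat \<Rightarrow> nat \<Rightarrow> real"
  shows "\<exists>x. \<forall>k<r. (\<Sum>a<l. c k a * (b a - (\<Sum>j<r. x j * c j a))) = 0"
proof (induction r arbitrary: b)
  case 0
  show ?case by simp
next
  case (Suc r)
  obtain x where x: "\<And>k. k < r \<Longrightarrow> (\<Sum>a<l. c k a * (b a - (\<Sum>j<r. x j * c j a))) = 0"
    using Suc[of b] by blast
  obtain z where z: "\<And>k. k < r \<Longrightarrow> (\<Sum>a<l. c k a * (c r a - (\<Sum>j<r. z j * c j a))) = 0"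
    using Suc[of "c r"] by blast
  define e where "e a = b a - (\<Sum>j<r. x j * c j a)" for a
  define d where "d a = c r a - (\<Sum>j<r. z j * c j a)" for a
  define t where "t = (\<Sum>a<l. e a * d a) / (\<Sum>a<l. d a * d a)"
  define x' where "x' j = (if j = r then t else x j - t * z j)" for j
  have res: "b a - (\<Sum>j<Suc r. x' j * c j a) = e a - t * d a" for a
  proof -
    have "(\<Sum>j<r. x' j * c j a) = (\<Sum>j<r. x j * c j a) - t * (\<Sum>j<r. z j * c j a)"
      unfolding sum_distrib_left sum_subtractf[symmetric]
      by (intro sum.cong) (auto simp: x'_def algebra_simps)
    then show ?thesis by (simp add: x'_def e_def d_def algebra_simps)
  qed
  have split: "(\<Sum>a<l. y a * (e a - t * d a)) = (\<Sum>a<l. y a * e a) - t * (\<Sum>a<l. y a * d a)" for y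
    by (simp add: sum_subtractf sum_distrib_left algebra_simps)
  have lt: "(\<Sum>a<l. c k a * e a) = 0" "(\<Sum>a<l. c k a * d a) = 0" if "k < r" for k
    using x[OF that] z[OF that] by (simp_all add: e_def d_def)
  have de: "(\<Sum>a<l. d a * (e a - t * d a)) = 0"
  proof (cases "(\<Sum>a<l. d a * d a) = 0")
    case True
    then have "\<forall>a\<in>{..<l}. d a * d a = 0"
      by (subst sum_nonneg_eq_0_iff[symmetric]) auto
    then show ?thesis by simp
  next
    case False
    then show ?thesis unfolding split by (simp add: t_def mult.commute)
  qed
  have cr: "c r a = d a + (\<Sum>j<r. z j * c j a)" for a by (simp add: d_def)
  have "(\<Sum>a<l. c k a * (e a - t * d a)) = 0" if "k < Suc r" for k
  proof (cases "k = r")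
    case False
    then show ?thesis using that lt[of k] unfolding split by simp
  next
    case True
    have "(\<Sum>a<l. (\<Sum>j<r. z j * c j a) * (e a - t * d a)) = (\<Sum>j<r. z j * (\<Sum>a<l. c j a * (e a - t * d a)))"
      unfolding sum_distrib_left sum_distrib_right by (subst sum.swap) (simp add: mult_ac)
    also have "\<dots> = 0" unfolding split using lt by simp
    finally show ?thesis using de True by (simp add: cr distrib_right sum.distrib)
  qed
  then show ?case using res by (intro exI[of _ x']) simp
qed

text \<open>For symmetric \<open>A\<close>, being orthogonal to the columns of \<open>A\<close> means being annihilated by \<open>A\<close>. So every
  vector is a sum of an element of the range and an element of the kernel.\<close>

lemma residual_in_kernel:
  assumes sym: "\<And>a b. a < l \<Longrightarrow> b < l \<Longrightarrow> A a b = A b a"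
  obtains x where "\<And>k. k < l \<Longrightarrow> app l A (\<lambda>a. b a - app l A x a) k = 0"
proof -
  obtain x where x: "\<And>k. k < l \<Longrightarrow> (\<Sum>a<l. A k a * (b a - (\<Sum>j<l. x j * A j a))) = 0"
    using least_squares[where c = A and b = b and l = l and r = l] by blast
  have "app l A (\<lambda>a. b a - app l A x a) k = (\<Sum>a<l. A k a * (b a - (\<Sum>j<l. x j * A j a)))" for k
    unfolding app_def by (intro sum.cong refl) (auto simp: mult.commute sym intro!: sum.cong)
  then show ?thesis using x by (intro that[of x]) simp
qed

lemma app_diff: "app l A (\<lambda>a. v a - w a) k = app l A v k - app l A w k"
  by (simp add: app_def right_diff_distrib sum_subtractf)

lemma app_cong: "(\<And>b. b < l \<Longrightarrow> v b = w b) \<Longrightarrow> app l A v = app l A w"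
  by (rule ext) (auto simp: app_def intro!: sum.cong)

lemma sum_square_zero:
  fixes r :: "nat \<Rightarrow> real"
  assumes "(\<Sum>a<l. r a * r a) = 0" "a < l" shows "r a = 0"
proof -
  have "\<forall>a\<in>{..<l}. r a * r a = 0"
    using assms(1) by (subst sum_nonneg_eq_0_iff[symmetric]) auto
  then show ?thesis using assms(2) by simp
qed

lemma column_in_square_range:
  assumes sym: "\<And>a b. a < l \<Longrightarrow> b < l \<Longrightarrow> A a b = A b a"
  shows "\<exists>x. \<forall>k<l. app l A s k = app l A (app l A x) k"
proof -
  obtain x where x: "\<And>k. k < l \<Longrightarrow> app l A (\<lambda>a. s a - app l A x a) k = 0"
    by (rule residual_in_kernel[where l = l and A = A and b = s, OF sym], assumption+, rule that)
  have "app l A s k = app l A (app l A x) k" if "k < l" for k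
    using x[OF that] by (simp add: app_diff)
  then show ?thesis by blast
qed

section \<open>The Moore-Penrose inverse of a symmetric matrix\<close>

text \<open>Range and range of the square agree for a symmetric matrix; this is applied to the unit vectors.\<close>

lemma sym_square_factor:
  assumes A: "A \<in> sym_mats l"
  obtains Y where "Y \<in> carrier_mat l l" "A = A * A * Y"
proof -
  have Ac: "A \<in> carrier_mat l l" and At: "transpose_mat A = A" using A by (auto simp: sym_mats_def)
  have sym: "A $$ (a, b) = A $$ (b, a)" if "a < l" "b < l" for a b
    using that Ac At by (metis carrier_matD index_transpose_mat(1))
  let ?A = "\<lambda>a b. A $$ (a, b)"
  have "\<exists>x. \<forall>k<l. app l ?A (\<lambda>a. if a = j then 1 else 0) k = app l ?A (app l ?A x) k" for j
    by (rule column_in_square_range) (rule sym)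
  note ex = this
  define x where "x j = (SOME x. \<forall>k<l. app l ?A (\<lambda>a. if a = j then 1 else 0) k = app l ?A (app l ?A x) k)" for j
  have x: "app l ?A (\<lambda>a. if a = j then 1 else 0) k = app l ?A (app l ?A (x j)) k" if "k < l" for j k
    using someI_ex[OF ex[of j]] that unfolding x_def by blast
  define Y where "Y = Matrix.mat l l (\<lambda>(i, j). x j i)"
  have Yc: "Y \<in> carrier_mat l l" by (simp add: Y_def)
  have "A = A * (A * Y)"
  proof (rule eq_matI)
    fix i j assume "i < dim_row (A * (A * Y))" "j < dim_col (A * (A * Y))"
    then have ij: "i < l" "j < l" using Ac by (auto simp: Y_def)
    have AY: "(A * Y) $$ (b, j) = app l ?A (x j) b" if "b < l" for b
      using Ac ij that by (simp add: Y_def scalar_prod_def app_def atLeast0LessThan)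
    have "(A * (A * Y)) $$ (i, j) = (\<Sum>b<l. A $$ (i, b) * (A * Y) $$ (b, j))"
      using Ac Yc ij by (simp add: scalar_prod_def atLeast0LessThan)
    also have "\<dots> = app l ?A (app l ?A (x j)) i"
      unfolding app_def[of l ?A "app l ?A (x j)"] by (intro sum.cong refl) (simp add: AY)
    also have "\<dots> = A $$ (i, j)"
      unfolding x[OF ij(1), symmetric] using ij by (simp add: app_def if_distrib cong: if_cong)
    finally show "A $$ (i, j) = (A * (A * Y)) $$ (i, j)" ..
  qed (use Ac Yc in auto)
  then have "A = A * A * Y" using assoc_mult_mat[OF Ac Ac Yc] by simp
  then show ?thesis using that Yc by blast
qed

text \<open>By symmetry of the products, \<open>A X = A Z\<close> and \<open>X A = Z A\<close> for any two such inverses.\<close>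

lemma moore_penrose_unique:
  assumes A: "A \<in> carrier_mat l l" and X: "is_moore_penrose A X" and Z: "is_moore_penrose A Z"
  shows "X = Z"
proof -
  have Xc: "X \<in> carrier_mat l l" and Zc: "Z \<in> carrier_mat l l"
    using X Z A by (auto simp: is_moore_penrose_def)
  have x: "A * X * A = A" "X * A * X = X" "transpose_mat (A * X) = A * X" "transpose_mat (X * A) = X * A"
    and z: "A * Z * A = A" "Z * A * Z = Z" "transpose_mat (A * Z) = A * Z" "transpose_mat (Z * A) = Z * A"
    using X Z by (auto simp: is_moore_penrose_def)
  have c: "A * X \<in> carrier_mat l l" "X * A \<in> carrier_mat l l" "A * Z \<in> carrier_mat l l" "Z * A \<in> carrier_mat l l"
    using A Xc Zc by auto
  have "A * X = (A * Z) * (A * X)"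
  proof -
    have "A * X = (A * Z * A) * X" by (simp only: z(1))
    also have "\<dots> = (A * Z) * (A * X)" by (rule assoc_mult_mat[OF c(3) A Xc])
    finally show ?thesis .
  qed
  then have "transpose_mat (A * X) = transpose_mat ((A * Z) * (A * X))" by simp
  also have "\<dots> = (A * X) * (A * Z)" unfolding transpose_mult[OF c(3,1)] x(3) z(3) ..
  also have "\<dots> = (A * X * A) * Z" by (rule assoc_mult_mat[OF c(1) A Zc, symmetric])
  also have "\<dots> = A * Z" by (simp only: x(1))
  finally have 1: "A * X = A * Z" by (simp only: x(3))
  have "X * A = (X * A) * (Z * A)"
  proof -
    have "X * A = X * (A * Z * A)" by (simp only: z(1))
    also have "\<dots> = X * (A * (Z * A))" by (simp only: assoc_mult_mat[OF A Zc A])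
    also have "\<dots> = (X * A) * (Z * A)" by (rule assoc_mult_mat[OF Xc A c(4), symmetric])
    finally show ?thesis .
  qed
  then have "transpose_mat (X * A) = transpose_mat ((X * A) * (Z * A))" by simp
  also have "\<dots> = (Z * A) * (X * A)" unfolding transpose_mult[OF c(2,4)] x(4) z(4) ..
  also have "\<dots> = Z * (A * (X * A))" by (rule assoc_mult_mat[OF Zc A c(2)])
  also have "\<dots> = Z * (A * X * A)" by (simp only: assoc_mult_mat[OF A Xc A])
  also have "\<dots> = Z * A" by (simp only: x(1))
  finally have 2: "X * A = Z * A" by (simp only: x(4))
  have "X = X * A * X" by (simp only: x(2))
  also have "\<dots> = Z * A * X" by (simp only: 2)
  also have "\<dots> = Z * (A * X)" by (rule assoc_mult_mat[OF Zc A Xc])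
  also have "\<dots> = Z * (A * Z)" by (simp only: 1)
  also have "\<dots> = Z * A * Z" by (rule assoc_mult_mat[OF Zc A Zc, symmetric])
  finally show ?thesis by (simp only: z(2))
qed

text \<open>With \<open>A = A A Y\<close>, the matrix \<open>E = A Y\<close> is the orthogonal projection to the range of \<open>A\<close>, and
  \<open>P = E Y\<close> is the inverse of \<open>A\<close> on this range and zero on its complement.\<close>

lemma is_moore_penrose_exists:
  assumes A: "A \<in> sym_mats l"
  obtains P where "is_moore_penrose A P" "P \<in> sym_mats l"
proof -
  have Ac: "A \<in> carrier_mat l l" and At: "transpose_mat A = A" using A by (auto simp: sym_mats_def)
  obtain Y where Y: "Y \<in> carrier_mat l l" and AAY: "A = A * A * Y" using sym_square_factor[OF A] by blast
  let ?Yt = "transpose_mat Y"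
  have Yt: "?Yt \<in> carrier_mat l l" using Y by simp
  define E where "E = A * Y"
  have E: "E \<in> carrier_mat l l" using Ac Y by (simp add: E_def)
  have AE: "A * E = A" unfolding E_def using AAY assoc_mult_mat[OF Ac Ac Y] by simp
  have YtA: "?Yt * A = transpose_mat E" unfolding E_def by (simp add: transpose_mult[OF Ac Y] At)
  have EtA: "transpose_mat E * A = A"
  proof -
    have "transpose_mat (A * E) = transpose_mat A" by (simp only: AE)
    then show ?thesis using transpose_mult[OF Ac E] At by simp
  qed
  have Et: "transpose_mat E = E"
  proof -
    have "transpose_mat E = ?Yt * (A * E)" by (simp only: AE YtA)
    also have "\<dots> = (?Yt * A) * E" by (rule assoc_mult_mat[OF Yt Ac E, symmetric])
    also have "\<dots> = transpose_mat E * E" by (simp only: YtA)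
    also have "\<dots> = transpose_mat E * (A * Y)" by (simp only: E_def)
    also have "\<dots> = transpose_mat E * A * Y"
      by (rule assoc_mult_mat[symmetric, of _ l l _ l _ l]) (use E Ac Y in auto)
    also have "\<dots> = A * Y" by (simp only: EtA)
    also have "\<dots> = E" by (simp only: E_def)
    finally show ?thesis .
  qed
  have EA: "E * A = A" using EtA Et by simp
  have EE: "E * E = E"
  proof -
    have "E * (A * Y) = E * A * Y" by (rule assoc_mult_mat[OF E Ac Y, symmetric])
    then show ?thesis by (simp add: EA E_def[symmetric])
  qed
  define P where "P = E * Y"
  have P: "P \<in> carrier_mat l l" using E Y by (simp add: P_def)
  have AP: "A * P = E"
  proof -
    have "A * (E * Y) = A * E * Y" by (rule assoc_mult_mat[OF Ac E Y, symmetric])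
    then show ?thesis by (simp add: P_def AE E_def[symmetric])
  qed
  have Pt: "transpose_mat P = P"
  proof -
    have 1: "P = ?Yt * A * Y" by (simp only: P_def YtA Et)
    have "transpose_mat (?Yt * A * Y) = ?Yt * (transpose_mat (?Yt * A))"
      by (rule transpose_mult[OF _ Y]) (use Yt Ac in auto)
    also have "\<dots> = ?Yt * (A * Y)" using transpose_mult[OF Yt Ac] At by simp
    also have "\<dots> = ?Yt * A * Y" by (rule assoc_mult_mat[OF Yt Ac Y, symmetric])
    finally show ?thesis using 1 by simp
  qed
  have PA: "P * A = E"
  proof -
    have "transpose_mat (A * P) = P * A" using transpose_mult[OF Ac P] At Pt by simp
    then show ?thesis by (simp add: AP Et)
  qed
  have "E * P = P"
  proof -
    have "E * (E * Y) = E * E * Y" by (rule assoc_mult_mat[OF E E Y, symmetric])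
    then show ?thesis by (simp add: P_def EE)
  qed
  then have "is_moore_penrose A P"
    unfolding is_moore_penrose_def using P Ac by (simp add: AP PA EA Et)
  moreover have "P \<in> sym_mats l" using P Pt by (simp add: sym_mats_def)
  ultimately show ?thesis by (rule that)
qed

lemma moore_penrose_sym:
  assumes A: "A \<in> sym_mats l"
  shows "moore_penrose A \<in> sym_mats l" "moore_penrose A * A * moore_penrose A = moore_penrose A"
proof -
  obtain P where P: "is_moore_penrose A P" "P \<in> sym_mats l" using is_moore_penrose_exists[OF A] by blast
  have Ac: "A \<in> carrier_mat l l" using A by (simp add: sym_mats_def)
  have "moore_penrose A = P"
    unfolding moore_penrose_def using P(1) moore_penrose_unique[OF Ac _ P(1)] by (rule the_equality)
  then show "moore_penrose A \<in> sym_mats l" "moore_penrose A * A * moore_penrose A = moore_penrose A"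
    using P by (auto simp: is_moore_penrose_def)
qed

section \<open>Kernels, ranges and ranks\<close>

text \<open>A maximal independent set of columns, as a list whose independence is stated with coefficients.\<close>

lemma rank_basis:
  fixes A :: "real mat"
  assumes A: "A \<in> carrier_mat l nc"
  obtains vs where "length vs = mat_rank A" "set vs \<subseteq> set (cols A)"
    "\<forall>c. (\<forall>i<l. (\<Sum>j<length vs. c j * vec_index (vs ! j) i) = 0) \<longrightarrow> (\<forall>j<length vs. c j = 0)"
proof -
  interpret vec_space "TYPE(real)" l .
  have "lin_indpt {}" by (simp add: lin_dep_def)
  then obtain S where S: "maximal S (\<lambda>T. T \<subseteq> set (cols A) \<and> lin_indpt T)" "finite S"
    using maximal_exists_superset[of "set (cols A)" "\<lambda>T. T \<subseteq> set (cols A) \<and> lin_indpt T" "{}"] by auto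
  have Sc: "S \<subseteq> set (cols A)" and Si: "lin_indpt S" using S(1) by (auto simp: maximal_def)
  have SV: "S \<subseteq> carrier_vec l" using Sc cols_dim[of A] A by auto
  have card: "card S = mat_rank A"
    using rank_card_indpt[OF A S(1)] A by (simp add: mat_rank_def)
  obtain vs where vs: "set vs = S" "distinct vs" using finite_distinct_list[OF S(2)] by blast
  have len: "length vs = mat_rank A" using vs card distinct_card by fastforce
  have "c j = 0" if c: "\<And>i. i < l \<Longrightarrow> (\<Sum>j<length vs. c j * vec_index (vs ! j) i) = 0" and j: "j < length vs" for c :: "nat \<Rightarrow> real" and j
  proof (rule ccontr)
    assume cj: "c j \<noteq> 0"
    have bij: "bij_betw ((!) vs) {..<length vs} S"
      using vs by (auto intro: bij_betw_nth)
    define a where "a x = c (the_inv_into {..<length vs} ((!) vs) x)" for x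
    have a: "a (vs ! k) = c k" if "k < length vs" for k
      unfolding a_def using the_inv_into_f_f[OF bij_betw_imp_inj_on[OF bij], of k] that by simp
    have "lincomb a S = 0\<^sub>v l"
    proof (rule eq_vecI)
      fix i assume "i < dim_vec (0\<^sub>v l :: real Matrix.vec)"
      then have i: "i < l" by simp
      have "vec_index (lincomb a S) i = (\<Sum>x\<in>S. a x * vec_index x i)" by (rule lincomb_index[OF i SV])
      also have "\<dots> = (\<Sum>k<length vs. a (vs ! k) * vec_index (vs ! k) i)"
        by (rule sum.reindex_bij_betw[OF bij, symmetric])
      also have "\<dots> = 0" using c[OF i] by (simp add: a)
      finally show "vec_index (lincomb a S) i = vec_index (0\<^sub>v l) i" using i by simp
    qed (use lincomb_dim[OF S(2) SV] in simp)
    then have "lin_dep S"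
      unfolding lin_dep_def using S(2) cj a[OF j] vs(1) j
      by (intro exI[of _ S] exI[of _ a] exI[of _ "vs ! j"]) auto
    then show False using Si by simp
  qed
  then have "\<forall>c. (\<forall>i<l. (\<Sum>j<length vs. c j * vec_index (vs ! j) i) = 0) \<longrightarrow> (\<forall>j<length vs. c j = 0)"
    by blast
  then show ?thesis using that len vs(1) Sc by blast
qed

text \<open>The residual of \<open>e\<close> against the range of \<open>L\<close> is orthogonal to that range, and, lying in the kernel
  of \<open>G\<close>, it is orthogonal to the range of \<open>G\<close> as well. These two ranges are orthogonal to each
  other and their dimensions add up to \<open>l\<close>, so the residual is zero.\<close>

lemma kernel_subset_range:
  fixes G L :: "real mat"
  assumes G: "G \<in> sym_mats l" and L: "L \<in> sym_mats l"
    and GL: "\<And>k s. k < l \<Longrightarrow> app l (\<lambda>a b. G $$ (a, b)) (app l (\<lambda>a b. L $$ (a, b)) s) k = 0"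
    and rank: "mat_rank G + mat_rank L = l"
    and e: "\<And>k. k < l \<Longrightarrow> app l (\<lambda>a b. G $$ (a, b)) e k = 0"
  shows "\<exists>x. \<forall>k<l. e k = app l (\<lambda>a b. L $$ (a, b)) x k"
proof -
  let ?G = "\<lambda>a b. G $$ (a, b)" and ?L = "\<lambda>a b. L $$ (a, b)"
  have Gc: "G \<in> carrier_mat l l" and Lc: "L \<in> carrier_mat l l" using G L by (auto simp: sym_mats_def)
  have Gs: "?G a b = ?G b a" and Ls: "?L a b = ?L b a" if "a < l" "b < l" for a b
    using G L that unfolding sym_mats_def by (metis (mono_tags, lifting) carrier_matD index_transpose_mat(1) mem_Collect_eq)+
  obtain x where x: "\<And>k. k < l \<Longrightarrow> app l ?L (\<lambda>a. e a - app l ?L x a) k = 0"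
    by (rule residual_in_kernel[where l = l and A = ?L and b = e, OF Ls], assumption+, rule that)
  define r where "r a = e a - app l ?L x a" for a
  have Lr: "app l ?L r k = 0" and Gr: "app l ?G r k = 0" if "k < l" for k
    using x[OF that] e[OF that] GL[OF that] unfolding r_def app_diff by auto
  obtain gs where gs: "length gs = mat_rank G" "set gs \<subseteq> set (cols G)"
    "\<forall>c. (\<forall>i<l. (\<Sum>j<length gs. c j * vec_index (gs ! j) i) = 0) \<longrightarrow> (\<forall>j<length gs. c j = 0)"
    by (rule rank_basis[OF Gc]) (rule that)
  obtain ls where ls: "length ls = mat_rank L" "set ls \<subseteq> set (cols L)"
    "\<forall>c. (\<forall>i<l. (\<Sum>j<length ls. c j * vec_index (ls ! j) i) = 0) \<longrightarrow> (\<forall>j<length ls. c j = 0)"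
    by (rule rank_basis[OF Lc]) (rule that)
  have gcol: "\<exists>a<l. \<forall>i<l. vec_index v i = ?G i a" if "v \<in> set gs" for v
  proof -
    from that gs(2) obtain a where "a < l" "v = col G a" using Gc by (auto simp: cols_def)
    then show ?thesis using Gc by (intro exI[of _ a]) auto
  qed
  have lcol: "\<exists>a<l. \<forall>i<l. vec_index v i = ?L i a" if "v \<in> set ls" for v
  proof -
    from that ls(2) obtain a where "a < l" "v = col L a" using Lc by (auto simp: cols_def)
    then show ?thesis using Lc by (intro exI[of _ a]) auto
  qed
  have rg: "(\<Sum>i<l. vec_index v i * r i) = 0" if v: "v \<in> set gs" for v
  proof -
    obtain a where a: "a < l" "\<And>i. i < l \<Longrightarrow> vec_index v i = ?G i a" using gcol[OF v] by blast
    have "(\<Sum>i<l. vec_index v i * r i) = app l ?G r a"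
      unfolding app_def using a Gs by (intro sum.cong refl) auto
    then show ?thesis using Gr[OF a(1)] by simp
  qed
  have rl: "(\<Sum>i<l. vec_index v i * r i) = 0" if v: "v \<in> set ls" for v
  proof -
    obtain a where a: "a < l" "\<And>i. i < l \<Longrightarrow> vec_index v i = ?L i a" using lcol[OF v] by blast
    have "(\<Sum>i<l. vec_index v i * r i) = app l ?L r a"
      unfolding app_def using a Ls by (intro sum.cong refl) auto
    then show ?thesis using Lr[OF a(1)] by simp
  qed
  have gl: "(\<Sum>i<l. vec_index v i * vec_index w i) = 0" if v: "v \<in> set gs" and w: "w \<in> set ls" for v w
  proof -
    obtain a where a: "a < l" "\<And>i. i < l \<Longrightarrow> vec_index v i = ?G i a" using gcol[OF v] by blast
    obtain b where b: "b < l" "\<And>i. i < l \<Longrightarrow> vec_index w i = ?L i b" using lcol[OF w] by blast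
    have "(\<Sum>i<l. vec_index v i * vec_index w i) = (\<Sum>i<l. ?G a i * ?L i b)"
      using a b Gs by (intro sum.cong refl) auto
    also have "\<dots> = app l ?G (app l ?L (\<lambda>j. if j = b then 1 else 0)) a"
      using b(1) by (simp add: app_def if_distrib cong: if_cong)
    finally show ?thesis using GL[OF a(1)] by simp
  qed
  have "r k = 0" if k: "k < l" for k
  proof (rule ccontr)
    assume rk: "r k \<noteq> 0"
    \<comment> \<open>The columns of \<open>M\<close> are bases of the two ranges. A nonzero residual makes \<open>M\<close> singular, and a
      linear relation between its columns splits into one relation for each basis, because the
      partial sums \<open>w1\<close> and \<open>w2\<close> are opposite to and orthogonal to each other.\<close>
    define M where "M = Matrix.mat l l (\<lambda>(i, j). vec_index ((gs @ ls) ! j) i)"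
    have len: "length (gs @ ls) = l" using gs(1) ls(1) rank by simp
    have Mc: "M \<in> carrier_mat l l" by (simp add: M_def)
    have Mtc: "transpose_mat M \<in> carrier_mat l l" using Mc by simp
    have "transpose_mat M *\<^sub>v Matrix.vec l r = 0\<^sub>v l"
    proof (rule eq_vecI)
      fix j assume "j < dim_vec (0\<^sub>v l :: real Matrix.vec)"
      then have j: "j < l" by simp
      then have "(gs @ ls) ! j \<in> set (gs @ ls)" using len nth_mem by metis
      then have "(\<Sum>i<l. vec_index ((gs @ ls) ! j) i * r i) = 0" using rg rl by auto
      then show "vec_index (transpose_mat M *\<^sub>v Matrix.vec l r) j = vec_index (0\<^sub>v l) j"
        using j by (simp add: M_def scalar_prod_def atLeast0LessThan)
    qed (simp add: M_def)
    moreover have "Matrix.vec l r \<noteq> 0\<^sub>v l" using rk k by (metis index_vec index_zero_vec(1))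
    ultimately have "Determinant.det (transpose_mat M) = 0"
      using det_0_iff_vec_prod_zero[OF Mtc] by (metis vec_carrier)
    then have "Determinant.det M = 0" using det_transpose[OF Mc] by simp
    then obtain v where v: "v \<in> carrier_vec l" "v \<noteq> 0\<^sub>v l" "M *\<^sub>v v = 0\<^sub>v l"
      using det_0_iff_vec_prod_zero[OF Mc] by blast
    let ?g = "length gs" and ?h = "length ls"
    define w1 where "w1 i = (\<Sum>j<?g. vec_index v j * vec_index (gs ! j) i)" for i
    define w2 where "w2 i = (\<Sum>j<?h. vec_index v (?g + j) * vec_index (ls ! j) i)" for i
    have w12: "w1 i + w2 i = 0" if i: "i < l" for i
    proof -
      have "0 = vec_index (M *\<^sub>v v) i" using v(3) i by simp
      also have "\<dots> = (\<Sum>j<l. vec_index v j * vec_index ((gs @ ls) ! j) i)"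
        using i v(1) by (simp add: M_def scalar_prod_def atLeast0LessThan mult.commute)
      also have "\<dots> = (\<Sum>j<?g + ?h. vec_index v j * vec_index ((gs @ ls) ! j) i)" using len by simp
      also have "\<dots> = w1 i + w2 i"
        unfolding sum_lessThan_add w1_def w2_def by (simp add: nth_append)
      finally show ?thesis by simp
    qed
    have w1w2: "(\<Sum>i<l. w1 i * w2 i) = 0"
    proof -
      have "(\<Sum>i<l. w1 i * w2 i) = (\<Sum>i<l. \<Sum>j<?g. \<Sum>j'<?h. vec_index v j * vec_index v (?g + j') * (vec_index (gs ! j) i * vec_index (ls ! j') i))"
        unfolding w1_def w2_def sum_product by (simp add: mult_ac)
      also have "\<dots> = (\<Sum>j<?g. \<Sum>i<l. \<Sum>j'<?h. vec_index v j * vec_index v (?g + j') * (vec_index (gs ! j) i * vec_index (ls ! j') i))"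
        by (rule sum.swap)
      also have "\<dots> = (\<Sum>j<?g. \<Sum>j'<?h. \<Sum>i<l. vec_index v j * vec_index v (?g + j') * (vec_index (gs ! j) i * vec_index (ls ! j') i))"
        by (intro sum.cong refl sum.swap)
      also have "\<dots> = (\<Sum>j<?g. \<Sum>j'<?h. vec_index v j * vec_index v (?g + j') * (\<Sum>i<l. vec_index (gs ! j) i * vec_index (ls ! j') i))"
        by (simp only: sum_distrib_left)
      also have "\<dots> = 0" using gl by simp
      finally show ?thesis .
    qed
    have w1z: "w1 i = 0" if i: "i < l" for i
    proof (rule sum_square_zero[OF _ i])
      have "w2 i = - w1 i" if "i < l" for i using w12[OF that] by linarith
      then have "(\<Sum>i<l. w1 i * w1 i) = (\<Sum>i<l. - (w1 i * w2 i))"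
        by (intro sum.cong refl) simp
      then show "(\<Sum>i<l. w1 i * w1 i) = 0" using w1w2 by (simp add: sum_negf)
    qed
    have w2z: "w2 i = 0" if i: "i < l" for i using w12[OF i] w1z[OF i] by simp
    have "vec_index v j = 0" if "j < ?g" for j
      using spec[OF gs(3), of "vec_index v"] w1z that unfolding w1_def by blast
    moreover have "vec_index v (?g + j) = 0" if "j < ?h" for j
      using spec[OF ls(3), of "\<lambda>j. vec_index v (?g + j)"] w2z that unfolding w2_def by blast
    ultimately have "vec_index v j = 0" if "j < l" for j
      using that len by (metis add_less_cancel_left le_add_diff_inverse length_append not_less)
    then have "v = 0\<^sub>v l" using v(1) by (intro eq_vecI) auto
    then show False using v(2) by simp
  qed
  then show ?thesis unfolding r_def by (intro exI[of _ x]) auto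
qed

section \<open>Nonnegative polynomials with a nondegenerate zero\<close>

text \<open>Where \<open>f\<close> is not positive, \<open>g\<close> has a positive lower bound and \<open>f\<close> a finite one.\<close>

lemma compact_penalty:
  fixes f g :: "'a::topological_space \<Rightarrow> real"
  assumes "compact X" "continuous_on X f" "continuous_on X g"
    and "\<And>x. x \<in> X \<Longrightarrow> 0 \<le> g x" "\<And>x. x \<in> X \<Longrightarrow> g x = 0 \<Longrightarrow> f x > 0"
  obtains c where "c \<ge> 0" "\<And>x. x \<in> X \<Longrightarrow> f x + c * g x > 0"
proof -
  define X0 where "X0 = {x \<in> X. f x \<le> 0}"
  have "closedin (top_of_set X) (X \<inter> f -` {..0})"
    by (rule continuous_closedin_preimage[OF assms(2) closed_atMost])
  moreover have "X \<inter> f -` {..0} = X0" by (auto simp: X0_def)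
  ultimately have cX0: "compact X0" using closedin_compact[OF assms(1)] by simp
  have "X0 \<subseteq> X" by (auto simp: X0_def)
  have g0: "continuous_on X0 g" using assms(3) \<open>X0 \<subseteq> X\<close> by (rule continuous_on_subset)
  have gpos: "g x > 0" if "x \<in> X0" for x
    using that assms(4,5)[of x] unfolding X0_def by fastforce
  obtain e where e: "e > 0" "\<And>x. x \<in> X0 \<Longrightarrow> e \<le> g x"
    by (rule compact_pos_lower_bound[OF cX0 g0 gpos]) (assumption, rule that)
  obtain B where B: "B > 0" "\<And>x. x \<in> X \<Longrightarrow> \<bar>f x\<bar> \<le> B"
    by (rule compact_abs_bound[OF assms(1,2)]) (rule that)
  define c where "c = (B + 1) / e"
  have c: "c \<ge> 0" "c * e = B + 1" using B(1) e(1) by (auto simp: c_def)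
  have "f x + c * g x > 0" if x: "x \<in> X" for x
  proof (cases "x \<in> X0")
    case True
    have "B + 1 \<le> c * g x" using e(2)[OF True] c mult_left_mono by metis
    then show ?thesis using B(2)[OF x] by linarith
  next
    case False
    then have "f x > 0" using x by (simp add: X0_def)
    moreover have "0 \<le> c * g x" using c(1) assms(4)[OF x] by simp
    ultimately show ?thesis by linarith
  qed
  then show ?thesis using that c(1) by blast
qed

text \<open>By hypothesis \<open>F\<close> is \<open>\<theta> + y\<^sup>T M0 y\<close> with \<open>y = x - w\<close> and \<open>M0\<close> positive definite at \<open>w\<close>, but not
  necessarily on the rest of the nonnegativity set \<open>K\<close> of \<open>T\<close>. Two changes, neither of which
  leaves the form "element of \<open>T\<close> plus quadratic form in \<open>y\<close>", repair this. Replacing \<open>\<theta>\<close> by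
  \<open>\<theta> h\<^bsup>2N\<^esup>\<close>, where \<open>0 \<le> h \<le> 1\<close> on \<open>K\<close> and \<open>h\<close> equals 1 only at \<open>w\<close>, makes the form represent
  almost \<open>F\<close> away from \<open>w\<close>, so that it is positive in the direction \<open>y\<close>. Adding a multiple of
  \<open>|y|\<^sup>2 I - y y\<^sup>T\<close>, whose form vanishes at \<open>y\<close> and is positive in all other directions, makes it
  positive definite there. The matrix Positivstellensatz applies to the result.\<close>

theorem nondegenerate_zero_in_module:
  fixes M0 :: "'n::finite \<Rightarrow> 'n \<Rightarrow> 'n mpoly"
  assumes T: "quadratic_module \<Delta> T" and ball: "ball_poly \<Delta> R \<in> T"
    and w: "w \<in> coord_space \<Delta>" "\<forall>g\<in>T. 0 \<le> peval g w"
    and F: "F \<in> polys \<Delta>" "peval F w = 0"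
    and Fpos: "\<And>x. x \<in> coord_space \<Delta> \<Longrightarrow> \<forall>g\<in>T. 0 \<le> peval g x \<Longrightarrow> x \<noteq> w \<Longrightarrow> 0 < peval F x"
    and \<theta>: "\<theta> \<in> T"
    and M0: "\<And>s t. M0 s t \<in> polys \<Delta>"
    and rep: "F - \<theta> = (\<Sum>s\<in>\<Delta>. \<Sum>t\<in>\<Delta>. (pvar s - pconst (w $ s)) * (pvar t - pconst (w $ t)) * M0 s t)"
    and pd: "\<And>v. v \<in> coord_space \<Delta> \<Longrightarrow> v \<noteq> 0 \<Longrightarrow> 0 < quad_form \<Delta> M0 w v"
  shows "F \<in> T"
proof -
  let ?S = "coord_sphere \<Delta>"
  define K where "K = {x \<in> coord_space \<Delta>. \<forall>g\<in>T. 0 \<le> peval g x}"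
  have cK: "compact K" unfolding K_def by (rule module_set_compact[OF ball])
  have wK: "w \<in> K" using w by (simp add: K_def)
  have \<theta>p: "\<theta> \<in> polys \<Delta>" using \<theta> T unfolding quadratic_module_def by blast
  define y where "y s = pvar s - pconst (w $ s)" for s
  have yp: "y s \<in> polys \<Delta>" if "s \<in> \<Delta>" for s
    unfolding y_def using that by (intro polys_diff polys_var polys_const)
  have yx: "peval (y s) x = (x - w) $ s" for s x by (simp add: y_def)
  define n where "n = (\<Sum>s\<in>\<Delta>. (y s)\<^sup>2)"
  have np: "n \<in> polys \<Delta>" unfolding n_def by (intro polys_sum polys_power yp)
  have nx: "peval n x = (norm (x - w))\<^sup>2" if "x \<in> coord_space \<Delta>" for x
    using sum_coord_eq_norm[of "x - w" \<Delta>] that w(1) by (auto simp: n_def yx)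
  \<comment> \<open>The part of \<open>K\<close> where \<open>M0\<close> is not positive definite. It is compact and avoids \<open>w\<close>, so that
    \<open>F\<close> and \<open>|y|\<^sup>2\<close> are bounded away from 0 on it.\<close>
  let ?\<phi> = "\<lambda>z. quad_form \<Delta> M0 (fst z) (snd z)"
  define C where "C = fst ` ((K \<times> ?S) \<inter> {z. ?\<phi> z \<le> 0})"
  have "closed {z. ?\<phi> z \<le> 0}" by (intro closed_Collect_le continuous_on_quad_form continuous_intros)
  then have cc: "compact ((K \<times> ?S) \<inter> {z. ?\<phi> z \<le> 0})"
    by (intro compact_Int_closed compact_Times cK compact_coord_sphere)
  have cC: "compact C"
    unfolding C_def by (rule compact_continuous_image[OF continuous_on_fst[OF continuous_on_id] cc])
  have CK: "C \<subseteq> K" by (auto simp: C_def)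
  have sph: "v \<in> coord_space \<Delta>" "v \<noteq> 0" "norm v = 1" if "v \<in> ?S" for v
    using that by (auto simp: coord_sphere_def)
  have wC: "w \<notin> C"
  proof
    assume "w \<in> C"
    then obtain v where "v \<in> ?S" "quad_form \<Delta> M0 w v \<le> 0" by (auto simp: C_def)
    then show False using pd[of v] sph[of v] by auto
  qed
  have nC: "0 < peval n x" and FC: "0 < peval F x" if "x \<in> C" for x
  proof -
    have "x \<in> K" "x \<noteq> w" using that CK wC by auto
    then show "0 < peval n x" "0 < peval F x" using Fpos[of x] by (auto simp: K_def nx)
  qed
  have cont: "continuous_on X (peval p)" for X p by (intro continuous_intros)
  obtain \<delta> where \<delta>: "\<delta> > 0" "\<And>x. x \<in> C \<Longrightarrow> \<delta> \<le> peval F x"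
    by (rule compact_pos_lower_bound[OF cC cont FC]) (assumption, rule that)
  obtain \<delta>' where \<delta>': "\<delta>' > 0" "\<And>x. x \<in> C \<Longrightarrow> \<delta>' \<le> peval n x"
    by (rule compact_pos_lower_bound[OF cC cont nC]) (assumption, rule that)
  obtain B where B: "B > 0" "\<And>x. x \<in> K \<Longrightarrow> \<bar>peval \<theta> x\<bar> \<le> B"
    by (rule compact_abs_bound[OF cK cont]) (rule that)
  obtain \<rho>0 where \<rho>0: "\<rho>0 > 0" "\<And>x. x \<in> K \<Longrightarrow> \<bar>peval n x\<bar> \<le> \<rho>0"
    by (rule compact_abs_bound[OF cK cont]) (rule that)
  \<comment> \<open>An upper bound for \<open>|y|\<^sup>2\<close> on \<open>K\<close>; the summand \<open>\<delta>'\<close> ensures \<open>\<delta>' / \<rho> \<le> 1\<close> even if \<open>C\<close> is empty.\<close>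
  define \<rho> where "\<rho> = \<rho>0 + \<delta>'"
  have \<rho>: "\<rho> > 0" "\<delta>' / \<rho> \<le> 1" "0 < \<delta>' / \<rho>" using \<rho>0(1) \<delta>'(1) by (auto simp: \<rho>_def)
  define h where "h = 1 - pconst (1 / \<rho>) * n"
  have hp: "h \<in> polys \<Delta>" unfolding h_def by (intro polys_diff polys_mult polys_const polys_1 np)
  have hx: "0 \<le> peval h x" "peval h x \<le> 1" if "x \<in> K" for x
  proof -
    have "0 \<le> peval n x" using that nx[of x] by (simp add: K_def)
    moreover have "peval n x \<le> \<rho>" using \<rho>0(2)[OF that] \<delta>'(1) by (simp add: \<rho>_def)
    ultimately show "0 \<le> peval h x" "peval h x \<le> 1" using \<rho>(1) by (auto simp: h_def)
  qed
  obtain N where N: "(1 - \<delta>' / \<rho>) ^ N < \<delta> / B"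
    using real_arch_pow_inv[of "\<delta> / B" "1 - \<delta>' / \<rho>"] \<delta>(1) B(1) \<rho> by auto
  define q where "q = 1 - \<delta>' / \<rho>"
  have q: "0 \<le> q" "q \<le> 1" using \<rho> by (auto simp: q_def)
  \<comment> \<open>On \<open>C\<close> one has \<open>h \<le> q < 1\<close>, so \<open>\<theta> h\<^bsup>2N\<^esup>\<close> is smaller than \<open>\<delta>\<close> and \<open>W\<close> is positive.\<close>
  define W where "W = F - \<theta> * (h ^ N)\<^sup>2"
  have Wp: "W \<in> polys \<Delta>" unfolding W_def by (intro polys_diff polys_mult polys_power F \<theta>p hp)
  have WC: "0 < peval W x" if x: "x \<in> C" for x
  proof -
    have xK: "x \<in> K" using x CK by auto
    have "\<delta>' / \<rho> \<le> peval n x / \<rho>" using \<delta>'(2)[OF x] \<rho>(1) by (simp add: divide_right_mono)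
    then have "peval h x \<le> q" by (simp add: h_def q_def)
    then have 1: "peval h x ^ N \<le> q ^ N" using hx(1)[OF xK] by (intro power_mono)
    have 2: "0 \<le> peval h x ^ N" using hx(1)[OF xK] by simp
    have "(peval h x ^ N)\<^sup>2 \<le> peval h x ^ N"
      unfolding power2_eq_square using 2 hx[OF xK] by (intro mult_left_le) (auto intro: power_le_one)
    then have "(peval h x ^ N)\<^sup>2 \<le> q ^ N" using 1 by linarith
    then have "\<bar>peval \<theta> x\<bar> * (peval h x ^ N)\<^sup>2 \<le> B * q ^ N"
      using B(2)[OF xK] B(1) by (intro mult_mono) auto
    also have "\<dots> < \<delta>" using N B(1) by (simp add: q_def field_simps)
    finally have "\<bar>peval \<theta> x\<bar> * (peval h x ^ N)\<^sup>2 < \<delta>" .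
    moreover have "peval \<theta> x * (peval h x ^ N)\<^sup>2 \<le> \<bar>peval \<theta> x\<bar> * (peval h x ^ N)\<^sup>2"
      by (intro mult_right_mono) auto
    ultimately show ?thesis using \<delta>(2)[OF x] by (simp add: W_def)
  qed
  \<comment> \<open>The geometric sum gives \<open>1 - h\<^bsup>2N\<^esup> = |y|\<^sup>2 \<kappa>\<close>, so the change of \<open>\<theta>\<close> is a quadratic form in \<open>y\<close>
    with the diagonal matrix \<open>\<kappa> \<theta> I\<close>.\<close>
  define \<kappa> where "\<kappa> = pconst (1 / \<rho>) * (\<Sum>i<2 * N. h ^ i)"
  have \<kappa>p: "\<kappa> \<in> polys \<Delta>" unfolding \<kappa>_def by (intro polys_mult polys_const polys_sum polys_power hp)
  have \<kappa>: "n * \<kappa> = 1 - (h ^ N)\<^sup>2"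
  proof -
    have "1 - h ^ (2 * N) = (1 - h) * (\<Sum>i<2 * N. h ^ i)" by (rule one_diff_power_eq)
    also have "\<dots> = n * \<kappa>" by (simp add: h_def \<kappa>_def mult_ac)
    finally show ?thesis by (simp add: power_mult[symmetric] mult.commute)
  qed
  have \<kappa>x: "0 \<le> peval \<kappa> x" if "x \<in> K" for x
    using hx[OF that] \<rho>(1) by (simp add: \<kappa>_def sum_nonneg)
  define M1 where "M1 s t = M0 s t + (if s = t then \<kappa> * \<theta> else 0)" for s t
  have qM1: "quad_form \<Delta> M1 x v = quad_form \<Delta> M0 x v + peval \<kappa> x * peval \<theta> x * (norm v)\<^sup>2"
    if "v \<in> coord_space \<Delta>" for x v
  proof -
    have "quad_form \<Delta> M1 x v = quad_form \<Delta> M0 x v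
        + (\<Sum>s\<in>\<Delta>. \<Sum>t\<in>\<Delta>. if s = t then v $ s * v $ s * (peval \<kappa> x * peval \<theta> x) else 0)"
      unfolding quad_form_def sum.distrib[symmetric]
      by (intro sum.cong refl) (auto simp: M1_def algebra_simps)
    also have "(\<Sum>s\<in>\<Delta>. \<Sum>t\<in>\<Delta>. if s = t then v $ s * v $ s * (peval \<kappa> x * peval \<theta> x) else 0)
        = peval \<kappa> x * peval \<theta> x * (\<Sum>s\<in>\<Delta>. (v $ s)\<^sup>2)"
      by (simp add: sum_distrib_left power2_eq_square mult_ac)
    finally show ?thesis using sum_coord_eq_norm[OF that] by simp
  qed
  have rep1: "(\<Sum>s\<in>\<Delta>. \<Sum>t\<in>\<Delta>. y s * y t * M1 s t) = W"
  proof -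
    have "(\<Sum>s\<in>\<Delta>. \<Sum>t\<in>\<Delta>. y s * y t * M1 s t) = (\<Sum>s\<in>\<Delta>. \<Sum>t\<in>\<Delta>. y s * y t * M0 s t)
        + (\<Sum>s\<in>\<Delta>. \<Sum>t\<in>\<Delta>. if s = t then y s * y s * (\<kappa> * \<theta>) else 0)"
      unfolding sum.distrib[symmetric] by (intro sum.cong refl) (auto simp: M1_def algebra_simps)
    also have "(\<Sum>s\<in>\<Delta>. \<Sum>t\<in>\<Delta>. if s = t then y s * y s * (\<kappa> * \<theta>) else 0) = n * \<kappa> * \<theta>"
      by (simp add: n_def sum_distrib_left sum_distrib_right power2_eq_square mult_ac)
    also have "(\<Sum>s\<in>\<Delta>. \<Sum>t\<in>\<Delta>. y s * y t * M0 s t) = F - \<theta>" using rep by (simp add: y_def)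
    finally show ?thesis unfolding \<kappa> by (simp add: W_def algebra_simps)
  qed
  \<comment> \<open>The form of \<open>|y|\<^sup>2 I - y y\<^sup>T\<close>, with zeros, for \<open>y \<noteq> 0\<close>, exactly at the multiples of \<open>y\<close>.\<close>
  define \<psi> where "\<psi> z = (norm (fst z - w))\<^sup>2 * (norm (snd z))\<^sup>2 - ((fst z - w) \<bullet> snd z)\<^sup>2" for z :: "(real ^ 'n) \<times> (real ^ 'n)"
  have \<psi>0: "0 \<le> \<psi> z" for z
    using Cauchy_Schwarz_ineq[of "fst z - w" "snd z"] by (simp add: \<psi>_def power2_norm_eq_inner)
  have qW: "quad_form \<Delta> M1 x (x - w) = peval W x" for x
    unfolding rep1[symmetric] quad_form_def by (simp add: yx)
  have par_pos: "0 < quad_form \<Delta> M1 (fst z) (snd z)" if z: "z \<in> C \<times> ?S" and eq: "\<psi> z = 0" for z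
  proof -
    obtain x v where zx: "z = (x, v)" by (cases z)
    have x: "x \<in> C" and v: "v \<in> ?S" using z zx by auto
    let ?b = "(x - w) \<bullet> v"
    have "(norm (x - w - ?b *\<^sub>R v))\<^sup>2 = (norm (x - w))\<^sup>2 - ?b\<^sup>2 * (2 - (norm v)\<^sup>2)"
      unfolding power2_norm_eq_inner by (simp add: inner_diff_left inner_diff_right inner_commute algebra_simps power2_eq_square)
    also have "\<dots> = 0" using eq sph(3)[OF v] by (simp add: \<psi>_def zx)
    finally have par: "x - w = ?b *\<^sub>R v" by simp
    have "0 < ?b\<^sup>2 * quad_form \<Delta> M1 x v"
      using WC[OF x] par quad_form_scaleR[of \<Delta> M1 x ?b v] qW[of x] by simp
    then show ?thesis by (simp add: zx zero_less_mult_iff)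
  qed
  have \<psi>c: "continuous_on (C \<times> ?S) \<psi>" unfolding \<psi>_def by (intro continuous_intros)
  obtain c where c: "c \<ge> 0"
    and cpos: "\<And>z. z \<in> C \<times> ?S \<Longrightarrow> 0 < quad_form \<Delta> M1 (fst z) (snd z) + c * \<psi> z"
    by (rule compact_penalty[OF compact_Times[OF cC compact_coord_sphere] continuous_on_quad_form \<psi>c \<psi>0 par_pos])
       (assumption, assumption, rule that)
  \<comment> \<open>The added matrix annihilates \<open>y\<close>, so \<open>M2\<close> represents \<open>W\<close> as well.\<close>
  define M2 where "M2 s t = M1 s t + pconst c * ((if s = t then n else 0) - y s * y t)" for s t
  have qM2: "quad_form \<Delta> M2 x v = quad_form \<Delta> M1 x v + c * \<psi> (x, v)"
    if x: "x \<in> coord_space \<Delta>" and v: "v \<in> coord_space \<Delta>" for x v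
  proof -
    have "quad_form \<Delta> M2 x v = quad_form \<Delta> M1 x v
      + (\<Sum>s\<in>\<Delta>. \<Sum>t\<in>\<Delta>. (if s = t then c * peval n x * (v $ s * v $ s) else 0) - c * (((x - w) $ s * v $ s) * ((x - w) $ t * v $ t)))"
      unfolding quad_form_def sum.distrib[symmetric]
      by (intro sum.cong refl) (auto simp: M2_def yx algebra_simps)
    also have "(\<Sum>s\<in>\<Delta>. \<Sum>t\<in>\<Delta>. (if s = t then c * peval n x * (v $ s * v $ s) else 0) - c * (((x - w) $ s * v $ s) * ((x - w) $ t * v $ t)))
      = c * peval n x * (\<Sum>s\<in>\<Delta>. (v $ s)\<^sup>2) - c * ((\<Sum>s\<in>\<Delta>. (x - w) $ s * v $ s) * (\<Sum>t\<in>\<Delta>. (x - w) $ t * v $ t))"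
      unfolding sum_product by (simp only: sum_subtractf sum_distrib_left) (simp add: power2_eq_square)
    also have "\<dots> = c * \<psi> (x, v)"
      unfolding sum_coord_eq_inner[OF v] sum_coord_eq_norm[OF v] nx[OF x]
      by (simp add: \<psi>_def power2_eq_square algebra_simps)
    finally show ?thesis .
  qed
  have sphere_pos: "0 < quad_form \<Delta> M2 x v" if x: "x \<in> K" and v: "v \<in> ?S" for x v
  proof (cases "x \<in> C")
    case True
    then show ?thesis using cpos[of "(x, v)"] qM2[of x v] x v sph(1) by (simp add: K_def)
  next
    case False
    then have "0 < quad_form \<Delta> M0 x v" using x v by (force simp: C_def)
    moreover have "0 \<le> peval \<kappa> x * peval \<theta> x * (norm v)\<^sup>2"
      using \<kappa>x[OF x] x \<theta> by (simp add: K_def)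
    moreover have "0 \<le> c * \<psi> (x, v)" using c \<psi>0 by simp
    ultimately show ?thesis using qM2[of x v] qM1[of v x] x sph(1)[OF v] by (simp add: K_def)
  qed
  have pos2: "0 < quad_form \<Delta> M2 x v"
    if x: "x \<in> coord_space \<Delta>" "\<forall>g\<in>T. 0 \<le> peval g x" and v: "v \<in> coord_space \<Delta>" "v \<noteq> 0" for x v
  proof -
    have "(1 / norm v) *\<^sub>R v \<in> ?S" using v by (auto simp: coord_sphere_def)
    moreover have "x \<in> K" using x by (simp add: K_def)
    ultimately have "0 < (1 / norm v)\<^sup>2 * quad_form \<Delta> M2 x v"
      using sphere_pos quad_form_scaleR[of \<Delta> M2 x "1 / norm v" v] by metis
    then show ?thesis by (simp add: zero_less_mult_iff)
  qed
  have M2p: "M2 s t \<in> polys \<Delta>" if "s \<in> \<Delta>" "t \<in> \<Delta>" for s t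
    unfolding M2_def M1_def using M0 \<kappa>p \<theta>p np yp that
    by (auto intro!: polys_add polys_mult polys_diff)
  have "(\<Sum>s\<in>\<Delta>. \<Sum>t\<in>\<Delta>. y s * y t * M2 s t) \<in> T"
    by (rule archimedean_matrix_positivstellensatz[OF T ball M2p yp pos2])
  also have "(\<Sum>s\<in>\<Delta>. \<Sum>t\<in>\<Delta>. y s * y t * M2 s t) = (\<Sum>s\<in>\<Delta>. \<Sum>t\<in>\<Delta>. y s * y t * M1 s t
      + ((if s = t then pconst c * n * (y s * y s) else 0) - pconst c * ((y s * y s) * (y t * y t))))"
    by (intro sum.cong refl) (auto simp: M2_def algebra_simps)
  also have "\<dots> = W + (pconst c * n * n - pconst c * (n * n))"
    unfolding sum.distrib rep1 sum_subtractf n_def power2_eq_square sum_product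
    by (simp only: sum_distrib_left[symmetric]) (simp add: sum_distrib_left sum_distrib_right sum_product mult_ac)
  finally have "W \<in> T" by (simp add: mult.assoc)
  moreover have "\<theta> * (h ^ N)\<^sup>2 \<in> T"
    using \<theta> T polys_power[OF hp] unfolding quadratic_module_def by blast
  ultimately have "W + \<theta> * (h ^ N)\<^sup>2 \<in> T" using T unfolding quadratic_module_def by blast
  then show ?thesis by (simp add: W_def)
qed

section \<open>Derivatives of polynomials\<close>

lemma isCont_upper_bound:
  fixes f :: "real \<Rightarrow> real"
  assumes "isCont f 0" "\<And>t. 0 < t \<Longrightarrow> t < 1 \<Longrightarrow> f t \<le> c"
  shows "f 0 \<le> c"
proof (rule tendsto_upperbound)
  show "(f \<longlongrightarrow> f 0) (at_right 0)"
    using assms(1) by (simp add: isCont_def filterlim_at_split)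
  show "eventually (\<lambda>t. f t \<le> c) (at_right 0)"
    unfolding eventually_at_right_field using assms(2) by (intro exI[of _ 1]) auto
qed simp

lemma isCont_zero_extension:
  fixes f :: "real \<Rightarrow> real"
  assumes "isCont f 0" "\<And>t. t \<noteq> 0 \<Longrightarrow> f t = 0"
  shows "f 0 = 0"
proof (rule antisym)
  show "f 0 \<le> 0" by (rule isCont_upper_bound[OF assms(1)]) (simp add: assms(2))
  have "- f 0 \<le> 0" by (rule isCont_upper_bound[where f = "\<lambda>t. - f t"]) (auto simp: assms intro: isCont_minus)
  then show "0 \<le> f 0" by simp
qed

lemma deriv_factor:
  fixes C :: "real \<Rightarrow> real"
  assumes "isCont C 0"
  shows "((\<lambda>t. c + t * C t) has_real_derivative C 0) (at 0)"
  unfolding CARAT_DERIV by (intro exI[of _ C]) (use assms in auto)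

text \<open>A second order Taylor expansion at \<open>w\<close> with polynomial remainder matrix \<open>b\<close>. The matrix is
  neither unique nor symmetric.\<close>

definition hadamard_rep :: "('n::finite) set \<Rightarrow> real ^ 'n \<Rightarrow> 'n mpoly \<Rightarrow> ('n \<Rightarrow> real) \<Rightarrow> ('n \<Rightarrow> 'n \<Rightarrow> 'n mpoly) \<Rightarrow> bool" where
  "hadamard_rep \<Delta> w p a b \<longleftrightarrow> (\<forall>s t. b s t \<in> polys \<Delta>) \<and>
    p = pconst (peval p w) + (\<Sum>s\<in>\<Delta>. pconst (a s) * (pvar s - pconst (w $ s)))
      + (\<Sum>s\<in>\<Delta>. \<Sum>t\<in>\<Delta>. (pvar s - pconst (w $ s)) * (pvar t - pconst (w $ t)) * b s t)"

lemma hadamard_repE: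
  assumes "p \<in> polys \<Delta>"
  obtains a b where "hadamard_rep \<Delta> w p a b"
  by (rule hadamard2[OF assms, of w]) (use that in \<open>unfold hadamard_rep_def, blast\<close>)

lemma hadamard_rep_shift:
  assumes "hadamard_rep \<Delta> w p a b"
  shows "peval p (w + v) = peval p w + (\<Sum>s\<in>\<Delta>. a s * v $ s) + quad_form \<Delta> b (w + v) v"
proof -
  have "p = pconst (peval p w) + (\<Sum>s\<in>\<Delta>. pconst (a s) * (pvar s - pconst (w $ s)))
      + (\<Sum>s\<in>\<Delta>. \<Sum>t\<in>\<Delta>. (pvar s - pconst (w $ s)) * (pvar t - pconst (w $ t)) * b s t)"
    using assms unfolding hadamard_rep_def by blast
  from arg_cong[OF this, of "\<lambda>p. peval p (w + v)"] show ?thesis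
    by (simp add: quad_form_def)
qed

lemma hadamard_rep_line:
  assumes "hadamard_rep \<Delta> w p a b"
  shows "peval p (w + t *\<^sub>R v) = peval p w + t * (\<Sum>s\<in>\<Delta>. a s * v $ s) + t\<^sup>2 * quad_form \<Delta> b (w + t *\<^sub>R v) v"
  unfolding hadamard_rep_shift[OF assms] quad_form_scaleR by (simp add: sum_distrib_left mult_ac)

lemma isCont_quad_form [continuous_intros]:
  assumes "isCont g a" shows "isCont (\<lambda>t. quad_form \<Delta> b (g t) v) a"
  unfolding quad_form_def by (intro continuous_intros assms)

lemma isCont_line [continuous_intros]: "isCont (\<lambda>t. w + t *\<^sub>R (v :: real ^ 'n)) a"
  by (intro continuous_intros)

lemma hadamard_rep_partial:
  assumes "hadamard_rep \<Delta> w p a b"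
  shows "partial j (peval p) w = (if j \<in> \<Delta> then a j else 0)"
proof -
  let ?v = "axis j (1::real) :: real ^ 'a"
  let ?C = "\<lambda>t. (\<Sum>s\<in>\<Delta>. a s * ?v $ s) + t * quad_form \<Delta> b (w + t *\<^sub>R ?v) ?v"
  have "isCont ?C 0" by (intro continuous_intros)
  then have "((\<lambda>t. peval p w + t * ?C t) has_real_derivative ?C 0) (at 0)" by (rule deriv_factor)
  moreover have "(\<lambda>t. peval p w + t * ?C t) = (\<lambda>t. peval p (w + t *\<^sub>R ?v))"
    unfolding hadamard_rep_line[OF assms] by (simp add: algebra_simps power2_eq_square)
  ultimately have "partial j (peval p) w = ?C 0"
    unfolding partial_def by (simp add: DERIV_imp_deriv)
  also have "\<dots> = (\<Sum>s\<in>\<Delta>. if s = j then a j else 0)"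
    by (simp add: axis_def if_distrib cong: if_cong)
  finally show ?thesis by simp
qed

text \<open>As partial derivatives are defined by a choice operator, their existence has to be shown before
  their values can be used. That they are polynomials also makes them continuous.\<close>

lemma peval_partial_poly:
  "\<exists>q. \<forall>x. ((\<lambda>t. peval p (x + t *\<^sub>R axis j 1)) has_real_derivative peval q x) (at 0)"
proof -
  have "p \<in> polys UNIV" by (simp add: polys_def)
  then show ?thesis
  proof (induction rule: polys_induct)
    case (const c)
    show ?case by (rule exI[of _ 0]) simp
  next
    case (var i)
    have "((\<lambda>t. x $ i + t * axis j 1 $ i) has_real_derivative axis j (1::real) $ i) (at 0)" for x :: "real ^ 'a"
      by (auto intro!: derivative_eq_intros)
    then show ?case
      by (intro exI[of _ "pconst (axis j 1 $ i)"]) simp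
  next
    case (add p q)
    then obtain p' q' where "\<forall>x. ((\<lambda>t. peval p (x + t *\<^sub>R axis j 1)) has_real_derivative peval p' x) (at 0)"
      "\<forall>x. ((\<lambda>t. peval q (x + t *\<^sub>R axis j 1)) has_real_derivative peval q' x) (at 0)" by blast
    then show ?case by (intro exI[of _ "p' + q'"]) (auto intro!: derivative_eq_intros)
  next
    case (mult p q)
    then obtain p' q' where pq: "\<And>x. ((\<lambda>t. peval p (x + t *\<^sub>R axis j 1)) has_real_derivative peval p' x) (at 0)"
      "\<And>x. ((\<lambda>t. peval q (x + t *\<^sub>R axis j 1)) has_real_derivative peval q' x) (at 0)" by blast
    have "((\<lambda>t. peval (p * q) (x + t *\<^sub>R axis j 1)) has_real_derivative peval (p' * q + q' * p) x) (at 0)" for x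
      using DERIV_mult[OF pq(1)[of x] pq(2)[of x]] by simp
    then show ?case by blast
  qed
qed

lemma peval_has_partial:
  "((\<lambda>t. peval p (x + t *\<^sub>R axis j 1)) has_real_derivative partial j (peval p) x) (at 0)"
proof -
  obtain q where "((\<lambda>t. peval p (x + t *\<^sub>R axis j 1)) has_real_derivative peval q x) (at 0)"
    using peval_partial_poly by blast
  then show ?thesis unfolding partial_def by (simp add: DERIV_imp_deriv)
qed

lemma isCont_partial [continuous_intros]:
  assumes "isCont g a" shows "isCont (\<lambda>t. partial j (peval p) (g t)) a"
proof -
  obtain q where q: "\<And>x. ((\<lambda>t. peval p (x + t *\<^sub>R axis j 1)) has_real_derivative peval q x) (at 0)"
    using peval_partial_poly by blast
  have "partial j (peval p) = peval q"
    unfolding partial_def by (rule ext) (rule DERIV_imp_deriv[OF q])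
  then show ?thesis using isCont_peval[OF assms, of q] by simp
qed

lemma sum_two_axes:
  fixes f :: "'n::finite \<Rightarrow> real"
  assumes "s \<in> \<Delta>" "t \<in> \<Delta>"
  shows "(\<Sum>q\<in>\<Delta>. (\<tau> *\<^sub>R axis s 1 + \<sigma> *\<^sub>R axis t 1 :: real ^ 'n) $ q * f q) = \<tau> * f s + \<sigma> * f t"
proof -
  have "(\<Sum>q\<in>\<Delta>. (\<tau> *\<^sub>R axis s 1 + \<sigma> *\<^sub>R axis t 1 :: real ^ 'n) $ q * f q)
      = (\<Sum>q\<in>\<Delta>. (if q = s then \<tau> * f s else 0) + (if q = t then \<sigma> * f t else 0))"
    by (intro sum.cong refl) (auto simp: axis_def algebra_simps)
  then show ?thesis using assms by (simp add: sum.distrib)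
qed

text \<open>The mixed derivative needs only the restriction of the polynomial to the plane spanned by two axes.
  There the expansion is explicit, and the partial derivative in one direction is again of the form
  \<open>c + t C(t)\<close> along the other, with \<open>C\<close> continuous.\<close>

lemma hadamard_rep_hessian:
  assumes rep: "hadamard_rep \<Delta> w p a b" and st: "s \<in> \<Delta>" "t \<in> \<Delta>"
  shows "hessian (peval p) w $ s $ t = peval (b s t) w + peval (b t s) w"
proof -
  define x where "x \<tau> = w + \<tau> *\<^sub>R axis s (1::real)" for \<tau>
  define C where "C \<tau> = peval (b s t) (x \<tau>) + peval (b t s) (x \<tau>) + \<tau> * partial t (peval (b s s)) (x \<tau>)" for \<tau>
  have line: "peval p (x \<tau> + \<sigma> *\<^sub>R axis t 1) = peval p w + (\<tau> * a s + \<sigma> * a t)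
      + \<tau> * (\<tau> * peval (b s s) (x \<tau> + \<sigma> *\<^sub>R axis t 1) + \<sigma> * peval (b s t) (x \<tau> + \<sigma> *\<^sub>R axis t 1))
      + \<sigma> * (\<tau> * peval (b t s) (x \<tau> + \<sigma> *\<^sub>R axis t 1) + \<sigma> * peval (b t t) (x \<tau> + \<sigma> *\<^sub>R axis t 1))" for \<tau> \<sigma>
  proof -
    let ?v = "\<tau> *\<^sub>R axis s 1 + \<sigma> *\<^sub>R axis t 1 :: real ^ 'a"
    have x: "x \<tau> + \<sigma> *\<^sub>R axis t 1 = w + ?v" by (simp add: x_def add.assoc)
    have "(\<Sum>r\<in>\<Delta>. a r * ?v $ r) = \<tau> * a s + \<sigma> * a t"
      using sum_two_axes[OF st, of \<tau> \<sigma> a] by (simp add: mult.commute)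
    moreover have "quad_form \<Delta> b (w + ?v) ?v
        = (\<Sum>q\<in>\<Delta>. ?v $ q * (\<Sum>r\<in>\<Delta>. ?v $ r * peval (b q r) (w + ?v)))"
      unfolding quad_form_def by (simp only: sum_distrib_left mult.assoc)
    ultimately show ?thesis
      unfolding x hadamard_rep_shift[OF rep] sum_two_axes[OF st] by (simp only: add.assoc)
  qed
  have "((\<lambda>\<sigma>. peval p (x \<tau> + \<sigma> *\<^sub>R axis t 1)) has_real_derivative a t + \<tau> * C \<tau>) (at 0)" for \<tau>
    unfolding line C_def
    by (rule derivative_eq_intros peval_has_partial refl)+ (simp add: algebra_simps)
  then have pt: "partial t (peval p) (w + \<tau> *\<^sub>R axis s 1) = a t + \<tau> * C \<tau>" for \<tau>
    unfolding partial_def x_def[symmetric] by (rule DERIV_imp_deriv)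
  have "isCont C 0" unfolding C_def x_def by (intro continuous_intros)
  then have "((\<lambda>\<tau>. partial t (peval p) (w + \<tau> *\<^sub>R axis s 1)) has_real_derivative C 0) (at 0)"
    unfolding pt by (rule deriv_factor)
  then have "partial s (partial t (peval p)) w = C 0"
    unfolding partial_def[of s] by (rule DERIV_imp_deriv)
  then show ?thesis by (simp add: hessian_def C_def x_def)
qed

lemma hadamard_rep_hessian_form:
  assumes rep: "hadamard_rep \<Delta> w p a b"
  shows "(\<Sum>s\<in>\<Delta>. \<Sum>t\<in>\<Delta>. v $ s * hessian (peval p) w $ s $ t * v $ t) = 2 * quad_form \<Delta> b w v"
proof -
  have "(\<Sum>s\<in>\<Delta>. \<Sum>t\<in>\<Delta>. v $ s * hessian (peval p) w $ s $ t * v $ t)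
      = (\<Sum>s\<in>\<Delta>. \<Sum>t\<in>\<Delta>. v $ s * v $ t * peval (b s t) w) + (\<Sum>s\<in>\<Delta>. \<Sum>t\<in>\<Delta>. v $ t * v $ s * peval (b t s) w)"
    unfolding sum.distrib[symmetric]
    by (intro sum.cong refl) (simp add: hadamard_rep_hessian[OF rep] algebra_simps)
  also have "(\<Sum>s\<in>\<Delta>. \<Sum>t\<in>\<Delta>. v $ t * v $ s * peval (b t s) w) = (\<Sum>s\<in>\<Delta>. \<Sum>t\<in>\<Delta>. v $ s * v $ t * peval (b s t) w)"
    by (rule sum.swap)
  finally show ?thesis by (simp add: quad_form_def)
qed

text \<open>The partial derivatives of a polynomial at \<open>w\<close> are the linear coefficients of any such
  representation, so only the quadratic part needs a choice.\<close>

definition rem2 :: "('n::finite) set \<Rightarrow> real ^ 'n \<Rightarrow> 'n mpoly \<Rightarrow> 'n \<Rightarrow> 'n \<Rightarrow> 'n mpoly" where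
  "rem2 \<Delta> w p = (SOME b. \<exists>a. hadamard_rep \<Delta> w p a b)"

lemma rem2_rep:
  assumes "p \<in> polys \<Delta>" obtains a where "hadamard_rep \<Delta> w p a (rem2 \<Delta> w p)"
proof -
  have "\<exists>b a. hadamard_rep \<Delta> w p a b" by (rule hadamard_repE[OF assms, of w]) blast
  from someI_ex[OF this, folded rem2_def] show ?thesis by (elim exE) (rule that)
qed

lemma rem2_line:
  assumes "p \<in> polys \<Delta>"
  shows "peval p (w + t *\<^sub>R v) = peval p w + t * (\<Sum>s\<in>\<Delta>. partial s (peval p) w * v $ s)
    + t\<^sup>2 * quad_form \<Delta> (rem2 \<Delta> w p) (w + t *\<^sub>R v) v"
proof -
  obtain a where rep: "hadamard_rep \<Delta> w p a (rem2 \<Delta> w p)" by (rule rem2_rep[OF assms])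
  have "(\<Sum>s\<in>\<Delta>. a s * v $ s) = (\<Sum>s\<in>\<Delta>. partial s (peval p) w * v $ s)"
    by (intro sum.cong refl) (simp add: hadamard_rep_partial[OF rep])
  then show ?thesis using hadamard_rep_line[OF rep, of t v] by simp
qed

lemma partial_outside:
  assumes "p \<in> polys \<Delta>" "j \<notin> \<Delta>" shows "partial j (peval p) w = 0"
  by (rule rem2_rep[OF assms(1), of w]) (simp add: hadamard_rep_partial assms(2))

lemma rem2_critical:
  assumes "p \<in> polys \<Delta>" "peval p w = 0" "\<And>s. s \<in> \<Delta> \<Longrightarrow> partial s (peval p) w = 0"
  shows "p = (\<Sum>s\<in>\<Delta>. \<Sum>t\<in>\<Delta>. (pvar s - pconst (w $ s)) * (pvar t - pconst (w $ t)) * rem2 \<Delta> w p s t)"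
    and "rem2 \<Delta> w p s t \<in> polys \<Delta>"
proof -
  obtain a where rep: "hadamard_rep \<Delta> w p a (rem2 \<Delta> w p)" by (rule rem2_rep[OF assms(1)])
  have a: "a s = 0" if "s \<in> \<Delta>" for s
    using hadamard_rep_partial[OF rep, of s] assms(3)[OF that] that by simp
  have eq: "p = pconst (peval p w) + (\<Sum>s\<in>\<Delta>. pconst (a s) * (pvar s - pconst (w $ s)))
      + (\<Sum>s\<in>\<Delta>. \<Sum>t\<in>\<Delta>. (pvar s - pconst (w $ s)) * (pvar t - pconst (w $ t)) * rem2 \<Delta> w p s t)"
    using rep unfolding hadamard_rep_def by blast
  show "p = (\<Sum>s\<in>\<Delta>. \<Sum>t\<in>\<Delta>. (pvar s - pconst (w $ s)) * (pvar t - pconst (w $ t)) * rem2 \<Delta> w p s t)"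
    by (rule trans[OF eq]) (simp add: a assms(2))
  show "rem2 \<Delta> w p s t \<in> polys \<Delta>" using rep unfolding hadamard_rep_def by blast
qed

lemma rem2_hessian:
  assumes "p \<in> polys \<Delta>"
  shows "(\<Sum>s\<in>\<Delta>. \<Sum>t\<in>\<Delta>. v $ s * hessian (peval p) w $ s $ t * v $ t) = 2 * quad_form \<Delta> (rem2 \<Delta> w p) w v"
  by (rule rem2_rep[OF assms, of w]) (rule hadamard_rep_hessian_form)

lemma partial_cong_polys:
  assumes "p \<in> polys \<Delta>" "\<And>j. j \<in> \<Delta> \<Longrightarrow> x $ j = x' $ j"
  shows "partial t (peval p) x = partial t (peval p) x'"
proof -
  have "peval p (x + h *\<^sub>R axis t 1) = peval p (x' + h *\<^sub>R axis t 1)" for h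
    by (rule peval_cong[OF assms(1)]) (simp add: assms(2))
  then show ?thesis by (simp add: partial_def)
qed

lemma hessian_coord_proj:
  assumes "p \<in> polys \<Delta>" shows "hessian (peval p) (coord_proj \<Delta> x) = hessian (peval p) x"
proof -
  have "partial t (peval p) (coord_proj \<Delta> x + h *\<^sub>R axis s 1) = partial t (peval p) (x + h *\<^sub>R axis s 1)" for h s t
    by (rule partial_cong_polys[OF assms]) (simp add: coord_proj_def)
  then show ?thesis by (simp add: hessian_def partial_def[of _ "partial _ _"])
qed

text \<open>Along a line the convex function stays below the chord, \<open>p(w+tv) \<le> (1-t) p(w) + t p(w+v)\<close>;
  dividing by \<open>t\<close> and letting \<open>t\<close> tend to 0 gives the tangent inequality. Applied to \<open>tv\<close> and
  divided by \<open>t\<^sup>2\<close>, the same inequality says that the second order part is nonnegative.\<close>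

lemma convex_tangent:
  assumes p: "p \<in> polys \<Delta>" and conv: "convex_on (coord_space \<Delta>) (peval p)"
    and w: "w \<in> coord_space \<Delta>" and v: "v \<in> coord_space \<Delta>"
  shows "peval p w + (\<Sum>s\<in>\<Delta>. partial s (peval p) w * v $ s) \<le> peval p (w + v)"
    and "0 \<le> quad_form \<Delta> (rem2 \<Delta> w p) w v"
proof -
  let ?q = "\<lambda>t v. quad_form \<Delta> (rem2 \<Delta> w p) (w + t *\<^sub>R v) v"
  have tangent: "peval p w + (\<Sum>s\<in>\<Delta>. partial s (peval p) w * v $ s) \<le> peval p (w + v)"
    if v: "v \<in> coord_space \<Delta>" for v
  proof -
    let ?A = "\<Sum>s\<in>\<Delta>. partial s (peval p) w * v $ s"
    have bound: "?A + t * ?q t v \<le> peval p (w + v) - peval p w" if t: "0 < t" "t < 1" for t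
    proof -
      have wv: "w + v \<in> coord_space \<Delta>" using w v by blast
      have "w + t *\<^sub>R v = (1 - t) *\<^sub>R w + t *\<^sub>R (w + v)" by (simp add: algebra_simps)
      then have "peval p (w + t *\<^sub>R v) \<le> (1 - t) * peval p w + t * peval p (w + v)"
        using convex_onD[OF conv, of t w "w + v"] t w wv by simp
      then have "t * (?A + t * ?q t v) \<le> t * (peval p (w + v) - peval p w)"
        unfolding rem2_line[OF p] by (simp add: algebra_simps power2_eq_square)
      then show ?thesis using t(1) by (simp only: mult_le_cancel_left_pos)
    qed
    have cont: "isCont (\<lambda>t. ?A + t * ?q t v) 0" by (intro continuous_intros)
    from isCont_upper_bound[OF cont bound] show ?thesis by simp
  qed
  show "peval p w + (\<Sum>s\<in>\<Delta>. partial s (peval p) w * v $ s) \<le> peval p (w + v)" by (rule tangent[OF v])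
  have bound: "- ?q t v \<le> 0" if t: "0 < t" "t < 1" for t
  proof -
    have "peval p w + t * (\<Sum>s\<in>\<Delta>. partial s (peval p) w * v $ s) \<le> peval p (w + t *\<^sub>R v)"
      using tangent[of "t *\<^sub>R v"] v by (auto simp: sum_distrib_left mult_ac)
    then have "0 \<le> t\<^sup>2 * ?q t v" unfolding rem2_line[OF p] by simp
    then show ?thesis using t(1) by (simp add: zero_le_mult_iff)
  qed
  have cont: "isCont (\<lambda>t. - ?q t v) 0" by (intro continuous_intros)
  from isCont_upper_bound[OF cont bound] show "0 \<le> quad_form \<Delta> (rem2 \<Delta> w p) w v" by simp
qed

text \<open>Compare the coefficients of the powers of \<open>t\<close> one after the other. After division by \<open>t\<close> the
  identity holds for \<open>t \<noteq> 0\<close> only, and continuity of the remainders extends it to 0.\<close>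

lemma second_order_comparison:
  fixes m R :: "real \<Rightarrow> real"
  assumes "isCont m 0" "isCont R 0" "\<And>t. c + t * A + t\<^sup>2 * m t = t\<^sup>2 * R t"
  shows "c = 0" "A = 0" "m 0 = R 0"
proof -
  show c: "c = 0" using assms(3)[of 0] by simp
  have 1: "A + t * (m t - R t) = 0" if "t \<noteq> 0" for t
  proof -
    have "t * (A + t * (m t - R t)) = 0"
      using assms(3)[of t] c by (simp add: algebra_simps power2_eq_square)
    then show ?thesis using that by simp
  qed
  have "isCont (\<lambda>t. A + t * (m t - R t)) 0" by (intro continuous_intros assms)
  from isCont_zero_extension[OF this 1] show A: "A = 0" by simp
  have "isCont (\<lambda>t. m t - R t) 0" by (intro continuous_intros assms)
  from isCont_zero_extension[OF this] 1 A show "m 0 = R 0" by simp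
qed

section \<open>The certificate of one convex block\<close>

abbreviation ent :: "'a mat \<Rightarrow> nat \<Rightarrow> nat \<Rightarrow> 'a" where
  "ent A \<equiv> \<lambda>a b. A $$ (a, b)"

lemma mat_inner_expand:
  assumes "A \<in> carrier_mat l l" "B \<in> carrier_mat l l"
  shows "mat_inner A B = (\<Sum>a<l. \<Sum>b<l. A $$ (a, b) * B $$ (b, a))"
  using assms by (simp add: mat_inner_def mat_trace_def scalar_prod_def atLeast0LessThan)

lemma bil_cong:
  "(\<And>a b. a < l \<Longrightarrow> b < l \<Longrightarrow> A a b = B a b) \<Longrightarrow> (\<And>a. a < l \<Longrightarrow> v a = v' a) \<Longrightarrow> (\<And>a. a < l \<Longrightarrow> w a = w' a)
    \<Longrightarrow> bil l A v w = bil l B v' w'"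
  by (simp add: bil_def)

lemma bil_matrix_add: "bil l (\<lambda>a b. A a b + B a b) v w = bil l A v w + bil l B v w"
  and bil_matrix_scale: "bil l (\<lambda>a b. c * A a b) v w = c * bil l A v w"
  by (simp_all add: bil_def algebra_simps sum.distrib sum_distrib_left)

lemma bil_matrix_sum: "bil l (\<lambda>a b. \<Sum>s\<in>S. A s a b) v w = (\<Sum>s\<in>S. bil l (A s) v w)"
  unfolding bil_def sum_distrib_left sum_distrib_right
  by (subst sum.swap, subst sum.swap, intro sum.cong refl sum.swap)

lemma bil_sum_left: "bil l A (\<lambda>a. \<Sum>s\<in>S. c s * x s a) w = (\<Sum>s\<in>S. c s * bil l A (x s) w)"
  by (induction S rule: infinite_finite_induct) (simp_all add: bil_add_left bil_scale_left, simp_all add: bil_def)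

lemma bil_sum_right: "bil l A w (\<lambda>a. \<Sum>s\<in>S. c s * x s a) = (\<Sum>s\<in>S. c s * bil l A w (x s))"
  by (induction S rule: infinite_finite_induct) (simp_all add: bil_add_right bil_scale_right, simp_all add: bil_def)

lemma app_sum: "app l A (\<lambda>a. \<Sum>s\<in>S. c s * x s a) k = (\<Sum>s\<in>S. c s * app l A (x s) k)"
  by (induction S rule: infinite_finite_induct)
     (simp_all add: app_def algebra_simps sum.distrib sum_distrib_left)

lemma app_mat_mult:
  assumes "A \<in> carrier_mat l l" "B \<in> carrier_mat l l" "k < l"
  shows "app l (ent (A * B)) x k = app l (ent A) (app l (ent B) x) k"
proof -
  have "app l (ent (A * B)) x k = (\<Sum>b<l. \<Sum>j<l. A $$ (k, j) * B $$ (j, b) * x b)"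
    using assms by (simp add: app_def scalar_prod_def atLeast0LessThan sum_distrib_right)
  also have "\<dots> = (\<Sum>j<l. \<Sum>b<l. A $$ (k, j) * B $$ (j, b) * x b)" by (rule sum.swap)
  finally show ?thesis by (simp add: app_def sum_distrib_left mult.assoc)
qed

lemma bil_sandwich:
  assumes X: "X \<in> carrier_mat l l" "\<And>a b. a < l \<Longrightarrow> b < l \<Longrightarrow> X $$ (a, b) = X $$ (b, a)"
    and P: "P \<in> carrier_mat l l" and Z: "Z \<in> carrier_mat l l"
  shows "bil l (ent (X * P * Z)) v w = bil l (ent P) (app l (ent X) v) (app l (ent Z) w)"
proof -
  let ?y = "app l (ent P) (app l (ent Z) w)"
  have XP: "X * P \<in> carrier_mat l l" by (rule mult_carrier_mat[OF X(1) P])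
  have "bil l (ent (X * P * Z)) v w = bil l (ent X) v ?y"
    unfolding bil_app by (intro sum.cong refl) (simp only: app_mat_mult[OF XP Z] app_mat_mult[OF X(1) P] lessThan_iff)
  also have "\<dots> = bil l (ent X) ?y v" by (rule bil_sym) (rule X(2))
  finally show ?thesis unfolding bil_app by (simp only: mult.commute)
qed

lemma sym_matsD:
  assumes "A \<in> sym_mats l" shows "A \<in> carrier_mat l l" "a < l \<Longrightarrow> b < l \<Longrightarrow> A $$ (a, b) = A $$ (b, a)"
proof -
  show c: "A \<in> carrier_mat l l" using assms by (simp add: sym_mats_def)
  assume ab: "a < l" "b < l"
  have "transpose_mat A = A" using assms by (simp add: sym_mats_def)
  then have "A $$ (a, b) = transpose_mat A $$ (a, b)" by simp
  then show "A $$ (a, b) = A $$ (b, a)" using ab c by simp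
qed

lemma sym_matsI:
  assumes "A \<in> carrier_mat l l" "\<And>a b. a < l \<Longrightarrow> b < l \<Longrightarrow> A $$ (a, b) = A $$ (b, a)" shows "A \<in> sym_mats l"
proof -
  have "transpose_mat A = A" using assms by (intro eq_matI) auto
  then show ?thesis using assms by (simp add: sym_mats_def)
qed

lemma concave_defect_index:
  fixes A B C :: "real mat"
  assumes "A \<in> carrier_mat l l" "B \<in> carrier_mat l l" "C \<in> carrier_mat l l" "a < l" "b < l"
  shows "(t \<cdot>\<^sub>m (- A) + s \<cdot>\<^sub>m (- B) - (- C)) $$ (a, b) = C $$ (a, b) + (- t) * A $$ (a, b) + (- s) * B $$ (a, b)"
  using assms by simp

lemma kernel_basis_cols:
  fixes A :: "real mat"
  assumes A: "A \<in> carrier_mat l l"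
  shows "kernel_basis A \<in> carrier_mat l (dim_col (kernel_basis A))"
    and "a < dim_col (kernel_basis A) \<Longrightarrow> col (kernel_basis A) a \<in> mat_kernel A"
proof -
  have E: "is_kernel_basis A (kernel_basis A)" by (rule is_kernel_basis_kernel_basis)
  have d: "dim_col A = l" using A by simp
  have "dim_row (kernel_basis A) = l" using E d by (simp add: is_kernel_basis_def)
  then show "kernel_basis A \<in> carrier_mat l (dim_col (kernel_basis A))" by auto
  interpret kernel l l A by unfold_locales (rule A)
  have "kernel.basis l A (set (cols (kernel_basis A)))" using E unfolding is_kernel_basis_def d by blast
  then have "set (cols (kernel_basis A)) \<subseteq> mat_kernel A" unfolding Ker.basis_def by blast
  then show "col (kernel_basis A) a \<in> mat_kernel A" if "a < dim_col (kernel_basis A)"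
    using that by (metis cols_length cols_nth nth_mem subsetD)
qed

text \<open>The columns of the chosen kernel basis lie in the kernel, so nothing else about the choice
  matters here.\<close>

lemma critical_spaceI:
  assumes G: "G \<in> carrier_mat l l" and v: "v \<in> coord_space \<Delta>"
    and ker: "\<And>x x'. (\<And>k. k < l \<Longrightarrow> app l (ent (mat_peval G z)) x k = 0) \<Longrightarrow>
      (\<And>k. k < l \<Longrightarrow> app l (ent (mat_peval G z)) x' k = 0) \<Longrightarrow>
      (\<Sum>j\<in>\<Delta>. v $ j * bil l (ent (mat_partial j G z)) x x') = 0"
  shows "v \<in> critical_space \<Delta> G z"
proof -
  have A: "mat_peval G z \<in> carrier_mat l l" using G by simp
  define E where "E = kernel_basis (mat_peval G z)"
  define n where "n = dim_col E"
  have Ec: "E \<in> carrier_mat l n" unfolding n_def E_def by (rule kernel_basis_cols(1)[OF A])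
  have Dc: "mat_partial j G z \<in> carrier_mat l l" for j using G by (simp add: mat_partial_def)
  have Eker: "app l (ent (mat_peval G z)) (\<lambda>i. E $$ (i, a)) k = 0" if a: "a < n" and k: "k < l" for a k
  proof -
    have "col E a \<in> mat_kernel (mat_peval G z)"
      using a unfolding n_def E_def by (rule kernel_basis_cols(2)[OF A])
    then have "mat_peval G z *\<^sub>v col E a = 0\<^sub>v l" by (rule mat_kernelD(2)[OF A])
    then have "vec_index (mat_peval G z *\<^sub>v col E a) k = 0" using k by simp
    moreover have "vec_index (B *\<^sub>v col E a) k = (\<Sum>i<l. B $$ (k, i) * E $$ (i, a))"
      if "B \<in> carrier_mat l l" for B
      using that Ec a k by (simp add: scalar_prod_def atLeast0LessThan)
    ultimately show ?thesis using A by (simp only: app_def)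
  qed
  have "Matrix.mat n n (\<lambda>ab. \<Sum>j\<in>\<Delta>. v $ j * (transpose_mat E * mat_partial j G z * E) $$ ab) = 0\<^sub>m n n"
  proof (rule eq_matI)
    fix a b assume "a < dim_row (0\<^sub>m n n :: real mat)" "b < dim_col (0\<^sub>m n n :: real mat)"
    then have ab: "a < n" "b < n" by auto
    have "(transpose_mat E * D * E) $$ (a, b) = bil l (ent D) (\<lambda>i. E $$ (i, a)) (\<lambda>i. E $$ (i, b))"
      if "D \<in> carrier_mat l l" for D
      using that Ec ab by (simp add: bil_def scalar_prod_def atLeast0LessThan sum_distrib_left mult.assoc)
    then have "(\<Sum>j\<in>\<Delta>. v $ j * (transpose_mat E * mat_partial j G z * E) $$ (a, b)) = 0"
      using ker[OF Eker[OF ab(1)] Eker[OF ab(2)]] Dc by (simp only:)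
    then show "Matrix.mat n n (\<lambda>ab. \<Sum>j\<in>\<Delta>. v $ j * (transpose_mat E * mat_partial j G z * E) $$ ab) $$ (a, b)
        = 0\<^sub>m n n $$ (a, b)" using ab by simp
  qed auto
  then show ?thesis unfolding critical_space_def Let_def E_def[symmetric] n_def[symmetric] using v by blast
qed

text \<open>One block of the problem, at the projection \<open>w\<close> of \<open>u\<close>. The first order condition couples the
  blocks through their gradients and is not part of it: \<open>F = f + shift\<close> is \<open>f\<close> minus the tangent of
  the Lagrangian at \<open>w\<close>, whatever the slope of this tangent.\<close>

locale convex_block =
  fixes \<Delta> :: "('n::finite) set" and l :: nat and f :: "'n mpoly" and G :: "'n mpoly mat"
    and L :: "real mat" and u :: "real ^ 'n"
  assumes f: "f \<in> polys \<Delta>" and G: "G \<in> sym_poly_mats \<Delta> l"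
    and L: "L \<in> sym_mats l" "psd L"
    and feas: "psd (mat_peval G (coord_proj \<Delta> u))"
    and compl: "mat_inner L (mat_peval G (coord_proj \<Delta> u)) = 0"
    and f_convex: "convex_on (coord_space \<Delta>) (peval f)"
    and G_concave: "mat_concave_on (coord_space \<Delta>) (mat_peval G)"
begin

abbreviation w :: "real ^ 'n" where "w \<equiv> coord_proj \<Delta> u"

definition Gv :: "real ^ 'n \<Rightarrow> nat \<Rightarrow> nat \<Rightarrow> real" where
  "Gv x a b = peval (G $$ (a, b)) x"

definition lag :: "'n mpoly" where
  "lag = f - (\<Sum>a<l. \<Sum>b<l. pconst (L $$ (a, b)) * G $$ (b, a))"

definition shift :: "'n mpoly" where
  "shift = - pconst (peval f w) - (\<Sum>j\<in>\<Delta>. pconst (partial j (peval lag) w) * (pvar j - pconst (w $ j)))"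

abbreviation F :: "'n mpoly" where "F \<equiv> f + shift"

text \<open>The number \<open>r\<close> of vectors and the vectors \<open>\<alpha> k\<close> with \<open>L = (\<Sum>k<r. \<alpha>\<^sub>k \<alpha>\<^sub>k\<^sup>T)\<close>.\<close>

definition gram :: "nat \<times> (nat \<Rightarrow> nat \<Rightarrow> real)" where
  "gram = (SOME g. \<forall>a<l. \<forall>b<l. L $$ (a, b) = (\<Sum>k<fst g. snd g k a * snd g k b))"

abbreviation r :: nat where "r \<equiv> fst gram"
abbreviation \<alpha> :: "nat \<Rightarrow> nat \<Rightarrow> real" where "\<alpha> \<equiv> snd gram"

lemmas Gd = sym_poly_matsD[OF G] and Ld = sym_matsD[OF L(1)]

lemma w: "w \<in> coord_space \<Delta>" by simp

lemma Gv_sym: "a < l \<Longrightarrow> b < l \<Longrightarrow> Gv x a b = Gv x b a"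
  using Gd(3) by (simp add: Gv_def)

lemma Gv_index: "a < l \<Longrightarrow> b < l \<Longrightarrow> mat_peval G x $$ (a, b) = Gv x a b"
  by (simp add: Gv_def mat_peval_index[OF Gd(1)])

lemma app_Gv: "a < l \<Longrightarrow> app l (ent (mat_peval G x)) y a = app l (Gv x) y a"
  unfolding app_def by (intro sum.cong refl) (simp add: Gv_index)

lemma mat_peval_G: "mat_peval G x \<in> carrier_mat l l"
  using Gd(1) by simp

lemma lag_polys: "lag \<in> polys \<Delta>"
  unfolding lag_def using Gd(2) by (intro polys_diff f polys_sum polys_mult polys_const) auto

lemma shift_polys: "shift \<in> polys \<Delta>"
  unfolding shift_def by (intro polys_diff polys_uminus polys_const polys_sum polys_mult polys_var)

lemma L_gram: "a < l \<Longrightarrow> b < l \<Longrightarrow> L $$ (a, b) = (\<Sum>k<r. \<alpha> k a * \<alpha> k b)"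
proof -
  obtain r' \<alpha>' where "\<forall>a\<in>{..<l}. \<forall>b\<in>{..<l}. L $$ (a, b) = (\<Sum>k<(r'::nat). \<alpha>' k a * \<alpha>' k b)"
    using psd_on_gram[of "{..<l}" "ent L"] L(2) psd_iff_psd_on[OF Ld(1)] by auto
  then have "\<exists>g :: nat \<times> (nat \<Rightarrow> nat \<Rightarrow> real). \<forall>a<l. \<forall>b<l. L $$ (a, b) = (\<Sum>k<fst g. snd g k a * snd g k b)"
    by (intro exI[of _ "(r', \<alpha>')"]) simp
  from someI_ex[OF this] show "a < l \<Longrightarrow> b < l \<Longrightarrow> L $$ (a, b) = (\<Sum>k<r. \<alpha> k a * \<alpha> k b)"
    unfolding gram_def by blast
qed

lemma inner_gram:
  assumes "M \<in> carrier_mat l l"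
  shows "mat_inner L M = (\<Sum>k<r. bil l (ent M) (\<alpha> k) (\<alpha> k))"
proof -
  have "mat_inner L M = (\<Sum>a<l. \<Sum>b<l. \<Sum>k<r. \<alpha> k b * M $$ (b, a) * \<alpha> k a)"
    unfolding mat_inner_expand[OF Ld(1) assms]
    by (intro sum.cong refl) (simp add: L_gram sum_distrib_left sum_distrib_right mult_ac)
  also have "\<dots> = (\<Sum>b<l. \<Sum>a<l. \<Sum>k<r. \<alpha> k b * M $$ (b, a) * \<alpha> k a)" by (rule sum.swap)
  also have "\<dots> = (\<Sum>b<l. \<Sum>k<r. \<Sum>a<l. \<alpha> k b * M $$ (b, a) * \<alpha> k a)" by (intro sum.cong refl sum.swap)
  also have "\<dots> = (\<Sum>k<r. \<Sum>b<l. \<Sum>a<l. \<alpha> k b * M $$ (b, a) * \<alpha> k a)" by (rule sum.swap)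
  finally show ?thesis by (simp only: bil_def)
qed

lemma inner_G: "mat_inner L (mat_peval G x) = (\<Sum>k<r. bil l (Gv x) (\<alpha> k) (\<alpha> k))"
  unfolding inner_gram[OF mat_peval_G] by (intro sum.cong refl bil_cong Gv_index)

lemma psd_bil: "psd (mat_peval G x) \<longleftrightarrow> (\<forall>v. 0 \<le> bil l (Gv x) v v)"
  unfolding psd_mat_peval_iff[OF G] bil_def Gv_def ..

lemma peval_lag: "peval lag x = peval f x - mat_inner L (mat_peval G x)"
  unfolding mat_inner_expand[OF Ld(1) mat_peval_G]
  by (simp add: lag_def mat_peval_index[OF Gd(1)])

lemma lagrangian_eq: "lagrangian \<Delta> f G L = peval lag"
proof
  fix x
  have "lagrangian \<Delta> f G L x = peval lag (coord_proj \<Delta> x)"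
    by (simp add: lagrangian_def peval_lag)
  then show "lagrangian \<Delta> f G L x = peval lag x" by (simp add: peval_coord_proj lag_polys)
qed

lemma concave_form:
  assumes "x \<in> coord_space \<Delta>" "z \<in> coord_space \<Delta>" "0 \<le> t" "t \<le> 1"
  shows "t * bil l (Gv x) v v + (1 - t) * bil l (Gv z) v v \<le> bil l (Gv (t *\<^sub>R x + (1 - t) *\<^sub>R z)) v v"
proof -
  let ?c = "t *\<^sub>R x + (1 - t) *\<^sub>R z"
  let ?M = "(t \<cdot>\<^sub>m (- mat_peval G x) + (1 - t) \<cdot>\<^sub>m (- mat_peval G z)) - (- mat_peval G ?c)"
  have M: "?M \<in> carrier_mat l l" using mat_peval_G by (auto intro!: minus_carrier_mat)
  have "psd ?M"
    using G_concave assms unfolding mat_concave_on_def mat_convex_on_def loewner_le_def by blast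
  then have "0 \<le> bil l (ent ?M) v v" unfolding psd_iff_psd_on[OF M] psd_on_def bil_def by blast
  also have "bil l (ent ?M) v v = bil l (\<lambda>a b. Gv ?c a b + (- t) * Gv x a b + (- (1 - t)) * Gv z a b) v v"
    by (intro bil_cong) (simp_all only: concave_defect_index[OF mat_peval_G mat_peval_G mat_peval_G] Gv_index)
  finally show ?thesis unfolding bil_matrix_add bil_matrix_scale by (simp add: algebra_simps)
qed

lemma lag_convex: "convex_on (coord_space \<Delta>) (peval lag)"
proof (rule convex_onI)
  fix t :: real and x z assume t: "0 < t" "t < 1" and x: "x \<in> coord_space \<Delta>" and z: "z \<in> coord_space \<Delta>"
  have "peval f ((1 - t) *\<^sub>R x + t *\<^sub>R z) \<le> (1 - t) * peval f x + t * peval f z"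
    using convex_onD[OF f_convex, of t x z] t x z by simp
  moreover have "(1 - t) * mat_inner L (mat_peval G x) + t * mat_inner L (mat_peval G z)
      \<le> mat_inner L (mat_peval G ((1 - t) *\<^sub>R x + t *\<^sub>R z))"
    unfolding inner_G sum_distrib_left sum.distrib[symmetric]
    using concave_form[OF x z, of "1 - t"] t by (intro sum_mono) simp
  ultimately show "peval lag ((1 - t) *\<^sub>R x + t *\<^sub>R z) \<le> (1 - t) * peval lag x + t * peval lag z"
    by (simp add: peval_lag algebra_simps)
next
  show "convex (coord_space \<Delta>)"
    by (rule convexI) (intro coord_space_add coord_space_scaleR)
qed

lemma peval_shift_line:
  "peval shift (w + t *\<^sub>R v) = - peval f w - t * (\<Sum>j\<in>\<Delta>. partial j (peval lag) w * v $ j)"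
  by (simp add: shift_def sum_distrib_left mult_ac)

lemma peval_lag_w: "peval lag w = peval f w"
  using compl by (simp add: peval_lag)

text \<open>The polynomial \<open>F\<close> is the sum of \<open>lag\<close> minus its tangent, which is nonnegative because \<open>lag\<close> is
  convex, and of the pairing of \<open>L\<close> with \<open>G\<close>, which is nonnegative where \<open>G\<close> is positive
  semidefinite.\<close>

theorem shifted_objective_nonneg:
  assumes "z \<in> block_feasible \<Delta> G" shows "0 \<le> peval F z"
proof -
  have z: "z \<in> coord_space \<Delta>" "psd (mat_peval G z)" using assms by (auto simp: block_feasible_def)
  then have v: "z - w \<in> coord_space \<Delta>" using w by blast
  have "0 \<le> mat_inner L (mat_peval G z)"
    unfolding inner_G using z(2) unfolding psd_bil by (intro sum_nonneg) blast
  then show ?thesis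
    using convex_tangent(1)[OF lag_polys lag_convex w v] peval_shift_line[of 1 "z - w"]
    by (simp add: peval_lag_w) (simp add: peval_lag)
qed

section \<open>An element of the module close to the shifted objective\<close>

lemma Gw_psd: "0 \<le> bil l (Gv w) v v"
  using feas unfolding psd_bil by blast

text \<open>By complementarity the pairing of \<open>L\<close> with \<open>G(w)\<close>, a sum of nonnegative terms, is zero.\<close>

lemma bil_Gw_gram: "k < r \<Longrightarrow> bil l (Gv w) (\<alpha> k) (\<alpha> k) = 0"
proof -
  have "\<forall>k\<in>{..<r}. bil l (Gv w) (\<alpha> k) (\<alpha> k) = 0"
    using Gw_psd compl[unfolded inner_G] by (subst sum_nonneg_eq_0_iff[symmetric]) auto
  then show "k < r \<Longrightarrow> bil l (Gv w) (\<alpha> k) (\<alpha> k) = 0" by simp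
qed

lemma Gw_gram: "k < r \<Longrightarrow> a < l \<Longrightarrow> app l (Gv w) (\<alpha> k) a = 0"
  by (rule psd_kernel[OF Gw_psd Gv_sym bil_Gw_gram])

lemma app_L: "a < l \<Longrightarrow> app l (ent L) x a = (\<Sum>k<r. (\<Sum>b<l. \<alpha> k b * x b) * \<alpha> k a)"
proof -
  assume a: "a < l"
  have "app l (ent L) x a = (\<Sum>b<l. \<Sum>k<r. \<alpha> k b * x b * \<alpha> k a)"
    unfolding app_def using a by (intro sum.cong refl) (simp add: L_gram sum_distrib_left sum_distrib_right mult_ac)
  also have "\<dots> = (\<Sum>k<r. \<Sum>b<l. \<alpha> k b * x b * \<alpha> k a)" by (rule sum.swap)
  finally show ?thesis by (simp only: sum_distrib_right)
qed

lemma bil_L: "bil l (ent L) x x = (\<Sum>k<r. (\<Sum>a<l. \<alpha> k a * x a)\<^sup>2)"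
proof -
  have "bil l (ent L) x x = (\<Sum>a<l. \<Sum>k<r. (\<Sum>b<l. \<alpha> k b * x b) * (\<alpha> k a * x a))"
    unfolding bil_app by (intro sum.cong refl) (simp add: app_L sum_distrib_left mult_ac)
  also have "\<dots> = (\<Sum>k<r. \<Sum>a<l. (\<Sum>b<l. \<alpha> k b * x b) * (\<alpha> k a * x a))" by (rule sum.swap)
  finally show ?thesis by (simp only: sum_distrib_left[symmetric] power2_eq_square)
qed

lemma Gw_L: "a < l \<Longrightarrow> app l (Gv w) (app l (ent L) x) a = 0"
proof -
  assume a: "a < l"
  have "app l (Gv w) (app l (ent L) x) a = app l (Gv w) (\<lambda>a. \<Sum>k<r. (\<Sum>b<l. \<alpha> k b * x b) * \<alpha> k a) a"
    by (rule fun_cong[OF app_cong]) (rule app_L)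
  then show ?thesis using a by (simp add: app_sum Gw_gram)
qed

definition P :: "real mat" where "P = moore_penrose (mat_peval G w)"

lemma Gw_sym: "mat_peval G w \<in> sym_mats l"
  by (rule sym_matsI[OF mat_peval_G]) (simp add: Gv_index Gv_sym)

lemma P_sym: "P \<in> sym_mats l" and PGP: "P * mat_peval G w * P = P"
  using moore_penrose_sym[OF Gw_sym] by (auto simp: P_def)

lemma bil_P: "bil l (ent P) x x' = bil l (Gv w) (app l (ent P) x) (app l (ent P) x')"
proof -
  have "bil l (ent (P * mat_peval G w * P)) x x' = bil l (ent (mat_peval G w)) (app l (ent P) x) (app l (ent P) x')"
    by (rule bil_sandwich[OF sym_matsD[OF P_sym] mat_peval_G sym_matsD(1)[OF P_sym]])
  also have "\<dots> = bil l (Gv w) (app l (ent P) x) (app l (ent P) x')" by (intro bil_cong Gv_index) auto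
  finally show ?thesis by (simp only: PGP)
qed

text \<open>Correcting \<open>\<alpha>\<close> by \<open>-t e\<close> contributes \<open>2 d\<^sup>T e - e\<^sup>T G(w) e\<close> to the second order part of
  \<open>F - \<theta>\<close>, where \<open>d\<close> is the derivative of \<open>G \<alpha>\<close>. On the range of \<open>G(w)\<close> the maximizer is
  \<open>e = P d\<close>, with value \<open>d\<^sup>T P d\<close>. The range of \<open>L\<close> lies in the kernel of \<open>G(w)\<close>, so adding a
  positive multiple of \<open>L d\<close> to \<open>e\<close> costs nothing and gains a multiple of \<open>d\<^sup>T L d\<close>; the factor
  one half makes this multiple 1.\<close>

definition Q :: "nat \<Rightarrow> nat \<Rightarrow> real" where
  "Q a b = P $$ (a, b) + 1/2 * L $$ (a, b)"

lemma bil_Gw_Q: "bil l (Gv w) (app l Q x) (app l Q x) = bil l (ent P) x x"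
proof -
  have z: "bil l (Gv w) y (app l (ent L) x) = 0" for y unfolding bil_app using Gw_L by simp
  have z': "bil l (Gv w) (app l (ent L) x) y = 0" for y
    using bil_sym[where l = l and A = "Gv w" and v = "app l (ent L) x" and w = y, OF Gv_sym] z[of y] by simp
  have "app l Q x = (\<lambda>a. app l (ent P) x a + 1/2 * app l (ent L) x a)"
    by (rule ext) (simp add: app_def Q_def algebra_simps sum.distrib sum_distrib_left)
  then show ?thesis
    by (simp only: bil_add_left bil_add_right bil_scale_left bil_scale_right z z' bil_P mult_zero_right add_0_right)
qed

definition D :: "'n \<Rightarrow> nat \<Rightarrow> nat \<Rightarrow> real" where
  "D s a b = partial s (peval (G $$ (a, b))) w"

text \<open>The derivative of \<open>G\<close> at \<open>w\<close> in direction \<open>v\<close>; \<open>G2 v t\<close> is the second order remainder along the line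
  \<open>w + t v\<close>, and \<open>dv v k\<close> the derivative of \<open>G \<alpha>\<^sub>k\<close>.\<close>

definition Dv :: "real ^ 'n \<Rightarrow> nat \<Rightarrow> nat \<Rightarrow> real" where
  "Dv v a b = (\<Sum>s\<in>\<Delta>. v $ s * D s a b)"

definition G2 :: "real ^ 'n \<Rightarrow> real \<Rightarrow> nat \<Rightarrow> nat \<Rightarrow> real" where
  "G2 v t a b = quad_form \<Delta> (rem2 \<Delta> w (G $$ (a, b))) (w + t *\<^sub>R v) v"

definition dv :: "real ^ 'n \<Rightarrow> nat \<Rightarrow> nat \<Rightarrow> real" where
  "dv v k a = (\<Sum>s\<in>\<Delta>. v $ s * app l (D s) (\<alpha> k) a)"

lemma D_sym: "a < l \<Longrightarrow> b < l \<Longrightarrow> D s a b = D s b a"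
  using Gd(3) by (simp add: D_def)

lemma Dv_sym: "a < l \<Longrightarrow> b < l \<Longrightarrow> Dv v a b = Dv v b a"
  unfolding Dv_def by (intro sum.cong refl) (simp add: D_sym)

lemma G_line: "a < l \<Longrightarrow> b < l \<Longrightarrow> Gv (w + t *\<^sub>R v) a b = Gv w a b + t * Dv v a b + t\<^sup>2 * G2 v t a b"
  unfolding Gv_def G2_def Dv_def D_def using rem2_line[OF Gd(2)] by (simp add: mult.commute)

lemma dv_eq: "dv v k = app l (Dv v) (\<alpha> k)"
proof
  fix a
  have "app l (Dv v) (\<alpha> k) a = (\<Sum>b<l. \<Sum>s\<in>\<Delta>. v $ s * (D s a b * \<alpha> k b))"
    by (simp add: app_def Dv_def sum_distrib_right mult.assoc)
  also have "\<dots> = (\<Sum>s\<in>\<Delta>. \<Sum>b<l. v $ s * (D s a b * \<alpha> k b))" by (rule sum.swap)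
  finally show "dv v k a = app l (Dv v) (\<alpha> k) a" by (simp add: dv_def app_def sum_distrib_left)
qed

text \<open>On the line \<open>w + t v\<close> this vector is \<open>\<alpha>\<^sub>k - t Q (dv v k)\<close>. With the constant vectors \<open>\<alpha>\<^sub>k\<close> alone, \<open>\<theta>\<close>
  would be \<open>\<langle>L, G\<rangle>\<close>, and \<open>F - \<theta>\<close> would have only the Hessian of \<open>lag\<close> as second order part.\<close>

definition Pv :: "nat \<Rightarrow> 'n mpoly Matrix.vec" where
  "Pv k = Matrix.vec l (\<lambda>a. pconst (\<alpha> k a)
    - (\<Sum>s\<in>\<Delta>. pconst (app l Q (app l (D s) (\<alpha> k)) a) * (pvar s - pconst (w $ s))))"

definition \<theta> :: "'n mpoly" where
  "\<theta> = (\<Sum>k<r. poly_form G (Pv k))"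

lemma Pv: "Pv k \<in> poly_vecs \<Delta> l"
  unfolding Pv_def by (intro poly_vecsI polys_diff polys_sum polys_mult polys_const polys_var)

lemma Pv_line: "a < l \<Longrightarrow> peval (vec_index (Pv k) a) (w + t *\<^sub>R v) = \<alpha> k a + (- t) * app l Q (dv v k) a"
proof -
  assume a: "a < l"
  have "dv v k = (\<lambda>a. \<Sum>s\<in>\<Delta>. v $ s * app l (D s) (\<alpha> k) a)" by (rule ext) (simp only: dv_def)
  then have "app l Q (dv v k) a = (\<Sum>s\<in>\<Delta>. v $ s * app l Q (app l (D s) (\<alpha> k)) a)" by (simp only: app_sum)
  then show ?thesis using a by (simp add: Pv_def sum_distrib_left sum_negf mult_ac)
qed

lemma \<theta>: "\<theta> \<in> qmodule \<Delta> G"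
  unfolding \<theta>_def by (intro quadratic_module_sum[OF quadratic_module_qmodule[OF G]] poly_form_in_qmodule[OF G Pv])

lemma \<theta>_line:
  defines "x \<equiv> \<lambda>t v. w + t *\<^sub>R v" and "e \<equiv> \<lambda>v k. app l Q (dv v k)"
  shows "peval \<theta> (x t v) = (\<Sum>k<r. bil l (Gv (x t v)) (\<alpha> k) (\<alpha> k)
      - 2 * t * bil l (Gv (x t v)) (\<alpha> k) (e v k) + t\<^sup>2 * bil l (Gv (x t v)) (e v k) (e v k))"
proof -
  let ?x = "x t v"
  have "peval (poly_form G (Pv k)) ?x = bil l (Gv ?x) (\<alpha> k) (\<alpha> k)
    - 2 * t * bil l (Gv ?x) (\<alpha> k) (e v k) + t\<^sup>2 * bil l (Gv ?x) (e v k) (e v k)" for k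
  proof -
    have "peval (poly_form G (Pv k)) ?x = bil l (Gv ?x) (\<lambda>a. peval (vec_index (Pv k) a) ?x) (\<lambda>a. peval (vec_index (Pv k) a) ?x)"
      unfolding peval_poly_form[OF G poly_vecsD(1)[OF Pv]] bil_def Gv_def ..
    also have "\<dots> = bil l (Gv ?x) (\<lambda>a. \<alpha> k a + (- t) * e v k a) (\<lambda>a. \<alpha> k a + (- t) * e v k a)"
      by (intro bil_cong) (simp_all only: Pv_line x_def e_def)
    also have "\<dots> = bil l (Gv ?x) (\<alpha> k) (\<alpha> k) - 2 * t * bil l (Gv ?x) (\<alpha> k) (e v k) + t\<^sup>2 * bil l (Gv ?x) (e v k) (e v k)"
      using bil_sym[where l = l and A = "Gv ?x" and v = "e v k" and w = "\<alpha> k", OF Gv_sym]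
      by (simp only: bil_add_left bil_add_right bil_scale_left bil_scale_right) (simp add: algebra_simps power2_eq_square)
    finally show ?thesis .
  qed
  then show ?thesis by (simp add: \<theta>_def)
qed

section \<open>The remainder and the second order condition\<close>

abbreviation lag2 :: "'n \<Rightarrow> 'n \<Rightarrow> 'n mpoly" where "lag2 \<equiv> rem2 \<Delta> w lag"

text \<open>The second summand is \<open>\<langle>L, G\<rangle>\<close>; it occurs in \<open>\<theta>_line\<close> as well and cancels in \<open>F - \<theta>\<close>.\<close>

lemma F_line: "peval F (w + t *\<^sub>R v) = t\<^sup>2 * quad_form \<Delta> lag2 (w + t *\<^sub>R v) v
    + (\<Sum>k<r. bil l (Gv (w + t *\<^sub>R v)) (\<alpha> k) (\<alpha> k))"
proof -
  have "peval F (w + t *\<^sub>R v) = peval lag (w + t *\<^sub>R v) + mat_inner L (mat_peval G (w + t *\<^sub>R v)) + peval shift (w + t *\<^sub>R v)"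
    by (simp add: peval_lag)
  then show ?thesis unfolding inner_G peval_shift_line rem2_line[OF lag_polys] peval_lag_w by simp
qed

text \<open>The quotient of \<open>F - \<theta>\<close> by \<open>t\<^sup>2\<close> along the line \<open>w + t v\<close>. It is a polynomial expression in \<open>t\<close> because
  \<open>G(w) \<alpha>\<^sub>k = 0\<close> by complementarity.\<close>

definition R :: "real ^ 'n \<Rightarrow> real \<Rightarrow> real" where
  "R v t = quad_form \<Delta> lag2 (w + t *\<^sub>R v) v + (\<Sum>k<r. 2 * bil l (Dv v) (\<alpha> k) (app l Q (dv v k))
    + 2 * t * bil l (G2 v t) (\<alpha> k) (app l Q (dv v k)) - bil l (Gv (w + t *\<^sub>R v)) (app l Q (dv v k)) (app l Q (dv v k)))"

lemma R_cont: "isCont (R v) 0"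
  unfolding R_def bil_def G2_def Gv_def by (intro continuous_intros)

lemma remainder_line: "peval (F - \<theta>) (w + t *\<^sub>R v) = t\<^sup>2 * R v t"
proof -
  let ?x = "w + t *\<^sub>R v" and ?e = "\<lambda>k. app l Q (dv v k)"
  have b: "bil l (Gv ?x) (\<alpha> k) (?e k) = t * bil l (Dv v) (\<alpha> k) (?e k) + t\<^sup>2 * bil l (G2 v t) (\<alpha> k) (?e k)"
    if "k < r" for k
  proof -
    have "bil l (Gv w) (\<alpha> k) (?e k) = bil l (Gv w) (?e k) (\<alpha> k)"
      by (rule bil_sym) (rule Gv_sym)
    also have "\<dots> = 0" unfolding bil_app using Gw_gram[OF that] by simp
    finally have z: "bil l (Gv w) (\<alpha> k) (?e k) = 0" .
    have "bil l (Gv ?x) (\<alpha> k) (?e k) = bil l (\<lambda>a b. Gv w a b + t * Dv v a b + t\<^sup>2 * G2 v t a b) (\<alpha> k) (?e k)"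
      by (intro bil_cong G_line) auto
    then show ?thesis by (simp only: bil_matrix_add bil_matrix_scale z add_0_left)
  qed
  have "peval (F - \<theta>) ?x = t\<^sup>2 * quad_form \<Delta> lag2 ?x v
    + (\<Sum>k<r. 2 * t * bil l (Gv ?x) (\<alpha> k) (?e k) - t\<^sup>2 * bil l (Gv ?x) (?e k) (?e k))"
    unfolding peval_diff F_line \<theta>_line by (simp add: sum.distrib sum_subtractf)
  also have "\<dots> = t\<^sup>2 * quad_form \<Delta> lag2 ?x v + (\<Sum>k<r. t\<^sup>2 * (2 * bil l (Dv v) (\<alpha> k) (?e k)
    + 2 * t * bil l (G2 v t) (\<alpha> k) (?e k) - bil l (Gv ?x) (?e k) (?e k)))"
    by (intro arg_cong2[where f = "(+)"] sum.cong refl) (simp add: b algebra_simps power2_eq_square)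
  finally show ?thesis by (simp add: R_def sum_distrib_left distrib_left)
qed

lemma R_0: "R v 0 = quad_form \<Delta> lag2 w v + (\<Sum>k<r. bil l (ent P) (dv v k) (dv v k)) + (\<Sum>k<r. bil l (ent L) (dv v k) (dv v k))"
proof -
  have "2 * bil l (Dv v) (\<alpha> k) (app l Q (dv v k)) - bil l (Gv w) (app l Q (dv v k)) (app l Q (dv v k))
      = bil l (ent P) (dv v k) (dv v k) + bil l (ent L) (dv v k) (dv v k)" for k
  proof -
    have "bil l (Dv v) (\<alpha> k) (app l Q (dv v k)) = bil l (Dv v) (app l Q (dv v k)) (\<alpha> k)"
      by (rule bil_sym) (rule Dv_sym)
    also have "\<dots> = bil l Q (dv v k) (dv v k)"
      unfolding bil_app dv_eq[symmetric] by (simp only: mult.commute)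
    also have "\<dots> = bil l (ent P) (dv v k) (dv v k) + 1/2 * bil l (ent L) (dv v k) (dv v k)"
      unfolding Q_def bil_matrix_add bil_matrix_scale ..
    finally show ?thesis unfolding bil_Gw_Q by simp
  qed
  then show ?thesis by (simp add: R_def sum.distrib add.assoc)
qed

lemma mat_partial_D: "mat_partial j G w \<in> carrier_mat l l" "a < l \<Longrightarrow> b < l \<Longrightarrow> mat_partial j G w $$ (a, b) = D j a b"
  using Gd(1) by (auto simp: mat_partial_def D_def)

text \<open>Inserting \<open>L = (\<Sum>k. \<alpha>\<^sub>k \<alpha>\<^sub>k\<^sup>T)\<close> turns the trace of \<open>L\<close> times \<open>\<nabla>\<^sub>sG P \<nabla>\<^sub>tG\<close> into
  \<open>\<Sum>k. (\<nabla>\<^sub>sG \<alpha>\<^sub>k)\<^sup>T P (\<nabla>\<^sub>tG \<alpha>\<^sub>k)\<close>, so the curvature term of the second order condition is the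
  second term of \<open>R_0\<close>.\<close>

lemma curvature_form:
  "(\<Sum>s\<in>\<Delta>. \<Sum>t\<in>\<Delta>. v $ s * curvature G L w $ s $ t * v $ t) = 2 * (\<Sum>k<r. bil l (ent P) (dv v k) (dv v k))"
proof -
  have app_D: "app l (ent (mat_partial s G w)) y a = app l (D s) y a" if "a < l" for s y a
    unfolding app_def using that by (intro sum.cong refl) (simp add: mat_partial_D)
  let ?b = "\<lambda>k s t. bil l (ent P) (app l (D s) (\<alpha> k)) (app l (D t) (\<alpha> k))"
  have C: "curvature G L w $ s $ t = 2 * (\<Sum>k<r. ?b k s t)" for s t
  proof -
    let ?M = "mat_partial s G w * P * mat_partial t G w"
    have Pc: "P \<in> carrier_mat l l" using sym_matsD(1)[OF P_sym] .
    have Mc: "?M \<in> carrier_mat l l" by (rule mult_carrier_mat[OF mult_carrier_mat[OF mat_partial_D(1) Pc] mat_partial_D(1)])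
    have "bil l (ent ?M) (\<alpha> k) (\<alpha> k) = ?b k s t" for k
    proof -
      have "bil l (ent ?M) (\<alpha> k) (\<alpha> k)
          = bil l (ent P) (app l (ent (mat_partial s G w)) (\<alpha> k)) (app l (ent (mat_partial t G w)) (\<alpha> k))"
        by (rule bil_sandwich[OF mat_partial_D(1) _ Pc mat_partial_D(1)]) (simp add: mat_partial_D D_sym)
      also have "\<dots> = ?b k s t" by (intro bil_cong app_D) auto
      finally show ?thesis .
    qed
    then show ?thesis by (simp add: curvature_def P_def[symmetric] inner_gram[OF Mc])
  qed
  have "(\<Sum>s\<in>\<Delta>. \<Sum>t\<in>\<Delta>. v $ s * curvature G L w $ s $ t * v $ t)
      = (\<Sum>s\<in>\<Delta>. \<Sum>t\<in>\<Delta>. \<Sum>k<r. 2 * (v $ s * (v $ t * ?b k s t)))"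
    unfolding C by (intro sum.cong refl) (simp add: sum_distrib_left sum_distrib_right mult_ac)
  also have "\<dots> = (\<Sum>s\<in>\<Delta>. \<Sum>k<r. \<Sum>t\<in>\<Delta>. 2 * (v $ s * (v $ t * ?b k s t)))"
    by (intro sum.cong refl sum.swap)
  also have "\<dots> = (\<Sum>k<r. \<Sum>s\<in>\<Delta>. \<Sum>t\<in>\<Delta>. 2 * (v $ s * (v $ t * ?b k s t)))" by (rule sum.swap)
  also have "\<dots> = (\<Sum>k<r. 2 * bil l (ent P) (dv v k) (dv v k))"
    unfolding dv_def bil_sum_left bil_sum_right by (simp only: sum_distrib_left)
  finally show ?thesis by (simp only: sum_distrib_left)
qed

text \<open>All three terms of \<open>R v 0\<close> are nonnegative. If the last one vanishes, the derivative of \<open>G\<close>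
  along \<open>v\<close> vanishes as a form on the range of \<open>L\<close>; by strict complementarity this range is the
  kernel of \<open>G(w)\<close>, so \<open>v\<close> is critical, and the first two terms are half of the positive quantity
  in the second order condition.\<close>

lemma R_pos:
  assumes rank: "mat_rank (mat_peval G w) + mat_rank L = l"
    and sosc: "second_order_sufficient \<Delta> f G L u"
    and v: "v \<in> coord_space \<Delta>" "v \<noteq> 0"
  shows "0 < R v 0"
proof (rule ccontr)
  assume "\<not> 0 < R v 0"
  moreover have "0 \<le> quad_form \<Delta> lag2 w v" by (rule convex_tangent(2)[OF lag_polys lag_convex w v(1)])
  moreover have "0 \<le> (\<Sum>k<r. bil l (ent P) (dv v k) (dv v k))" unfolding bil_P using Gw_psd by (intro sum_nonneg)
  moreover have Lnn: "0 \<le> bil l (ent L) (dv v k) (dv v k)" for k unfolding bil_L by (intro sum_nonneg) simp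
  moreover have "0 \<le> (\<Sum>k<r. bil l (ent L) (dv v k) (dv v k))" using Lnn by (intro sum_nonneg)
  ultimately have z: "quad_form \<Delta> lag2 w v = 0" "(\<Sum>k<r. bil l (ent P) (dv v k) (dv v k)) = 0"
    "(\<Sum>k<r. bil l (ent L) (dv v k) (dv v k)) = 0"
    unfolding R_0 by linarith+
  have z\<alpha>: "bil l (Dv v) (\<alpha> k') (\<alpha> k) = 0" if k: "k < r" "k' < r" for k k'
  proof -
    have "\<forall>k\<in>{..<r}. bil l (ent L) (dv v k) (dv v k) = 0"
      using z(3) Lnn by (subst sum_nonneg_eq_0_iff[symmetric]) auto
    then have "(\<Sum>k'<r. (\<Sum>a<l. \<alpha> k' a * dv v k a)\<^sup>2) = 0" using k(1) bil_L[of "dv v k"] by simp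
    then have "\<forall>k'\<in>{..<r}. (\<Sum>a<l. \<alpha> k' a * dv v k a)\<^sup>2 = 0"
      by (subst sum_nonneg_eq_0_iff[symmetric]) auto
    then show ?thesis using k(2) unfolding bil_app dv_eq[symmetric] by simp
  qed
  have kernel: "\<exists>c. \<forall>a<l. x a = (\<Sum>k<r. c k * \<alpha> k a)"
    if x: "\<And>a. a < l \<Longrightarrow> app l (ent (mat_peval G w)) x a = 0" for x
  proof -
    have "\<exists>y. \<forall>k<l. x k = app l (ent L) y k"
      by (rule kernel_subset_range[OF Gw_sym L(1) _ rank x]) (simp_all add: app_Gv Gw_L)
    then obtain y where "\<forall>k<l. x k = app l (ent L) y k" by blast
    then have "\<forall>a<l. x a = (\<Sum>k<r. (\<Sum>b<l. \<alpha> k b * y b) * \<alpha> k a)" using app_L by simp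
    then show ?thesis by (rule exI[of _ "\<lambda>k. \<Sum>b<l. \<alpha> k b * y b"])
  qed
  have crit: "v \<in> critical_space \<Delta> G w"
  proof (rule critical_spaceI[OF Gd(1) v(1)])
    fix x x' assume x: "\<And>k. k < l \<Longrightarrow> app l (ent (mat_peval G w)) x k = 0"
      and x': "\<And>k. k < l \<Longrightarrow> app l (ent (mat_peval G w)) x' k = 0"
    obtain c where c: "\<forall>a<l. x a = (\<Sum>k<r. c k * \<alpha> k a)" using kernel[OF x] by blast
    obtain c' where c': "\<forall>a<l. x' a = (\<Sum>k<r. c' k * \<alpha> k a)" using kernel[OF x'] by blast
    have "bil l (ent (mat_partial j G w)) x x' = bil l (D j) x x'" for j
      by (intro bil_cong mat_partial_D) auto
    then have "(\<Sum>j\<in>\<Delta>. v $ j * bil l (ent (mat_partial j G w)) x x') = bil l (Dv v) x x'"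
      unfolding Dv_def bil_matrix_sum bil_matrix_scale by (simp only:)
    also have "\<dots> = bil l (Dv v) (\<lambda>a. \<Sum>k<r. c k * \<alpha> k a) (\<lambda>a. \<Sum>k<r. c' k * \<alpha> k a)"
      using c c' by (intro bil_cong) auto
    also have "\<dots> = 0" unfolding bil_sum_left bil_sum_right using z\<alpha> by simp
    finally show "(\<Sum>j\<in>\<Delta>. v $ j * bil l (ent (mat_partial j G w)) x x') = 0" .
  qed
  have "0 < (\<Sum>s\<in>\<Delta>. \<Sum>t\<in>\<Delta>. v $ s * (hessian (peval lag) w + curvature G L w) $ s $ t * v $ t)"
    using sosc crit v(2) unfolding second_order_sufficient_def lagrangian_eq hessian_coord_proj[OF lag_polys, of u, symmetric]
    by blast
  also have "\<dots> = (\<Sum>s\<in>\<Delta>. \<Sum>t\<in>\<Delta>. v $ s * hessian (peval lag) w $ s $ t * v $ t)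
      + (\<Sum>s\<in>\<Delta>. \<Sum>t\<in>\<Delta>. v $ s * curvature G L w $ s $ t * v $ t)"
    by (simp add: algebra_simps sum.distrib)
  also have "\<dots> = 0" unfolding rem2_hessian[OF lag_polys] curvature_form z by simp
  finally show False by simp
qed

text \<open>The remainder \<open>F - \<theta>\<close> vanishes to second order at \<open>w\<close>, with the positive definite form
  \<open>v \<mapsto> R v 0\<close>. On the feasible set \<open>F\<close> can vanish at \<open>w\<close> only: at another zero \<open>x\<close>, convexity would
  give \<open>F \<le> 0\<close> on the feasible segment from \<open>w\<close> to \<open>x\<close>, hence \<open>F - \<theta> \<le> 0\<close> there, against the
  positive second derivative at \<open>w\<close>.\<close>

theorem shifted_objective_in_qmodule:
  assumes arch: "archimedean_qmodule \<Delta> G"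
    and rank: "mat_rank (mat_peval G w) + mat_rank L = l"
    and sosc: "second_order_sufficient \<Delta> f G L u"
  shows "F \<in> qmodule \<Delta> G"
proof -
  note qm = quadratic_module_qmodule[OF G]
  have Fp: "F \<in> polys \<Delta>" by (intro polys_add f shift_polys)
  have Wp: "F - \<theta> \<in> polys \<Delta>" using \<theta> qm Fp unfolding quadratic_module_def by blast
  define b where "b = rem2 \<Delta> w (F - \<theta>)"
  have cmp: "peval (F - \<theta>) w = 0" "(\<Sum>s\<in>\<Delta>. partial s (peval (F - \<theta>)) w * v $ s) = 0" "quad_form \<Delta> b w v = R v 0" for v
  proof -
    have cont: "isCont (\<lambda>t. quad_form \<Delta> b (w + t *\<^sub>R v) v) 0" by (intro continuous_intros)
    have "peval (F - \<theta>) w + t * (\<Sum>s\<in>\<Delta>. partial s (peval (F - \<theta>)) w * v $ s)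
        + t\<^sup>2 * quad_form \<Delta> b (w + t *\<^sub>R v) v = t\<^sup>2 * R v t" for t
      using remainder_line[of t v] unfolding rem2_line[OF Wp] b_def .
    from second_order_comparison[OF cont R_cont this]
    show "peval (F - \<theta>) w = 0" "(\<Sum>s\<in>\<Delta>. partial s (peval (F - \<theta>)) w * v $ s) = 0" "quad_form \<Delta> b w v = R v 0"
      by simp_all
  qed
  have "partial s (peval (F - \<theta>)) w = 0" if "s \<in> \<Delta>" for s
  proof -
    have "(\<Sum>q\<in>\<Delta>. partial q (peval (F - \<theta>)) w * axis s (1::real) $ q)
        = (\<Sum>q\<in>\<Delta>. if q = s then partial s (peval (F - \<theta>)) w else 0)"
      by (intro sum.cong refl) (auto simp: axis_def)
    then show ?thesis using cmp(2)[of "axis s 1"] that by simp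
  qed
  note b = rem2_critical[OF Wp cmp(1) this, folded b_def]
  obtain \<rho> where \<rho>: "ball_poly \<Delta> \<rho> \<in> qmodule \<Delta> G"
    using arch unfolding archimedean_qmodule_def ball_poly_def by blast
  have Kiff: "(\<forall>g\<in>qmodule \<Delta> G. 0 \<le> peval g x) \<longleftrightarrow> psd (mat_peval G x)" for x
    using psd_if_qmodule_nonneg[OF G] qmodule_nonneg[OF G] by blast
  show ?thesis
  proof (rule nondegenerate_zero_in_module[OF qm \<rho> w _ Fp _ _ \<theta> b(2) b(1)])
    show "\<forall>g\<in>qmodule \<Delta> G. 0 \<le> peval g w" using Kiff feas by blast
    show "peval F w = 0" using F_line[of 0 0] bil_Gw_gram by simp
    show "0 < quad_form \<Delta> b w v" if "v \<in> coord_space \<Delta>" "v \<noteq> 0" for v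
      unfolding cmp(3) by (rule R_pos[OF rank sosc that])
    show "0 < peval F x" if x: "x \<in> coord_space \<Delta>" "\<forall>g\<in>qmodule \<Delta> G. 0 \<le> peval g x" "x \<noteq> w" for x
    proof (rule ccontr)
      assume neg: "\<not> 0 < peval F x"
      define v where "v = x - w"
      have v: "v \<in> coord_space \<Delta>" "v \<noteq> 0" using x(1,3) w by (auto simp: v_def)
      have psdx: "0 \<le> bil l (Gv x) z z" for z using x(2) Kiff psd_bil by blast
      have bound: "quad_form \<Delta> b (w + t *\<^sub>R v) v \<le> 0" if t: "0 < t" "t < 1" for t
      proof -
        have xt: "w + t *\<^sub>R v = t *\<^sub>R x + (1 - t) *\<^sub>R w" by (simp add: v_def algebra_simps)
        have "0 \<le> bil l (Gv (w + t *\<^sub>R v)) z z" for z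
        proof -
          have "0 \<le> t * bil l (Gv x) z z + (1 - t) * bil l (Gv w) z z" using t Gw_psd[of z] psdx[of z] by simp
          also have "\<dots> \<le> bil l (Gv (w + t *\<^sub>R v)) z z" unfolding xt using concave_form[OF x(1) w] t by simp
          finally show ?thesis .
        qed
        then have "0 \<le> peval \<theta> (w + t *\<^sub>R v)" using Kiff \<theta> psd_bil by blast
        moreover have "peval F (w + t *\<^sub>R v) \<le> t * peval F x"
        proof -
          have "w + t *\<^sub>R v = (1 - t) *\<^sub>R w + t *\<^sub>R x" by (simp add: v_def algebra_simps)
          then have "peval f (w + t *\<^sub>R v) \<le> (1 - t) * peval f w + t * peval f x"
            using convex_onD[OF f_convex, of t w x] t x(1) w by simp
          moreover have sx: "peval shift x = - peval f w - (\<Sum>j\<in>\<Delta>. partial j (peval lag) w * v $ j)"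
            using peval_shift_line[of 1 v] by (simp add: v_def)
          ultimately show ?thesis
            unfolding peval_add peval_shift_line sx by (simp add: algebra_simps)
        qed
        moreover have "t * peval F x \<le> 0" using t neg by (simp add: mult_le_0_iff)
        ultimately have "peval (F - \<theta>) (w + t *\<^sub>R v) \<le> 0" unfolding peval_diff by linarith
        then have "t\<^sup>2 * quad_form \<Delta> b (w + t *\<^sub>R v) v \<le> 0"
          unfolding rem2_line[OF Wp] b_def[symmetric] cmp(1) cmp(2)[of v] by simp
        then show ?thesis using t(1) by (simp add: mult_le_0_iff)
      qed
      have "isCont (\<lambda>t. quad_form \<Delta> b (w + t *\<^sub>R v) v) 0" by (intro continuous_intros)
      from isCont_upper_bound[OF this bound] have "quad_form \<Delta> b w v \<le> 0" by simp
      then show False using R_pos[OF rank sosc v] cmp(3)[of v] by simp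
    qed
  qed
qed

end

section \<open>Assembling the blocks\<close>

lemma partial_add: "partial j (peval (p + q)) x = partial j (peval p) x + partial j (peval q) x"
  unfolding partial_def[of _ "peval (p + q)"]
  by (rule DERIV_imp_deriv) (use DERIV_add[OF peval_has_partial peval_has_partial] in simp)

lemma partial_const_mult: "partial j (peval (pconst c * p)) x = c * partial j (peval p) x"
  unfolding partial_def[of _ "peval (pconst c * p)"]
  by (rule DERIV_imp_deriv) (use DERIV_cmult[OF peval_has_partial] in simp)

lemma partial_diff: "partial j (peval (p - q)) x = partial j (peval p) x - partial j (peval q) x"
  using partial_add[of j "p - q" q x] by simp

lemma partial_sum: "partial j (peval (sum g A)) x = (\<Sum>a\<in>A. partial j (peval (g a)) x)"
proof (induction A rule: infinite_finite_induct)
  case (infinite A)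
  then show ?case by (simp add: partial_def)
next
  case empty
  show ?case by (simp add: partial_def)
next
  case (insert a A)
  then show ?case using partial_add[of j "g a" "sum g A" x] by (simp del: peval_add peval_sum)
qed

context convex_block
begin

lemma partial_lag: "partial j (peval lag) w = partial j (peval f) u - nabla_adj G w L $ j"
proof -
  have "nabla_adj G w L $ j = (\<Sum>a<l. \<Sum>b<l. mat_partial j G w $$ (a, b) * L $$ (b, a))"
    unfolding nabla_adj_def using Gd(1) by (simp add: mat_inner_expand[OF _ Ld(1)] mat_partial_def)
  also have "\<dots> = (\<Sum>b<l. \<Sum>a<l. mat_partial j G w $$ (a, b) * L $$ (b, a))" by (rule sum.swap)
  also have "\<dots> = (\<Sum>b<l. \<Sum>a<l. L $$ (b, a) * partial j (peval (G $$ (a, b))) w)"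
    using Gd(1) by (intro sum.cong refl) (simp add: mat_partial_def)
  finally have "nabla_adj G w L $ j = (\<Sum>b<l. \<Sum>a<l. L $$ (b, a) * partial j (peval (G $$ (a, b))) w)" .
  moreover have "partial j (peval f) w = partial j (peval f) u"
    by (rule partial_cong_polys[OF f]) (simp add: coord_proj_def)
  ultimately show ?thesis
    unfolding lag_def partial_diff partial_sum partial_const_mult by simp
qed

text \<open>Outside \<open>\<Delta>\<close> the coefficients vanish. With all variables and the base point \<open>u\<close> the shifts of different
  blocks can be added coefficient by coefficient.\<close>

lemma shift_full:
  "shift = - pconst (peval f u) - (\<Sum>j\<in>UNIV. pconst (partial j (peval f) u - nabla_adj G w L $ j) * (pvar j - pconst (u $ j)))"
proof -
  have "(\<Sum>j\<in>\<Delta>. pconst (partial j (peval lag) w) * (pvar j - pconst (w $ j)))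
      = (\<Sum>j\<in>\<Delta>. pconst (partial j (peval lag) w) * (pvar j - pconst (u $ j)))"
    by (intro sum.cong refl) (simp add: coord_proj_def)
  also have "\<dots> = (\<Sum>j\<in>UNIV. pconst (partial j (peval lag) w) * (pvar j - pconst (u $ j)))"
    by (intro sum.mono_neutral_left) (auto simp: partial_outside[OF lag_polys])
  finally show ?thesis
    unfolding shift_def peval_coord_proj[OF f] partial_lag by (simp only:)
qed

end

theorem theorem5p1:
  fixes m :: nat
    and \<Delta> :: "nat \<Rightarrow> ('n::finite) set"
    and l :: "nat \<Rightarrow> nat"
    and f :: "nat \<Rightarrow> 'n mpoly"
    and G :: "nat \<Rightarrow> 'n mpoly mat"
    and \<Lambda> :: "nat \<Rightarrow> real mat"
    and u :: "real ^ 'n"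
    and fmin :: real
  assumes cover: "(\<Union>i\<in>{1..m}. \<Delta> i) = UNIV"
    and f_sparse: "\<forall>i\<in>{1..m}. f i \<in> polys (\<Delta> i)"
    and G_sparse: "\<forall>i\<in>{1..m}. G i \<in> sym_poly_mats (\<Delta> i) (l i)"
    and minimizer: "u \<in> feasible m \<Delta> G"
      "\<forall>x\<in>feasible m \<Delta> G. peval (\<Sum>i=1..m. f i) u \<le> peval (\<Sum>i=1..m. f i) x"
    and fmin: "fmin = peval (\<Sum>i=1..m. f i) u"
    and first_order: "first_order_optimality m \<Delta> f G u \<Lambda>"
    and f_convex: "\<forall>i\<in>{1..m}. convex_on (coord_space (\<Delta> i)) (peval (f i))"
    and G_concave: "\<forall>i\<in>{1..m}. mat_concave_on (coord_space (\<Delta> i)) (mat_peval (G i))"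
  shows
    "(\<exists>p. (\<forall>i\<in>{1..m}. p i \<in> polys (\<Delta> i)) \<and>
        (\<Sum>i=1..m. p i) + pconst fmin = 0 \<and>
        (\<forall>i\<in>{1..m}. \<forall>z\<in>block_feasible (\<Delta> i) (G i). peval (f i + p i) z \<ge> 0)) \<and>
     ((\<forall>i\<in>{1..m}. archimedean_qmodule (\<Delta> i) (G i)) \<and>
      (\<forall>i\<in>{1..m}.
        nondegenerate (\<Delta> i) (G i) (coord_proj (\<Delta> i) u) \<and>
        mat_rank (mat_peval (G i) (coord_proj (\<Delta> i) u)) + mat_rank (\<Lambda> i) = l i \<and>
        second_order_sufficient (\<Delta> i) (f i) (G i) (\<Lambda> i) u)
      \<longrightarrow>
      hierarchy_tight m \<Delta> f G fmin \<and>
      (\<exists>K. \<forall>k\<ge>K. (\<Sum>i=1..m. f i) - pconst fmin \<in> sparse_qmodule m \<Delta> G (2 * k)))"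
proof -
  have block: "convex_block (\<Delta> i) (l i) (f i) (G i) (\<Lambda> i) u" if i: "i \<in> {1..m}" for i
  proof -
    have Gi: "G i \<in> sym_poly_mats (\<Delta> i) (l i)" using G_sparse i by blast
    have dim: "dim_row (G i) = l i" using sym_poly_matsD(1)[OF Gi] by simp
    show ?thesis
      using first_order i f_sparse Gi f_convex G_concave unfolding first_order_optimality_def dim[symmetric]
      by unfold_locales blast+
  qed
  define p where "p i = convex_block.shift (\<Delta> i) (l i) (f i) (G i) (\<Lambda> i) u" for i
  have p_polys: "\<forall>i\<in>{1..m}. p i \<in> polys (\<Delta> i)"
    unfolding p_def using convex_block.shift_polys[OF block] by blast
  have p_sum: "(\<Sum>i=1..m. p i) + pconst fmin = 0"
  proof -
    let ?g = "\<lambda>i j. partial j (peval (f i)) u - nabla_adj (G i) (coord_proj (\<Delta> i) u) (\<Lambda> i) $ j"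
    have grad: "(\<Sum>i=1..m. ?g i j) = 0" for j
    proof -
      have "gradient (peval (\<Sum>i=1..m. f i)) u $ j = (\<Sum>i=1..m. nabla_adj (G i) (coord_proj (\<Delta> i) u) (\<Lambda> i)) $ j"
        using first_order unfolding first_order_optimality_def by simp
      then show ?thesis by (simp add: gradient_def partial_sum sum_subtractf)
    qed
    have "(\<Sum>i=1..m. p i) = (\<Sum>i=1..m. - pconst (peval (f i) u)
        - (\<Sum>j\<in>UNIV. pconst (?g i j) * (pvar j - pconst (u $ j))))"
      unfolding p_def by (intro sum.cong refl convex_block.shift_full[OF block])
    also have "\<dots> = - pconst (\<Sum>i=1..m. peval (f i) u)
        - (\<Sum>i=1..m. \<Sum>j\<in>UNIV. pconst (?g i j) * (pvar j - pconst (u $ j)))"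
      by (simp only: sum_subtractf sum_negf pconst_sum)
    also have "(\<Sum>i=1..m. \<Sum>j\<in>UNIV. pconst (?g i j) * (pvar j - pconst (u $ j)))
        = (\<Sum>j\<in>UNIV. \<Sum>i=1..m. pconst (?g i j) * (pvar j - pconst (u $ j)))"
      by (rule sum.swap)
    also have "\<dots> = (\<Sum>j\<in>UNIV. pconst (\<Sum>i=1..m. ?g i j) * (pvar j - pconst (u $ j)))"
      by (simp only: pconst_sum sum_distrib_right)
    also have "\<dots> = 0" unfolding grad by simp
    finally show ?thesis by (simp add: fmin)
  qed
  have m: "1 \<le> m"
  proof (rule ccontr)
    assume "\<not> 1 \<le> m"
    then have "{1..m} = {}" by simp
    then show False using cover by simp
  qed
  show ?thesis
  proof (intro conjI impI exI[of _ p] p_polys p_sum ballI)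
    fix i z assume i: "i \<in> {1..m}" and z: "z \<in> block_feasible (\<Delta> i) (G i)"
    show "0 \<le> peval (f i + p i) z"
      unfolding p_def by (rule convex_block.shifted_objective_nonneg[OF block[OF i] z])
  next
    assume h: "(\<forall>i\<in>{1..m}. archimedean_qmodule (\<Delta> i) (G i)) \<and>
      (\<forall>i\<in>{1..m}.
        nondegenerate (\<Delta> i) (G i) (coord_proj (\<Delta> i) u) \<and>
        mat_rank (mat_peval (G i) (coord_proj (\<Delta> i) u)) + mat_rank (\<Lambda> i) = l i \<and>
        second_order_sufficient (\<Delta> i) (f i) (G i) (\<Lambda> i) u)"
    have "\<forall>i\<in>{1..m}. f i + p i \<in> qmodule (\<Delta> i) (G i)"
    proof
      fix i assume i: "i \<in> {1..m}"
      show "f i + p i \<in> qmodule (\<Delta> i) (G i)"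
        unfolding p_def using h i by (intro convex_block.shifted_objective_in_qmodule[OF block[OF i]]) blast+
    qed
    note tight = hierarchy_tight_if_certified[OF m f_sparse G_sparse minimizer(1) fmin p_sum this]
    from tight show "hierarchy_tight m \<Delta> f G fmin" by (rule conjunct1)
    from tight show "\<exists>K. \<forall>k\<ge>K. (\<Sum>i=1..m. f i) - pconst fmin \<in> sparse_qmodule m \<Delta> G (2 * k)"
      by (rule conjunct2)
  qed
qed

end
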